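(* Let $G$ be a plane series-parallel 4-graph, let $T$ be an SPQ$^*$-tree of $G$, and let $\rho$ be the root of $T$. The cumulative budget $B_\rho$ equals the number of bends of a bend-minimum orthogonal representation of $G$.
   Context: A 4-graph has maximum vertex degree at most $4$. A plane graph is a planar graph with a fixed planar embedding and external face. An (embedding-preserving) orthogonal representation of a plane 4-graph assigns to every angle between consecutive edges around a vertex a value in $\{90^\circ,180^\circ,270^\circ,360^\circ\}$ ($360^\circ$ only at degree-1 vertices) and to every edge a finite ordered sequence of bends, each bend forming $90^\circ$ in one incident face and $270^\circ$ in the other, so that (1) angles at each vertex sum to $360^\circ$; (2) for each face $f$, $N_{90}(f)-N_{270}(f)-2N_{360}(f)$ is $4$ if $f$ is internal and $-4$ if $f$ is external, $N_a(f)$ being the number of $a^\circ$ angles (at vertices and bends) in $f$. It is bend-minimum if its total number of bends is minimum. Series-parallel graphs (with source and sink) are built from single edges by series compositions (identify the sink of each graph with the source of the next) and parallel compositions (identify all sources and all sinks). If $G$ is biconnected, $e$ is any edge on the external face; otherwise $e$ is a dummy edge added in the external face to make $G$ biconnected. A dummy edge is treated as an edge of the graph in all definitions (degrees at most four included), but it is not drawn: its bends are not counted. The SPQ$^*$-tree $T$ with respect to $e$ is the rooted decomposition tree whose leaves are Q$^*$-nodes (each representing a path of one or more edges), whose S-nodes (P-nodes) represent series (parallel) compositions of the graphs of their children, and whose root $\rho$ is a P-node with two children, one being the Q$^*$-node of $e$; no non-root P-node has a P-node child and no S-node has an S-node child; non-root P-nodes have two or three children. $G_\nu$ is the subgraph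 formed by the edges in the Q$^*$-nodes of the subtree at $\nu$ ($G_\rho$ is the whole graph). For a subdivision $G'_\nu$ of $G_\nu$ (obtained by placing degree-2 vertices on edges of $G_\nu$), $G'_\nu$ is called rectilinear planar if the plane graph obtained from $G$ by replacing $G_\nu$ with $G'_\nu$ has an orthogonal representation in which no edge of $G'_\nu$ has a bend. Budgets (bottom-up visit of $T$). If $\nu$ is a leaf, $b_\nu=B_\nu=0$. If $\nu$ is an internal node with children $\mu_1,\dots,\mu_h$, the budget $b_\nu$ is the minimum number of extra subdivision vertices that must be inserted along the edges of $G_\nu$, besides those already inserted for its children, to make it rectilinear planar: that is, the minimum $k\ge0$ such that one can insert $B_{\mu_i}$ subdivision vertices in each $G_{\mu_i}$ so as to make it rectilinear planar, and then $k$ further subdivision vertices along edges of $G_\nu$, so that the resulting subdivision of $G_\nu$ is rectilinear planar; the cumulative budget is $B_\nu=b_\nu+\sum_{i=1}^h B_{\mu_i}$. (In particular $b_\nu=0$ for S-nodes.) If $e$ is a dummy edge, $b_\rho=0$. *)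

theory Defs
  imports "Graph_Theory.Graph_Theory"
begin

section \<open>Plane graphs\<close>

text \<open>
  An undirected multigraph is a bidirected digraph: every edge consists of two opposite arcs
  exchanged by \<^emph>\<open>rv\<close>. A planar embedding is given combinatorially by its rotation system:
  \<^emph>\<open>nxt\<close> maps an arc to the next arc around its tail, in a fixed orientation of the plane.
  A face is the set of arcs having it on a fixed side; walking along the boundary of a face
  one arrives at the head of \<^emph>\<open>a\<close> and continues with the successor of the reverse of \<^emph>\<open>a\<close>.
  The external face is the face \<^emph>\<open>outer\<close>.
\<close>

record 'd embedding =
  rv :: "'d \<Rightarrow> 'd"
  nxt :: "'d \<Rightarrow> 'd"
  outer :: "'d set"

definition faces :: "('v, 'd) pre_digraph \<Rightarrow> 'd embedding \<Rightarrow> 'd set set" where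
  "faces G M = orbit (nxt M \<circ> rv M) ` arcs G"

text \<open>A rotation system of a connected graph is a planar embedding iff it satisfies
  Euler's formula; \<^emph>\<open>arcs G\<close> contains two arcs per edge.\<close>

locale plane_graph = fin_digraph G + bidirected_digraph G "rv M"
  for G :: "('v, 'd) pre_digraph" and M :: "'d embedding" +
  assumes nxt_permutes: "nxt M permutes arcs G"
    and nxt_cyclic:
      "\<And>v. v \<in> verts G \<Longrightarrow> out_arcs G v \<noteq> {} \<Longrightarrow> cyclic_on (nxt M) (out_arcs G v)"
    and connected: "connected G"
    and euler: "card (verts G) + card (faces G M) = card (arcs G) div 2 + 2"
    and outer_face: "outer M \<in> faces G M"

text \<open>In a bidirected digraph the out-degree of a vertex is its degree as an undirected graph.\<close>

definition four_graph :: "('v, 'd) pre_digraph \<Rightarrow> bool" where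
  "four_graph G \<longleftrightarrow> (\<forall>v \<in> verts G. out_degree G v \<le> 4)"

text \<open>Two parallel edges are biconnected, a single edge is not: it has no SPQ*-tree unless a
  dummy edge is added.\<close>

definition biconnected :: "('v, 'd) pre_digraph \<Rightarrow> bool" where
  "biconnected G \<longleftrightarrow> connected G \<and> 4 \<le> card (arcs G) \<and>
     (\<forall>v \<in> verts G. connected (pre_digraph.del_vert G v))"

section \<open>Orthogonal representations\<close>

text \<open>
  \<^emph>\<open>angle R a\<close> is the angle at the tail of \<^emph>\<open>a\<close> between \<^emph>\<open>a\<close> and \<^emph>\<open>nxt a\<close>.
  \<^emph>\<open>bends R a\<close> lists, in the direction of \<^emph>\<open>a\<close>, the angles that the bends of the edge of
  \<^emph>\<open>a\<close> form in the face containing the arc \<^emph>\<open>a\<close>.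
\<close>

record 'd orth_rep =
  angle :: "'d \<Rightarrow> nat"
  bends :: "'d \<Rightarrow> nat list"

text \<open>The corner of a face between an arc \<^emph>\<open>a\<close> and the next arc \<^emph>\<open>nxt (rv a)\<close> on its boundary
  is the one whose angle is \<^emph>\<open>angle R (rv a)\<close>.\<close>

definition num_angles :: "'d embedding \<Rightarrow> 'd orth_rep \<Rightarrow> 'd set \<Rightarrow> nat \<Rightarrow> nat" where
  "num_angles M R f x =
     card {a \<in> f. angle R (rv M a) = x} + (\<Sum>a\<in>f. count_list (bends R a) x)"

definition orthogonal_representation ::
    "('v, 'd) pre_digraph \<Rightarrow> 'd embedding \<Rightarrow> 'd orth_rep \<Rightarrow> bool" where
  "orthogonal_representation G M R \<longleftrightarrow>
     (\<forall>a \<in> arcs G. angle R a \<in> {90, 180, 270, 360}) \<and>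
     (\<forall>a \<in> arcs G. angle R a = 360 \<longrightarrow> out_degree G (tail G a) = 1) \<and>
     (\<forall>a \<in> arcs G. set (bends R a) \<subseteq> {90, 270} \<and>
        bends R (rv M a) = rev (map (\<lambda>x. 360 - x) (bends R a))) \<and>
     (\<forall>v \<in> verts G. (\<Sum>a \<in> out_arcs G v. angle R a) = 360) \<and>
     (\<forall>f \<in> faces G M.
        int (num_angles M R f 90) - int (num_angles M R f 270) - 2 * int (num_angles M R f 360)
          = (if f = outer M then - 4 else 4))"

section \<open>Reference edge and drawn graph\<close>

text \<open>
  The plane graph \<^emph>\<open>G\<close> contains the reference edge \<^emph>\<open>e\<close> (given by one of its arcs), be it an
  edge of the original graph or a dummy edge; the flag \<^emph>\<open>dummy\<close> tells which. The original
  graph, i.e. the drawn part of \<^emph>\<open>G\<close>, is obtained by omitting a dummy edge.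
\<close>

definition drawn_graph ::
    "('v, 'd) pre_digraph \<Rightarrow> 'd embedding \<Rightarrow> 'd \<Rightarrow> bool \<Rightarrow> ('v, 'd) pre_digraph" where
  "drawn_graph G M e dummy =
     (if dummy then pre_digraph.del_arc (pre_digraph.del_arc G e) (rv M e) else G)"

definition reference_edge ::
    "('v, 'd) pre_digraph \<Rightarrow> 'd embedding \<Rightarrow> 'd \<Rightarrow> bool \<Rightarrow> bool" where
  "reference_edge G M e dummy \<longleftrightarrow>
     e \<in> outer M \<and> biconnected G \<and> (dummy \<longleftrightarrow> \<not> biconnected (drawn_graph G M e dummy))"

text \<open>Each bend of an edge is listed once for each of its two arcs.\<close>

definition num_bends ::
    "('v, 'd) pre_digraph \<Rightarrow> 'd embedding \<Rightarrow> 'd \<Rightarrow> bool \<Rightarrow> 'd orth_rep \<Rightarrow> nat" where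
  "num_bends G M e dummy R = (\<Sum>a \<in> arcs (drawn_graph G M e dummy). length (bends R a)) div 2"

definition bend_minimum ::
    "('v, 'd) pre_digraph \<Rightarrow> 'd embedding \<Rightarrow> 'd \<Rightarrow> bool \<Rightarrow> 'd orth_rep \<Rightarrow> bool" where
  "bend_minimum G M e dummy R \<longleftrightarrow> orthogonal_representation G M R \<and>
     (\<forall>R'. orthogonal_representation G M R' \<longrightarrow>
        num_bends G M e dummy R \<le> num_bends G M e dummy R')"

section \<open>Series-parallel graphs\<close>

text \<open>The subgraph of \<^emph>\<open>G\<close> formed by the edges in \<^emph>\<open>A\<close> has vertex set \<^emph>\<open>ends G A\<close>.
  Sets of arcs representing subgraphs are closed under reversal.\<close>

definition ends :: "('v, 'd) pre_digraph \<Rightarrow> 'd set \<Rightarrow> 'v set" where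
  "ends G A = tail G ` A \<union> head G ` A"

text \<open>\<^emph>\<open>series_parallel_between G M A s t\<close>: the edges in \<^emph>\<open>A\<close> form a series-parallel graph
  with source \<^emph>\<open>s\<close> and sink \<^emph>\<open>t\<close>.\<close>

inductive series_parallel_between ::
    "('v, 'd) pre_digraph \<Rightarrow> 'd embedding \<Rightarrow> 'd set \<Rightarrow> 'v \<Rightarrow> 'v \<Rightarrow> bool"
  for G M where
  edge: "a \<in> arcs G \<Longrightarrow> tail G a = s \<Longrightarrow> head G a = t \<Longrightarrow> s \<noteq> t \<Longrightarrow>
    series_parallel_between G M {a, rv M a} s t"
| series: "series_parallel_between G M A s w \<Longrightarrow> series_parallel_between G M B w t \<Longrightarrow>
    ends G A \<inter> ends G B = {w} \<Longrightarrow> series_parallel_between G M (A \<union> B) s t"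
| parallel: "series_parallel_between G M A s t \<Longrightarrow> series_parallel_between G M B s t \<Longrightarrow>
    A \<inter> B = {} \<Longrightarrow> ends G A \<inter> ends G B = {s, t} \<Longrightarrow> series_parallel_between G M (A \<union> B) s t"

definition series_parallel :: "('v, 'd) pre_digraph \<Rightarrow> 'd embedding \<Rightarrow> bool" where
  "series_parallel G M \<longleftrightarrow>
     (\<exists>s t. series_parallel_between G M (arcs G) s t \<and> ends G (arcs G) = verts G)"

section \<open>SPQ*-trees\<close>

text \<open>A Q*-node carries the list of arcs of its path, directed from source to sink. The children
  of an S-node are listed from source to sink.\<close>

datatype 'd spq = QStar "'d list" | SNode "'d spq list" | PNode "'d spq list"

fun children :: "'d spq \<Rightarrow> 'd spq list" where
  "children (QStar p) = []"
| "children (SNode ts) = ts"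
| "children (PNode ts) = ts"

fun node_arcs :: "'d embedding \<Rightarrow> 'd spq \<Rightarrow> 'd set" where
  "node_arcs M (QStar p) = set p \<union> rv M ` set p"
| "node_arcs M (SNode ts) = (\<Union>t \<in> set ts. node_arcs M t)"
| "node_arcs M (PNode ts) = (\<Union>t \<in> set ts. node_arcs M t)"

text \<open>\<^emph>\<open>decomposes G M T s t\<close>: the subgraph of \<^emph>\<open>T\<close> arises, with source \<^emph>\<open>s\<close> and sink \<^emph>\<open>t\<close>, by
  the compositions prescribed by \<^emph>\<open>T\<close>. The graphs that are composed share no vertices except the
  identified sources and sinks, and no edges.\<close>

inductive decomposes ::
    "('v, 'd) pre_digraph \<Rightarrow> 'd embedding \<Rightarrow> 'd spq \<Rightarrow> 'v \<Rightarrow> 'v \<Rightarrow> bool"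
  for G M where
  QStar: "p \<noteq> [] \<Longrightarrow> pre_digraph.apath G s p t \<Longrightarrow> decomposes G M (QStar p) s t"
| SNode: "2 \<le> length ts \<Longrightarrow> length ws = length ts + 1 \<Longrightarrow>
    (\<And>i. i < length ts \<Longrightarrow> decomposes G M (ts ! i) (ws ! i) (ws ! (i + 1))) \<Longrightarrow>
    (\<And>i j. i < j \<Longrightarrow> j < length ts \<Longrightarrow>
       ends G (node_arcs M (ts ! i)) \<inter> ends G (node_arcs M (ts ! j))
         = (if j = i + 1 then {ws ! j} else {})) \<Longrightarrow>
    decomposes G M (SNode ts) (hd ws) (last ws)"
| PNode: "2 \<le> length ts \<Longrightarrow>
    (\<And>i. i < length ts \<Longrightarrow> decomposes G M (ts ! i) s t) \<Longrightarrow>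
    (\<And>i j. i < j \<Longrightarrow> j < length ts \<Longrightarrow>
       node_arcs M (ts ! i) \<inter> node_arcs M (ts ! j) = {} \<and>
       ends G (node_arcs M (ts ! i)) \<inter> ends G (node_arcs M (ts ! j)) = {s, t}) \<Longrightarrow>
    decomposes G M (PNode ts) s t"

fun proper_node :: "'d spq \<Rightarrow> bool" where
  "proper_node (QStar p) \<longleftrightarrow> True"
| "proper_node (SNode ts) \<longleftrightarrow> (\<forall>t \<in> set ts. proper_node t \<and> (\<forall>us. t \<noteq> SNode us))"
| "proper_node (PNode ts) \<longleftrightarrow>
     length ts \<in> {2, 3} \<and> (\<forall>t \<in> set ts. proper_node t \<and> (\<forall>us. t \<noteq> PNode us))"

definition spq_tree ::
    "('v, 'd) pre_digraph \<Rightarrow> 'd embedding \<Rightarrow> 'd \<Rightarrow> 'd spq \<Rightarrow> bool" where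
  "spq_tree G M e T \<longleftrightarrow>
     (\<exists>s t. decomposes G M T s t) \<and>
     node_arcs M T = arcs G \<and> ends G (arcs G) = verts G \<and>
     (\<exists>t1 t2. T = PNode [t1, t2] \<and> proper_node t1 \<and> proper_node t2 \<and>
        (\<exists>p. QStar p \<in> {t1, t2} \<and> e \<in> node_arcs M (QStar p)))"

section \<open>Subdivisions\<close>

text \<open>
  An edge is identified with the set of its two arcs; \<^emph>\<open>n E\<close> is the number of subdivision vertices
  placed on the edge \<^emph>\<open>E\<close>. An edge with arcs \<^emph>\<open>a\<close> and \<^emph>\<open>rv a\<close> carrying \<^emph>\<open>k\<close> subdivision vertices
  is replaced by a path with arcs \<^emph>\<open>(a, 0)\<close>, ..., \<^emph>\<open>(a, k)\<close>, in the direction of \<^emph>\<open>a\<close>; the reverse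
  of \<^emph>\<open>(a, i)\<close> is \<^emph>\<open>(rv a, k - i)\<close>. A subdivision vertex is the set of the two arcs leaving it.
\<close>

definition edge_of :: "'d embedding \<Rightarrow> 'd \<Rightarrow> 'd set" where
  "edge_of M a = {a, rv M a}"

definition sub_arcs ::
    "('v, 'd) pre_digraph \<Rightarrow> 'd embedding \<Rightarrow> ('d set \<Rightarrow> nat) \<Rightarrow> ('d \<times> nat) set" where
  "sub_arcs G M n = {(a, i). a \<in> arcs G \<and> i \<le> n (edge_of M a)}"

definition sub_tail ::
    "('v, 'd) pre_digraph \<Rightarrow> 'd embedding \<Rightarrow> ('d set \<Rightarrow> nat) \<Rightarrow> 'd \<times> nat \<Rightarrow> 'v + ('d \<times> nat) set" where
  "sub_tail G M n = (\<lambda>(a, i).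
     if i = 0 then Inl (tail G a) else Inr {(a, i), (rv M a, n (edge_of M a) + 1 - i)})"

definition sub_emb ::
    "('v, 'd) pre_digraph \<Rightarrow> 'd embedding \<Rightarrow> ('d set \<Rightarrow> nat) \<Rightarrow> ('d \<times> nat) embedding" where
  "sub_emb G M n = \<lparr>
     rv = (\<lambda>(a, i). if (a, i) \<in> sub_arcs G M n then (rv M a, n (edge_of M a) - i) else (a, i)),
     nxt = (\<lambda>(a, i). if (a, i) \<notin> sub_arcs G M n then (a, i)
                     else if i = 0 then (nxt M a, 0)
                     else (rv M a, n (edge_of M a) + 1 - i)),
     outer = {(a, i) \<in> sub_arcs G M n. a \<in> outer M} \<rparr>"

definition sub_graph ::
    "('v, 'd) pre_digraph \<Rightarrow> 'd embedding \<Rightarrow> ('d set \<Rightarrow> nat) \<Rightarrow>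
     ('v + ('d \<times> nat) set, 'd \<times> nat) pre_digraph" where
  "sub_graph G M n = \<lparr>
     verts = Inl ` verts G \<union> sub_tail G M n ` sub_arcs G M n,
     arcs = sub_arcs G M n,
     tail = sub_tail G M n,
     head = (\<lambda>x. sub_tail G M n (rv (sub_emb G M n) x)) \<rparr>"

text \<open>\<^emph>\<open>n\<close> places a total of \<^emph>\<open>k\<close> subdivision vertices, all of them on edges in \<^emph>\<open>A\<close>.\<close>

definition subdivides :: "'d embedding \<Rightarrow> 'd set \<Rightarrow> nat \<Rightarrow> ('d set \<Rightarrow> nat) \<Rightarrow> bool" where
  "subdivides M A k n \<longleftrightarrow>
     (\<forall>E. E \<notin> edge_of M ` A \<longrightarrow> n E = 0) \<and> (\<Sum>E \<in> edge_of M ` A. n E) = k"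

definition rectilinear_planar ::
    "('v, 'd) pre_digraph \<Rightarrow> 'd embedding \<Rightarrow> 'd set \<Rightarrow> ('d set \<Rightarrow> nat) \<Rightarrow> bool" where
  "rectilinear_planar G M A n \<longleftrightarrow>
     (\<exists>R. orthogonal_representation (sub_graph G M n) (sub_emb G M n) R \<and>
        (\<forall>(a, i) \<in> sub_arcs G M n. a \<in> A \<longrightarrow> bends R (a, i) = []))"

section \<open>Budgets\<close>

text \<open>\<^emph>\<open>budget G M \<nu> bs\<close> is the budget of an internal node \<^emph>\<open>\<nu>\<close> whose children have the
  cumulative budgets \<^emph>\<open>bs\<close>. Each \<^emph>\<open>ns ! i\<close> makes the i-th child rectilinear planar on its own,
  and \<^emph>\<open>n\<close> combines these subdivisions with \<^emph>\<open>k\<close> further vertices.\<close>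

definition budget ::
    "('v, 'd) pre_digraph \<Rightarrow> 'd embedding \<Rightarrow> 'd spq \<Rightarrow> nat list \<Rightarrow> nat" where
  "budget G M \<nu> bs = (LEAST k.
     \<exists>ns m n. length ns = length (children \<nu>) \<and>
       (\<forall>i < length (children \<nu>).
          subdivides M (node_arcs M (children \<nu> ! i)) (bs ! i) (ns ! i) \<and>
          rectilinear_planar G M (node_arcs M (children \<nu> ! i)) (ns ! i)) \<and>
       subdivides M (node_arcs M \<nu>) k m \<and>
       n = (\<lambda>E. (\<Sum>i < length ns. (ns ! i) E) + m E) \<and>
       rectilinear_planar G M (node_arcs M \<nu>) n)"

fun cumulative_budget :: "('v, 'd) pre_digraph \<Rightarrow> 'd embedding \<Rightarrow> 'd spq \<Rightarrow> nat" where
  "cumulative_budget G M (QStar p) = 0"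
| "cumulative_budget G M (SNode ts) =
     (let bs = map (cumulative_budget G M) ts in budget G M (SNode ts) bs + sum_list bs)"
| "cumulative_budget G M (PNode ts) =
     (let bs = map (cumulative_budget G M) ts in budget G M (PNode ts) bs + sum_list bs)"

definition root_cumulative_budget ::
    "('v, 'd) pre_digraph \<Rightarrow> 'd embedding \<Rightarrow> bool \<Rightarrow> 'd spq \<Rightarrow> nat" where
  "root_cumulative_budget G M dummy T =
     (let bs = map (cumulative_budget G M) (children T)
      in (if dummy then 0 else budget G M T bs) + sum_list bs)"

end

theory Submission
  imports Defs
begin

text \<open>
  Write angles in multiples of 90 degrees. Since the first cohomology of the sphere vanishes (Euler's
  formula, via a spanning tree and its complementary dual tree), any two orthogonal
  representations differ by a rotation \<^emph>\<open>q a\<close> of every arc \<^emph>\<open>a\<close>, and conversely every \<^emph>\<open>q\<close> that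
  leaves all angles positive gives a representation. The constraints on \<^emph>\<open>q\<close> involve one vertex at a
  time and are differences, and the number of bends is a sum of convex functions of differences.
  Hence minima and maxima of solutions are solutions and the cost is submodular: a solution
  that costs \<^emph>\<open>k\<close> more than the optimum of a subgraph can be replaced by an optimal one at the
  price of changing the rotation between two given arcs by at most \<^emph>\<open>k\<close>.

  It follows that \<^emph>\<open>B\<close> of every node is the minimum number of bends of its subgraph. For series
  compositions optimal solutions of the children can be glued, since at a common vertex of degree
  at most 4 either one part has a single arc or all angles are right angles. For parallel
  compositions the degree bound provides all children but one with a single arc at the source.
  Replacing the children by optimal ones changes their rotations by at most what is saved, and
  this change is turned into bends on those single arcs.
\<close>

section \<open>Trees of darts\<close>

text \<open>The obstacle is the order of decisions that budgets impose. Each child must first be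
  subdivided with exactly its own optimal number of vertices, whereas a rotation that is optimal for
  the composition may bend a child more than the child needs on its own. It has to be shown that
  this bottom-up greed loses nothing: every unit of turning between the poles that a child gives up
  by moving to its own optimum must be paid for by one bend saved inside that child. Budgets are
  phrased with subdivision vertices and the theorem with bends. The bridge is that the two angles at
  a subdivision vertex are positive and sum to 360 degrees, so the vertex turns its edge by at most
  90 degrees, to either side; placing vertices on an edge is the same as granting it that many net
  bends. The constant 4 enters twice. It makes a vertex of degree 4 rigid, and at each pole of an
  inner P-node it leaves at most three arcs for two or three children, because one arc lies
  outside.\<close>

text \<open>A dart \<^emph>\<open>a\<close> runs from the node \<^emph>\<open>lab a\<close> to the node \<^emph>\<open>lab (r a)\<close>. With tails as labels
  this describes trees in the primal graph, with faces as labels trees in the dual graph.\<close>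

inductive dart_tree :: "('d \<Rightarrow> 'd) \<Rightarrow> ('d \<Rightarrow> 'n) \<Rightarrow> 'n set \<Rightarrow> 'd set \<Rightarrow> bool"
  for r lab where
  single: "dart_tree r lab {n} {}"
| grow: "dart_tree r lab N L \<Longrightarrow> lab a \<in> N \<Longrightarrow> lab (r a) \<notin> N \<Longrightarrow>
    dart_tree r lab (insert (lab (r a)) N) (insert a (insert (r a) L))"

context
  fixes r :: "'d \<Rightarrow> 'd" and lab :: "'d \<Rightarrow> 'n"
  assumes invol: "\<And>a. r (r a) = a"
begin

lemma dart_tree_finite:
  assumes "dart_tree r lab N L" shows "finite N \<and> finite L"
  using assms by induction auto

lemma dart_tree_labels:
  assumes "dart_tree r lab N L" "a \<in> L" shows "lab a \<in> N \<and> r a \<in> L"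
  using assms by (induction arbitrary: a) (auto simp: invol)

lemma dart_tree_new:
  assumes "dart_tree r lab N L" "lab (r a) \<notin> N" shows "a \<notin> L" "r a \<notin> L"
  using dart_tree_labels[OF assms(1)] assms(2) by (auto simp: invol)

text \<open>An edge has two darts, so a tree on k nodes has 2k - 2 of them. The counts for a
  spanning tree and for a dual tree are later compared with Euler's formula.\<close>

lemma dart_tree_card:
  assumes "dart_tree r lab N L" shows "card L + 2 = 2 * card N"
  using assms
proof induction
  case (grow N L a)
  have "a \<noteq> r a" using grow by auto
  then show ?case
    using grow dart_tree_finite[OF grow(1)] dart_tree_new[OF grow(1,3)] by simp
qed auto

text \<open>The new leaf carries a single dart, and among the old nodes only its parent gains one.
  Inductions over trees reduce balance conditions to this.\<close>

lemma dart_tree_grow_sum: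
  fixes y :: "'d \<Rightarrow> int"
  assumes "dart_tree r lab N L" "lab a \<in> N" "lab (r a) \<notin> N"
  defines "L' \<equiv> insert a (insert (r a) L)"
  shows "(\<Sum>b | b \<in> L' \<and> lab b = lab (r a). y b) = y (r a)"
    and "n \<in> N \<Longrightarrow> (\<Sum>b | b \<in> L' \<and> lab b = n. y b)
      = (if n = lab a then y a else 0) + (\<Sum>b | b \<in> L \<and> lab b = n. y b)"
proof -
  have fin: "finite L" using dart_tree_finite[OF assms(1)] by simp
  have "{b. b \<in> L' \<and> lab b = lab (r a)} = {r a}"
    using assms(2,3) dart_tree_labels[OF assms(1)] unfolding L'_def by force
  then show "(\<Sum>b | b \<in> L' \<and> lab b = lab (r a). y b) = y (r a)" by simp
  assume n: "n \<in> N"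
  have "{b. b \<in> L' \<and> lab b = n} = (if n = lab a then {a} else {}) \<union> {b. b \<in> L \<and> lab b = n}"
    using assms n by auto
  moreover have "a \<notin> L" by (rule dart_tree_new[OF assms(1,3)])
  ultimately show "(\<Sum>b | b \<in> L' \<and> lab b = n. y b)
      = (if n = lab a then y a else 0) + (\<Sum>b | b \<in> L \<and> lab b = n. y b)"
    using fin by (auto)
qed

text \<open>A leaf has only one dart, so conservation there makes its edge carry nothing; what
  remains is a circulation on a smaller tree.\<close>

lemma dart_tree_circulation_zero:
  fixes y :: "'d \<Rightarrow> int"
  assumes "dart_tree r lab N L" "\<And>a. a \<in> L \<Longrightarrow> y (r a) = - y a"
    and "\<And>n. n \<in> N \<Longrightarrow> (\<Sum>a | a \<in> L \<and> lab a = n. y a) = 0"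
    and "a \<in> L"
  shows "y a = 0"
  using assms
proof (induction arbitrary: a)
  case (grow N L b)
  have rb: "y (r b) = 0"
    using grow.prems(2)[of "lab (r b)"] dart_tree_grow_sum(1)[OF grow(1-3), of y] by simp
  then have yb: "y b = 0" using grow.prems(1)[of b] by simp
  have "y c = 0" if "c \<in> L" for c
  proof (rule grow.IH[OF _ _ that])
    show "\<And>a. a \<in> L \<Longrightarrow> y (r a) = - y a" using grow.prems(1) by blast
    show "(\<Sum>c | c \<in> L \<and> lab c = n. y c) = 0" if "n \<in> N" for n
      using dart_tree_grow_sum(2)[OF grow(1-3) that, of y] grow.prems(2)[of n] that yb
      by (simp split: if_splits)
  qed
  then show ?case using rb yb grow.prems(3) by blast
qed auto

text \<open>A tree has no cycles, so integrating an antisymmetric \<open>w\<close> along it meets no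
  obstruction.\<close>

lemma dart_tree_potential:
  fixes w :: "'d \<Rightarrow> int"
  assumes "dart_tree r lab N L" "\<And>a. a \<in> L \<Longrightarrow> w (r a) = - w a"
  obtains p where "\<And>a. a \<in> L \<Longrightarrow> p (lab (r a)) = p (lab a) + w a"
proof -
  have "\<exists>p. \<forall>a\<in>L. p (lab (r a)) = p (lab a) + w a"
    using assms
  proof induction
    case (grow N L a)
    then obtain p where p: "\<forall>b\<in>L. p (lab (r b)) = p (lab b) + w b" by blast
    define p' where "p' = p(lab (r a) := p (lab a) + w a)"
    have "p' (lab (r b)) = p' (lab b) + w b" if "b \<in> L" for b
      using p that grow(3) dart_tree_labels[OF grow(1) that]
        dart_tree_labels[OF grow(1), of "r b"] by (auto simp: p'_def)
    moreover have "p' (lab (r a)) = p' (lab a) + w a"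
      using grow(2,3) by (auto simp: p'_def)
    moreover have "p' (lab (r (r a))) = p' (lab (r a)) + w (r a)"
      using grow(2,3) grow.prems[of a] by (auto simp: p'_def invol)
    ultimately show ?case by blast
  qed auto
  then show ?thesis using that by blast
qed

text \<open>The whole demand of a leaf has to pass through its only edge, so it can be charged to
  the parent before that edge is removed.\<close>

lemma dart_tree_flow:
  fixes d :: "'n \<Rightarrow> int"
  assumes "dart_tree r lab N L" "(\<Sum>n\<in>N. d n) = 0"
  obtains y where "\<And>a. y (r a) = - y a" "\<And>a. a \<notin> L \<Longrightarrow> y a = 0"
    "\<And>n. n \<in> N \<Longrightarrow> (\<Sum>a | a \<in> L \<and> lab a = n. y a) = d n"
proof -
  have "\<exists>y. (\<forall>a. y (r a) = - y a) \<and> (\<forall>a. a \<notin> L \<longrightarrow> y a = 0) \<and>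
      (\<forall>n\<in>N. (\<Sum>a | a \<in> L \<and> lab a = n. y a) = d n)"
    using assms
  proof (induction arbitrary: d)
    case (single n)
    then show ?case by (intro exI[of _ "\<lambda>_. 0"]) auto
  next
    case (grow N L a)
    let ?n = "lab (r a)" and ?L = "insert a (insert (r a) L)"
    define d' where "d' = d(lab a := d (lab a) + d ?n)"
    have fin: "finite N" using dart_tree_finite[OF grow(1)] by simp
    have "(\<Sum>n\<in>N. d' n) = (\<Sum>n\<in>N. d n + (if n = lab a then d ?n else 0))"
      by (intro sum.cong) (auto simp: d'_def)
    also have "\<dots> = 0"
      using grow(2,3) grow.prems fin by (simp add: sum.distrib)
    finally obtain y where y: "\<And>a. y (r a) = - y a" "\<And>a. a \<notin> L \<Longrightarrow> y a = 0"
      "\<And>n. n \<in> N \<Longrightarrow> (\<Sum>a | a \<in> L \<and> lab a = n. y a) = d' n"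
      using grow.IH[of d'] by blast
    define y' where "y' = y(r a := d ?n, a := - d ?n)"
    have ne: "r a \<noteq> a" using grow by auto
    have new: "a \<notin> L" "r a \<notin> L" using dart_tree_new[OF grow(1,3)] by auto
    have anti: "y' (r b) = - y' b" for b
      using y(1)[of b] ne invol by (auto simp: y'_def) (metis invol)+
    have sumL: "(\<Sum>b | b \<in> L \<and> lab b = n. y' b) = (\<Sum>b | b \<in> L \<and> lab b = n. y b)" for n
      using new by (intro sum.cong) (auto simp: y'_def)
    have "(\<Sum>b | b \<in> ?L \<and> lab b = n. y' b) = d n" if "n \<in> N" for n
      unfolding dart_tree_grow_sum(2)[OF grow(1-3) that, of y'] sumL y(3)[OF that]
      by (auto simp: y'_def d'_def)
    moreover have "(\<Sum>b | b \<in> ?L \<and> lab b = ?n. y' b) = d ?n"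
      unfolding dart_tree_grow_sum(1)[OF grow(1-3), of y'] using ne by (simp add: y'_def)
    moreover have "y' b = 0" if "b \<notin> ?L" for b using that y(2) by (simp add: y'_def)
    ultimately show ?case using anti by blast
  qed
  then show ?thesis using that by blast
qed

text \<open>Connectivity is assumed as a cut condition, since this is what can be verified for the
  dual graph, where it says that tree arcs alone cut off no set of faces.\<close>

lemma spanning_dart_tree:
  assumes "finite N" "N \<noteq> {}" "\<And>a. a \<in> D \<Longrightarrow> r a \<in> D \<and> lab a \<in> N"
    and conn: "\<And>K. K \<noteq> {} \<Longrightarrow> K \<subset> N \<Longrightarrow> \<exists>a\<in>D. lab a \<in> K \<and> lab (r a) \<notin> K"
  obtains L where "dart_tree r lab N L" "L \<subseteq> D"
proof -
  have "\<exists>K L. K \<subseteq> N \<and> card K = Suc k \<and> L \<subseteq> D \<and> dart_tree r lab K L" if "k < card N" for k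
    using that
  proof (induction k)
    case 0
    from \<open>N \<noteq> {}\<close> obtain n where "n \<in> N" by blast
    then show ?case
      using dart_tree.single[of r lab n] by (intro exI[of _ "{n}"] exI[of _ "{}"]) auto
  next
    case (Suc k)
    then obtain K L where K: "K \<subseteq> N" "card K = Suc k" "L \<subseteq> D" "dart_tree r lab K L" by auto
    then have "K \<subset> N" "K \<noteq> {}" using Suc.prems by auto
    from conn[OF this(2,1)] obtain a where a: "a \<in> D" "lab a \<in> K" "lab (r a) \<notin> K" by blast
    have "insert (lab (r a)) K \<subseteq> N" "insert a (insert (r a) L) \<subseteq> D"
      using a(1) K(1,3) assms(3) by auto
    moreover have "card (insert (lab (r a)) K) = Suc (Suc k)"
      using a(3) K(2) dart_tree_finite[OF K(4)] by simp
    ultimately show ?case using dart_tree.grow[OF K(4) a(2,3)] by blast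
  qed
  from this[of "card N - 1"] obtain K L where
    "K \<subseteq> N" "card K = card N" "L \<subseteq> D" "dart_tree r lab K L"
    using assms(1,2) by (auto simp: card_gt_0_iff)
  then show ?thesis using that card_subset_eq[OF assms(1), of K] by metis
qed

end

text \<open>Prefix sums along the cycle; the vanishing total makes them consistent where the cycle
  closes.\<close>

lemma cyclic_potential:
  fixes u :: "'d \<Rightarrow> int"
  assumes cyc: "cyclic_on f S" and "(\<Sum>a\<in>S. u a) = 0"
  obtains p where "\<And>a. a \<in> S \<Longrightarrow> p (f a) = p a + u a"
proof -
  from cyc obtain b where b: "b \<in> S" "S = orbit f b" by (auto simp: cyclic_on_def)
  define N where "N = funpow_dist1 f b b"
  define it where "it n = (f ^^ n) b" for n
  have self: "b \<in> orbit f b" using b by simp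
  have S: "S = it ` {0..<N}" unfolding b(2) N_def it_def
    by (rule orbit_conv_funpow_dist1[OF self])
  have inj: "inj_on it {0..<N}" unfolding N_def it_def
    by (rule inj_on_funpow_dist1[OF self])
  have last: "it N = b" unfolding N_def it_def by (rule funpow_dist1_prop[OF self])
  define p where "p a = (\<Sum>j < the_inv_into {0..<N} it a. u (it j))" for a
  have p: "p (it n) = (\<Sum>j<n. u (it j))" if "n < N" for n
    using the_inv_into_f_f[OF inj, of n] that by (simp add: p_def)
  have tot: "(\<Sum>j<N. u (it j)) = 0"
    using assms(2) unfolding S sum.reindex[OF inj] by (simp add: atLeast0LessThan)
  have "p (f a) = p a + u a" if "a \<in> S" for a
  proof -
    from that S obtain n where n: "n < N" "a = it n" by auto
    have fa: "f a = it (Suc n)" using n by (simp add: it_def)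
    show ?thesis
    proof (cases "Suc n < N")
      case True
      then show ?thesis using p[OF True] p[OF n(1)] fa n by simp
    next
      case False
      then have N: "N = Suc n" using n by simp
      then have "f a = it 0" using fa last by (simp add: it_def)
      moreover have "0 < N" using N by simp
      ultimately show ?thesis using p[of 0] p[OF n(1)] tot n(2) N by simp
    qed
  qed
  then show ?thesis using that by blast
qed

section \<open>Potentials in plane graphs\<close>

context plane_graph
begin

abbreviation face :: "'d \<Rightarrow> 'd set" where
  "face \<equiv> orbit (nxt M \<circ> rv M)"

lemma rv_rv [simp]: "rv M (rv M a) = a"
  by (rule arev_arev)

lemma rv_arc [simp]: "rv M a \<in> arcs G \<longleftrightarrow> a \<in> arcs G"
  using arev_in_arcs[of a] arev_in_arcs[of "rv M a"] by auto

lemma nxt_arc [simp]: "nxt M a \<in> arcs G \<longleftrightarrow> a \<in> arcs G"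
  by (rule permutes_in_image[OF nxt_permutes])

lemma finite_out [simp]: "finite (out_arcs G v)"
  by (rule finite_out_arcs)

lemma nxt_out: "a \<in> out_arcs G v \<Longrightarrow> nxt M a \<in> out_arcs G v"
proof -
  assume a: "a \<in> out_arcs G v"
  then have "cyclic_on (nxt M) (out_arcs G v)" by (intro nxt_cyclic) auto
  from cyclic_on_inI[OF this a] show ?thesis .
qed

lemma tail_nxt [simp]: "a \<in> arcs G \<Longrightarrow> tail G (nxt M a) = tail G a"
  using nxt_out[of a "tail G a"] by simp

lemma bij_nxt_out: "bij_betw (nxt M) (out_arcs G v) (out_arcs G v)"
proof -
  have inj: "inj_on (nxt M) (out_arcs G v)"
    by (rule inj_on_subset[OF permutes_inj[OF nxt_permutes]]) simp
  then show ?thesis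
    using endo_inj_surj[OF finite_out _ inj] nxt_out by (auto simp: bij_betw_def image_subset_iff)
qed

lemma sum_nxt_out: "(\<Sum>a\<in>out_arcs G v. g (nxt M a)) = (\<Sum>a\<in>out_arcs G v. g a)"
  by (rule sum.reindex_bij_betw[OF bij_nxt_out])

lemma out_arcs_induct:
  assumes "b \<in> out_arcs G v" "P b" "\<And>a. a \<in> out_arcs G v \<Longrightarrow> P a \<Longrightarrow> P (nxt M a)"
    and "a \<in> out_arcs G v"
  shows "P a"
proof -
  have "v \<in> verts G" using assms(1) by auto
  then have "cyclic_on (nxt M) (out_arcs G v)" using assms(1) by (intro nxt_cyclic) auto
  then have "out_arcs G v = orbit (nxt M) b" using assms(1) by (simp add: cyclic_on_alldef)
  with assms(4) have "a \<in> orbit (nxt M) b" by simp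
  then show ?thesis
  proof induction
    case base
    then show ?case using assms by blast
  next
    case (step c)
    then show ?case using assms(3)[of c] \<open>out_arcs G v = _\<close> by blast
  qed
qed

section \<open>Faces as orbits of the face permutation\<close>

lemma face_step_permutes: "(nxt M \<circ> rv M) permutes arcs G"
  by (rule permutes_compose[OF arev_permutes_arcs nxt_permutes])

lemma face_step_permutation: "permutation (nxt M \<circ> rv M)"
  unfolding permutation_permutes using face_step_permutes finite_arcs by blast

lemma face_self [simp]: "a \<in> face a"
  by (rule permutation_self_in_orbit[OF face_step_permutation])

lemma face_subset: "a \<in> arcs G \<Longrightarrow> face a \<subseteq> arcs G"
  by (rule permutes_orbit_subset[OF face_step_permutes])

lemma face_eq: "b \<in> face a \<Longrightarrow> face b = face a"
  by (rule orbit_cyclic_eq3[OF cyclic_on_orbit[OF face_step_permutes finite_arcs]])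

lemma face_step [simp]: "face (nxt M (rv M a)) = face a"
  by (rule face_eq) (use orbit.base[of "nxt M \<circ> rv M" a] in simp)

text \<open>The corner between \<open>a\<close> and \<open>nxt M a\<close> is entered along
  \<open>rv M a\<close> and left along \<open>nxt M a\<close>. This makes differences of face labels
  telescope around a vertex.\<close>

lemma face_nxt: "face (nxt M a) = face (rv M a)"
  using face_step[of "rv M a"] by simp

text \<open>Faces become the fibres of the labelling \<open>face\<close>, the form in which
  \<open>dart_tree\<close> with dual labels speaks of them.\<close>

lemma faces_eq: "f \<in> faces G M \<Longrightarrow> f = {a \<in> arcs G. face a = f}"
  using face_eq face_subset by (force simp: faces_def)

lemma face_in_faces [simp]: "a \<in> arcs G \<Longrightarrow> face a \<in> faces G M"
  by (simp add: faces_def)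

lemma faces_subset: "f \<in> faces G M \<Longrightarrow> f \<subseteq> arcs G"
  using faces_eq by blast

lemma finite_face: "f \<in> faces G M \<Longrightarrow> finite f"
  using faces_subset finite_subset finite_arcs by metis

lemma finite_faces: "finite (faces G M)"
  by (simp add: faces_def)

lemma sum_face_step:
  assumes "f \<in> faces G M"
  shows "(\<Sum>a\<in>f. g (nxt M (rv M a))) = (\<Sum>a\<in>f. g a)"
proof -
  have inj: "inj_on (nxt M \<circ> rv M) f"
    by (rule inj_on_subset[OF permutes_inj[OF face_step_permutes]]) simp
  have "(nxt M \<circ> rv M) a \<in> f" if "a \<in> f" for a
    using that faces_eq[OF assms] by auto (metis (no_types, lifting) face_step mem_Collect_eq nxt_arc rv_arc)
  then have "(nxt M \<circ> rv M) ` f \<subseteq> f" by blast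
  then have "bij_betw (nxt M \<circ> rv M) f f"
    using endo_inj_surj[OF finite_face[OF assms] _ inj] inj by (simp add: bij_betw_def)
  from sum.reindex_bij_betw[OF this, of g] show ?thesis by simp
qed

text \<open>A set of vertices that no arc leaves is closed under reachability; the cut form is what
  \<open>spanning_dart_tree\<close> asks for.\<close>

lemma primal_connected:
  assumes "K \<noteq> {}" "K \<subset> verts G"
  shows "\<exists>a\<in>arcs G. tail G a \<in> K \<and> tail G (rv M a) \<notin> K"
proof (rule ccontr)
  assume no: "\<not> ?thesis"
  have sc: "strongly_connected G"
    by (rule symmetric_connected_imp_strongly_connected[OF sym_arcs connected])
  from assms obtain u w where uw: "u \<in> K" "w \<in> verts G" "w \<notin> K" by blast
  with sc assms have "u \<rightarrow>\<^sup>*\<^bsub>G\<^esub> w" by (auto simp: strongly_connected_def)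
  then have "w \<in> K"
  proof (induction rule: reachable_induct)
    case base
    then show ?case using uw by simp
  next
    case (step x y)
    then obtain a where "a \<in> arcs G" "tail G a = x" "head G a = y"
      by (auto simp: arcs_ends_def arc_to_ends_def)
    then show ?case using no step by auto
  qed
  then show False using uw by simp
qed

text \<open>If a set of faces were separated from the rest by tree arcs only, its boundary would be a
  circulation supported on the tree.\<close>

lemma cotree_connected:
  assumes T: "dart_tree (rv M) (tail G) (verts G) T" "T \<subseteq> arcs G"
    and K: "K \<noteq> {}" "K \<subset> faces G M"
  shows "\<exists>a\<in>arcs G - T. face a \<in> K \<and> face (rv M a) \<notin> K"
proof (rule ccontr)
  assume no: "\<not> ?thesis"
  define g :: "'d set \<Rightarrow> int" where "g f = of_bool (f \<in> K)" for f
  \<comment> \<open>The coboundary of the indicator of \<open>K\<close>: on arcs it is nonzero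
    exactly between \<open>K\<close> and its complement.\<close>
  define y where "y a = g (face a) - g (face (rv M a))" for a
  have T_rv: "rv M a \<in> T \<longleftrightarrow> a \<in> T" for a
    using dart_tree_labels[OF rv_rv T(1)] rv_rv[of a] by metis
  have off: "y a = 0" if "a \<in> arcs G - T" for a
  proof -
    have "face a \<in> K \<longleftrightarrow> face (rv M a) \<in> K"
      using no that T_rv[of a] by (metis DiffD1 DiffD2 DiffI rv_arc rv_rv)
    then show ?thesis by (simp add: y_def g_def)
  qed
  have "y a = 0" if "a \<in> T" for a
  proof (rule dart_tree_circulation_zero[OF rv_rv T(1) _ _ that])
    show "y (rv M a) = - y a" for a by (simp add: y_def)
    fix v
    have "(\<Sum>a | a \<in> T \<and> tail G a = v. y a) = (\<Sum>a\<in>out_arcs G v. y a)"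
      by (rule sum.mono_neutral_left) (use T(2) in \<open>auto intro!: off\<close>)
    also have "\<dots> = (\<Sum>a\<in>out_arcs G v. g (face a)) - (\<Sum>a\<in>out_arcs G v. g (face (nxt M a)))"
      by (simp add: y_def sum_subtractf face_nxt)
    also have "\<dots> = 0" using sum_nxt_out[of "\<lambda>a. g (face a)" v] by simp
    finally show "(\<Sum>a | a \<in> T \<and> tail G a = v. y a) = 0" .
  qed
  with off have y: "y a = 0" if "a \<in> arcs G" for a using that by blast
  have rvK: "face (rv M a) \<in> K \<longleftrightarrow> face a \<in> K" if "a \<in> arcs G" for a
    using y[OF that] by (auto simp: y_def g_def of_bool_def split: if_splits)
  \<comment> \<open>Membership in \<open>K\<close> now passes both across edges and around vertices,
    so by connectivity it spreads from one arc to all arcs.\<close>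
  define X where "X = {a \<in> arcs G. face a \<in> K}"
  have out: "a \<in> X" if "b \<in> X" "a \<in> arcs G" "tail G a = tail G b" for a b
    by (rule out_arcs_induct[of b "tail G b"])
      (use that in \<open>auto simp: X_def face_nxt rvK\<close>)
  have "X \<noteq> {}" using K by (force simp: X_def faces_def)
  have "tail G ` X = verts G"
  proof (rule ccontr)
    assume "tail G ` X \<noteq> verts G"
    then have "tail G ` X \<subset> verts G" by (auto simp: X_def)
    from primal_connected[OF _ this] \<open>X \<noteq> {}\<close> obtain a where
      a: "a \<in> arcs G" "tail G a \<in> tail G ` X" "tail G (rv M a) \<notin> tail G ` X" by blast
    then have "a \<in> X" using out by auto
    then have "rv M a \<in> X" by (simp add: X_def rvK)
    then show False using a(3) by blast
  qed
  then have "a \<in> X" if "a \<in> arcs G" for a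
    using out[of _ a] that tail_in_verts[OF that] by (metis imageE)
  then have "faces G M \<subseteq> K" by (auto simp: X_def faces_def)
  then show False using K by blast
qed

text \<open>On the sphere the edges off a spanning tree are dual to a spanning tree of the faces: a
  dual tree chosen among them already uses all of them, by counting.\<close>

lemma tree_cotree:
  obtains T where "dart_tree (rv M) (tail G) (verts G) T" "T \<subseteq> arcs G"
    "dart_tree (rv M) face (faces G M) (arcs G - T)"
proof -
  obtain T where T: "dart_tree (rv M) (tail G) (verts G) T" "T \<subseteq> arcs G"
  proof (rule spanning_dart_tree[OF rv_rv finite_verts, of "arcs G" "tail G"])
    show "verts G \<noteq> {}" using connected by (auto simp: connected_def strongly_connected_def)
  qed (use primal_connected in auto)
  have T_rv: "rv M a \<in> T \<longleftrightarrow> a \<in> T" for a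
    using dart_tree_labels[OF rv_rv T(1)] rv_rv[of a] by metis
  obtain L where L: "dart_tree (rv M) face (faces G M) L" "L \<subseteq> arcs G - T"
  proof (rule spanning_dart_tree[OF rv_rv finite_faces, of "arcs G - T" face])
    show "faces G M \<noteq> {}" using outer_face by blast
    show "\<exists>a\<in>arcs G - T. face a \<in> K \<and> face (rv M a) \<notin> K" if "K \<noteq> {}" "K \<subset> faces G M" for K
      by (rule cotree_connected[OF T that])
  qed (use T_rv in auto)
  have fin: "finite L" "finite T"
    using L(2) T(2) finite_arcs by (auto intro: finite_subset)
  have "card (arcs G - T - L) = card (arcs G) - card T - card L"
    using fin T(2) L(2) by (simp add: card_Diff_subset)
  \<comment> \<open>By Euler's formula the two trees have \<open>2 * (card (arcs G) div 2)\<close>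
    darts. The rounding leaves room for one more, but leftover darts come in pairs \<open>a\<close>,
    \<open>rv M a\<close>.\<close>
  then have card: "card (arcs G - T - L) \<le> 1"
    using dart_tree_card[OF rv_rv T(1)] dart_tree_card[OF rv_rv L(1)] euler by linarith
  have "arcs G - T - L = {}"
  proof (rule ccontr)
    assume "arcs G - T - L \<noteq> {}"
    then obtain a where a: "a \<in> arcs G" "a \<notin> T" "a \<notin> L" by blast
    then have "rv M a \<notin> L" using dart_tree_labels[OF rv_rv L(1), of "rv M a"] by auto
    then have "{a, rv M a} \<subseteq> arcs G - T - L" using a T_rv by auto
    then have "card {a, rv M a} \<le> 1"
      using card card_mono[of "arcs G - T - L"] finite_arcs by (meson finite_Diff order_trans)
    then show False using arev_neq[OF a(1)] by simp
  qed
  then have "L = arcs G - T" using L(2) by blast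
  then show ?thesis using that T L(1) by blast
qed

text \<open>Vanishing of the first cohomology of the sphere.\<close>

lemma rotation_potential:
  fixes u w :: "'d \<Rightarrow> int"
  assumes w: "\<And>a. a \<in> arcs G \<Longrightarrow> w (rv M a) = - w a"
    and u: "\<And>v. v \<in> verts G \<Longrightarrow> (\<Sum>a\<in>out_arcs G v. u a) = 0"
    and f: "\<And>f. f \<in> faces G M \<Longrightarrow> (\<Sum>a\<in>f. w a + u (rv M a)) = 0"
  obtains q where "\<And>a. a \<in> arcs G \<Longrightarrow> q (nxt M a) = q a + u a"
    "\<And>a. a \<in> arcs G \<Longrightarrow> q (rv M a) = q a + w a"
proof -
  obtain T where T: "dart_tree (rv M) (tail G) (verts G) T" "T \<subseteq> arcs G"
    and R: "dart_tree (rv M) face (faces G M) (arcs G - T)" by (rule tree_cotree)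
  have "\<exists>p. \<forall>a\<in>out_arcs G v. p (nxt M a) = p a + u a" if v: "v \<in> verts G" for v
  proof (cases "out_arcs G v = {}")
    case False
    obtain p where "\<And>a. a \<in> out_arcs G v \<Longrightarrow> p (nxt M a) = p a + u a"
      by (rule cyclic_potential[OF nxt_cyclic[OF v False] u[OF v]]) (rule that)
    then show ?thesis by blast
  qed simp
  then have "\<exists>p. \<forall>v\<in>verts G. \<forall>a\<in>out_arcs G v. p v (nxt M a) = p v a + u a"
    by (intro bchoice) blast
  then obtain p where p: "\<And>v a. v \<in> verts G \<Longrightarrow> a \<in> out_arcs G v \<Longrightarrow> p v (nxt M a) = p v a + u a"
    by blast
  define p' where "p' a = p (tail G a) a" for a
  have p': "p' (nxt M a) = p' a + u a" if "a \<in> arcs G" for a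
    using p[of "tail G a" a] that by (simp add: p'_def)
  \<comment> \<open>\<open>p'\<close> has the right increments around each vertex but is free up to
    a constant there; \<open>c\<close> fixes these constants along the primal tree.\<close>
  obtain c where c: "\<And>a. a \<in> T \<Longrightarrow> c (tail G (rv M a)) = c (tail G a) + (w a + p' a - p' (rv M a))"
    by (rule dart_tree_potential[OF rv_rv T(1), of "\<lambda>a. w a + p' a - p' (rv M a)"])
      (use w T(2) in auto)
  define q where "q a = p' a + c (tail G a)" for a
  have q: "q (nxt M a) = q a + u a" if "a \<in> arcs G" for a
    using that p' by (simp add: q_def)
  \<comment> \<open>The failure of \<open>q\<close> across an edge. It vanishes on the primal tree,
    and the face condition makes it a circulation on the dual tree.\<close>
  define y where "y a = q a + w a - q (rv M a)" for a
  have yT: "y a = 0" if "a \<in> T" for a using c[OF that] by (simp add: y_def q_def)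
  have yR: "y a = 0" if "a \<in> arcs G - T" for a
  proof (rule dart_tree_circulation_zero[OF rv_rv R _ _ that])
    show "y (rv M a) = - y a" if "a \<in> arcs G - T" for a using w that by (simp add: y_def)
    fix g assume g: "g \<in> faces G M"
    have "(\<Sum>a | a \<in> arcs G - T \<and> face a = g. y a) = (\<Sum>a | a \<in> arcs G \<and> face a = g. y a)"
      by (rule sum.mono_neutral_left) (use yT finite_arcs in auto)
    also have "\<dots> = (\<Sum>a\<in>g. y a)" using faces_eq[OF g] by simp
    also have "\<dots> = (\<Sum>a\<in>g. (w a + u (rv M a)) + (q a - q (nxt M (rv M a))))"
      by (rule sum.cong) (use faces_subset[OF g] in \<open>auto simp: y_def q\<close>)
    also have "\<dots> = 0"
      using f[OF g] sum_face_step[OF g, of q] by (simp only: sum.distrib sum_subtractf)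
    finally show "(\<Sum>a | a \<in> arcs G - T \<and> face a = g. y a) = 0" .
  qed
  have "q (rv M a) = q a + w a" if "a \<in> arcs G" for a
    using yT yR[of a] that by (cases "a \<in> T") (auto simp: y_def)
  then show ?thesis using that q by blast
qed

text \<open>Bends move turning from a face to the face across the edge; the dual tree alone can
  route any demand of total zero.\<close>

lemma face_flow:
  fixes d :: "'d set \<Rightarrow> int"
  assumes "(\<Sum>f\<in>faces G M. d f) = 0"
  obtains y where "\<And>a. y (rv M a) = - y a" "\<And>f. f \<in> faces G M \<Longrightarrow> (\<Sum>a\<in>f. y a) = d f"
proof -
  obtain T where R: "dart_tree (rv M) face (faces G M) (arcs G - T)" by (rule tree_cotree)
  obtain y where y: "\<And>a. y (rv M a) = - y a" "\<And>a. a \<notin> arcs G - T \<Longrightarrow> y a = 0"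
    "\<And>f. f \<in> faces G M \<Longrightarrow> (\<Sum>a | a \<in> arcs G - T \<and> face a = f. y a) = d f"
    by (rule dart_tree_flow[OF rv_rv R assms]) (rule that)
  have "(\<Sum>a\<in>f. y a) = d f" if f: "f \<in> faces G M" for f
  proof -
    have "(\<Sum>a | a \<in> arcs G - T \<and> face a = f. y a) = (\<Sum>a | a \<in> arcs G \<and> face a = f. y a)"
      by (rule sum.mono_neutral_left) (use y(2) finite_arcs in auto)
    then show ?thesis using y(3)[OF f] faces_eq[OF f] by simp
  qed
  then show ?thesis using that y(1) by blast
qed

end

section \<open>Orthogonal representations as integer solutions\<close>

text \<open>Angles are measured in multiples of 90 degrees; only the net number of bends of an edge
  matters for the faces.\<close>

definition ortho_solution ::
    "('v, 'd) pre_digraph \<Rightarrow> 'd embedding \<Rightarrow> ('d \<Rightarrow> int) \<Rightarrow> ('d \<Rightarrow> int) \<Rightarrow> bool" where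
  "ortho_solution G M al x \<longleftrightarrow>
     (\<forall>a\<in>arcs G. 1 \<le> al a) \<and>
     (\<forall>v\<in>verts G. (\<Sum>a\<in>out_arcs G v. al a) = 4) \<and>
     (\<forall>a\<in>arcs G. x (rv M a) = - x a) \<and>
     (\<forall>f\<in>faces G M. (\<Sum>a\<in>f. 2 - al (rv M a) + x a) = (if f = outer M then - 4 else 4))"

definition net_bends :: "nat list \<Rightarrow> int" where
  "net_bends bs = int (count_list bs 90) - int (count_list bs 270)"

lemma net_bends_reverse:
  "set bs \<subseteq> {90, 270} \<Longrightarrow> net_bends (rev (map (\<lambda>x. 360 - x) bs)) = - net_bends bs"
  by (induction bs) (auto simp: net_bends_def)

lemma abs_net_bends_le: "\<bar>net_bends bs\<bar> \<le> int (length bs)"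
  by (induction bs) (auto simp: net_bends_def)

text \<open>The shortest list with net number \<open>k\<close>: bends in opposite directions on one
  edge would cancel in both of its faces.\<close>

definition bend_list :: "int \<Rightarrow> nat list" where
  "bend_list k = replicate (nat \<bar>k\<bar>) (if k > 0 then 90 else 270)"

lemma count_list_replicate: "count_list (replicate k y) z = (if y = z then k else 0)"
  by (induction k) auto

lemma net_bends_bend_list: "net_bends (bend_list k) = k"
  by (simp add: net_bends_def bend_list_def count_list_replicate)

lemma bend_list_uminus: "bend_list (- k) = rev (map (\<lambda>x. 360 - x) (bend_list k))"
  by (simp add: bend_list_def)

text \<open>A corner of k quarter turns contributes 2 - k, that is 1, 0, -1 or -2 for 90, 180, 270
  or 360 degrees; a bend is never 360 degrees.\<close>

lemma face_rotation:
  assumes "finite f" "\<And>a. a \<in> f \<Longrightarrow> angle R (rv M a) \<in> {90, 180, 270, 360}"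
    and "\<And>a. a \<in> f \<Longrightarrow> set (bends R a) \<subseteq> {90, 270}"
  shows "int (num_angles M R f 90) - int (num_angles M R f 270) - 2 * int (num_angles M R f 360)
    = (\<Sum>a\<in>f. 2 - int (angle R (rv M a) div 90) + net_bends (bends R a))"
proof -
  have num: "int (num_angles M R f y)
      = (\<Sum>a\<in>f. (if angle R (rv M a) = y then 1 else 0) + int (count_list (bends R a) y))" for y
    using assms(1) by (simp add: num_angles_def sum.distrib sum.If_cases Int_def)
  have "count_list (bends R a) 360 = 0" if "a \<in> f" for a
    using assms(3)[OF that] by (auto simp: count_list_0_iff)
  then show ?thesis
    unfolding num sum_distrib_left sum_subtractf[symmetric]
    using assms(2) by (intro sum.cong) (force simp: net_bends_def)+
qed

text \<open>Stated for an arbitrary graph \<open>H\<close> with embedding \<open>E\<close>, because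
  it serves both \<open>G\<close> and its subdivisions.\<close>

lemma orthogonal_representation_solution:
  assumes R: "orthogonal_representation H E R"
    and fin: "\<And>f. f \<in> faces H E \<Longrightarrow> finite f \<and> f \<subseteq> arcs H"
    and rv: "\<And>a. a \<in> arcs H \<Longrightarrow> rv E a \<in> arcs H"
  shows "ortho_solution H E (\<lambda>a. int (angle R a div 90)) (\<lambda>a. net_bends (bends R a))"
proof -
  have angles: "angle R a \<in> {90, 180, 270, 360}"
    and set_bends: "set (bends R a) \<subseteq> {90, 270}"
    and rev_bends: "bends R (rv E a) = rev (map (\<lambda>x. 360 - x) (bends R a))"
    if "a \<in> arcs H" for a
    using R that by (auto simp: orthogonal_representation_def)
  have "(\<Sum>a\<in>out_arcs H v. int (angle R a div 90)) = 4" if "v \<in> verts H" for v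
  proof -
    have "90 * (\<Sum>a\<in>out_arcs H v. int (angle R a div 90)) = (\<Sum>a\<in>out_arcs H v. int (angle R a))"
      unfolding sum_distrib_left using angles by (intro sum.cong) force+
    also have "\<dots> = 360"
      using R that by (auto simp: orthogonal_representation_def simp flip: of_nat_sum)
    finally show ?thesis by simp
  qed
  moreover have "1 \<le> int (angle R a div 90)" if "a \<in> arcs H" for a
    using angles[OF that] by auto
  moreover have "net_bends (bends R (rv E a)) = - net_bends (bends R a)" if "a \<in> arcs H" for a
    using net_bends_reverse[OF set_bends[OF that]] rev_bends[OF that] by simp
  moreover have "(\<Sum>a\<in>f. 2 - int (angle R (rv E a) div 90) + net_bends (bends R a))
      = (if f = outer E then - 4 else 4)" if "f \<in> faces H E" for f
  proof -
    have "a \<in> arcs H" "rv E a \<in> arcs H" if "a \<in> f" for a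
      using fin[OF \<open>f \<in> faces H E\<close>] that rv by auto
    then show ?thesis
      using face_rotation[of f R E] fin[OF that] angles set_bends R that
      by (simp add: orthogonal_representation_def)
  qed
  ultimately show ?thesis by (simp add: ortho_solution_def)
qed

text \<open>A solution bounds single angles only from below. Since they sum to 4 around a vertex, an
  angle is at most 4 minus the number of other arcs there; so 4 is the largest value and occurs only
  at degree 1.\<close>

lemma ortho_solution_representation:
  assumes sol: "ortho_solution H E al x"
    and fin: "\<And>f. f \<in> faces H E \<Longrightarrow> finite f \<and> f \<subseteq> arcs H" "finite (arcs H)"
    and rv: "\<And>a. a \<in> arcs H \<Longrightarrow> rv E a \<in> arcs H"
    and tail: "\<And>a. a \<in> arcs H \<Longrightarrow> tail H a \<in> verts H"
  defines "R \<equiv> \<lparr>angle = \<lambda>a. nat (90 * al a), bends = \<lambda>a. bend_list (x a)\<rparr>"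
  shows "orthogonal_representation H E R"
proof -
  have al1: "1 \<le> al a" if "a \<in> arcs H" for a
    using sol that by (simp add: ortho_solution_def)
  have fin_out: "finite (out_arcs H v)" for v
    by (rule finite_subset[OF _ fin(2)]) auto
  have sum_out: "(\<Sum>a\<in>out_arcs H v. al a) = 4" if "v \<in> verts H" for v
    using sol that by (simp add: ortho_solution_def)
  have rest: "al a + int (card (out_arcs H (tail H a) - {a})) \<le> 4" if "a \<in> arcs H" for a
  proof -
    have "int (card (out_arcs H (tail H a) - {a})) = (\<Sum>b\<in>out_arcs H (tail H a) - {a}. 1)"
      by simp
    also have "\<dots> \<le> (\<Sum>b\<in>out_arcs H (tail H a) - {a}. al b)"
      by (rule sum_mono) (use al1 in auto)
    also have "\<dots> = 4 - al a"
      using sum_out[OF tail[OF that]] that fin_out by (simp add: sum_diff1)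
    finally show ?thesis by simp
  qed
  have al: "al a \<in> {1, 2, 3, 4}" if "a \<in> arcs H" for a
    using al1[OF that] rest[OF that] by auto
  have angles: "angle R a \<in> {90, 180, 270, 360}" "int (angle R a div 90) = al a"
    "int (angle R a) = 90 * al a" if "a \<in> arcs H" for a
    using al[OF that] by (auto simp: R_def)
  have set_bends: "set (bends R a) \<subseteq> {90, 270}" for a
    by (auto simp: R_def bend_list_def)
  have "out_degree H (tail H a) = 1" if "a \<in> arcs H" "angle R a = 360" for a
  proof -
    have "card (out_arcs H (tail H a) - {a}) = 0"
      using rest[OF that(1)] angles(3)[OF that(1)] that(2) by simp
    then have "out_arcs H (tail H a) - {a} = {}"
      using fin_out[of "tail H a"] by (metis card_0_eq finite_Diff)
    then have "out_arcs H (tail H a) = {a}" using that(1) by auto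
    then show ?thesis by (simp add: out_degree_def)
  qed
  moreover have "(\<Sum>a\<in>out_arcs H v. angle R a) = 360" if "v \<in> verts H" for v
  proof -
    have "int (\<Sum>a\<in>out_arcs H v. angle R a) = 90 * (\<Sum>a\<in>out_arcs H v. al a)"
      unfolding of_nat_sum sum_distrib_left by (rule sum.cong) (simp_all add: angles(3))
    then have "int (\<Sum>a\<in>out_arcs H v. angle R a) = int 360"
      using sum_out[OF that] by (simp del: of_nat_sum)
    then show ?thesis by (simp only: of_nat_eq_iff)
  qed
  moreover have "int (num_angles E R f 90) - int (num_angles E R f 270)
      - 2 * int (num_angles E R f 360) = (if f = outer E then - 4 else 4)"
    if "f \<in> faces H E" for f
  proof -
    have f: "a \<in> arcs H" "rv E a \<in> arcs H" if "a \<in> f" for a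
      using fin(1)[OF \<open>f \<in> faces H E\<close>] that rv by auto
    have "int (num_angles E R f 90) - int (num_angles E R f 270) - 2 * int (num_angles E R f 360)
      = (\<Sum>a\<in>f. 2 - int (angle R (rv E a) div 90) + net_bends (bends R a))"
      using fin(1)[OF that] by (intro face_rotation) (use f angles(1) set_bends in blast)+
    also have "\<dots> = (\<Sum>a\<in>f. 2 - al (rv E a) + x a)"
      by (rule sum.cong) (use f in \<open>simp_all add: angles(2), simp add: R_def net_bends_bend_list\<close>)
    finally show ?thesis using sol that by (simp add: ortho_solution_def)
  qed
  moreover have "bends R (rv E a) = rev (map (\<lambda>x. 360 - x) (bends R a))" if "a \<in> arcs H" for a
    using sol that bend_list_uminus[of "x a"] by (simp add: R_def ortho_solution_def)
  ultimately show ?thesis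
    using angles(1) set_bends by (simp add: orthogonal_representation_def)
qed

section \<open>Subdivisions\<close>

lemma sum_of_bool_le:
  fixes m :: int
  assumes "0 \<le> m" "m \<le> int k"
  shows "(\<Sum>j\<in>{1..k}. if int j \<le> m then 1 else 0) = m"
proof -
  have "{j \<in> {1..k}. int j \<le> m} = {1..nat m}" using assms by auto
  then show ?thesis using assms by (simp flip: sum.inter_filter)
qed

lemma sum_flip:
  fixes h :: "nat \<Rightarrow> int"
  shows "(\<Sum>j\<in>{1..k}. h (k + 1 - j)) = (\<Sum>j\<in>{1..k}. h j)"
  by (rule sum.reindex_bij_witness[of _ "\<lambda>j. k + 1 - j" "\<lambda>j. k + 1 - j"]) auto

lemma sum_flip_atMost:
  fixes h :: "nat \<Rightarrow> int"
  shows "(\<Sum>j\<le>k. h (k - j)) = (\<Sum>j\<le>k. h j)"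
  by (rule sum.reindex_bij_witness[of _ "\<lambda>j. k - j" "\<lambda>j. k - j"]) auto

context plane_graph
begin

lemma edge_of_rv [simp]: "edge_of M (rv M a) = edge_of M a"
  by (auto simp: edge_of_def)

lemma edge_of_eq_iff: "edge_of M a = edge_of M b \<longleftrightarrow> a = b \<or> a = rv M b"
  by (auto simp: edge_of_def doubleton_eq_iff)

context
  fixes n :: "'d set \<Rightarrow> nat"
begin

abbreviation subdiv :: "'d \<Rightarrow> nat" where
  "subdiv a \<equiv> n (edge_of M a)"

lemma sub_arcs_iff [simp]: "(a, i) \<in> sub_arcs G M n \<longleftrightarrow> a \<in> arcs G \<and> i \<le> subdiv a"
  by (simp add: sub_arcs_def)

lemma sub_rv: "a \<in> arcs G \<Longrightarrow> i \<le> subdiv a \<Longrightarrow> rv (sub_emb G M n) (a, i) = (rv M a, subdiv a - i)"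
  by (simp add: sub_emb_def)

lemma sub_nxt: "a \<in> arcs G \<Longrightarrow> i \<le> subdiv a \<Longrightarrow> nxt (sub_emb G M n) (a, i) =
    (if i = 0 then (nxt M a, 0) else (rv M a, subdiv a + 1 - i))"
  by (simp add: sub_emb_def)

section \<open>Faces and vertices of a subdivision\<close>

lemma sub_face_step:
  assumes "a \<in> arcs G" "i \<le> subdiv a"
  shows "(nxt (sub_emb G M n) \<circ> rv (sub_emb G M n)) (a, i) =
    (if i = subdiv a then (nxt M (rv M a), 0) else (a, i + 1))"
  using assms by (auto simp: sub_rv sub_nxt)

lemma finite_sub_arcs: "finite (sub_arcs G M n)"
proof -
  have "sub_arcs G M n = (SIGMA a:arcs G. {..subdiv a})" by (auto simp: sub_arcs_def)
  then show ?thesis by simp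
qed

abbreviation sub_face :: "'d set \<Rightarrow> ('d \<times> nat) set" where
  "sub_face f \<equiv> (SIGMA a:f. {..subdiv a})"

lemma orbit_sub_arc:
  assumes a: "a \<in> arcs G" "i \<le> subdiv a"
  shows "orbit (nxt (sub_emb G M n) \<circ> rv (sub_emb G M n)) (a, i) = sub_face (face a)"
    (is "orbit ?f _ = _")
proof (intro equalityI subsetI)
  fix y assume "y \<in> orbit ?f (a, i)"
  then show "y \<in> sub_face (face a)"
  proof induction
    case base
    show ?case
      using a orbit.base[of "nxt M \<circ> rv M" a]
      by (auto simp: sub_face_step simp del: o_apply) simp
  next
    case (step y)
    obtain b j where y: "y = (b, j)" by (cases y)
    have b: "b \<in> face a" "j \<le> subdiv b"
      using step.IH unfolding y by (simp_all only: mem_Sigma_iff atMost_iff)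
    then have "b \<in> arcs G" using face_subset[OF a(1)] by blast
    have "nxt M (rv M b) \<in> face a" using orbit.step[OF b(1)] by simp
    then show ?case
      using b \<open>b \<in> arcs G\<close> by (simp only: sub_face_step y mem_Sigma_iff atMost_iff split: if_splits) simp
  qed
next
  have up: "(b, j) \<in> orbit ?f (a, i)"
    if "(b, 0) \<in> orbit ?f (a, i)" "b \<in> arcs G" "j \<le> subdiv b" for b j
    using that(3)
  proof (induction j)
    case (Suc j)
    from orbit.step[OF Suc.IH] Suc.prems show ?case
      using that(2) by (simp add: sub_face_step del: o_apply)
  qed (use that in simp)
  \<comment> \<open>The walk starts at piece \<open>i\<close> of \<open>a\<close> and reaches the
    later pieces directly, but the earlier ones only after a full round, through
    \<open>start\<close> and \<open>up\<close>.\<close>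
  have high: "(a, j) \<in> orbit ?f (a, i)" if "i < j" "j \<le> subdiv a" for j
    using that
  proof (induction j)
    case (Suc j)
    then show ?case
      using orbit.step[of "(a, j)" ?f "(a, i)"] orbit.base[of ?f "(a, i)"] a
      by (cases "i = j") (auto simp: sub_face_step simp del: o_apply)
  qed simp
  have first: "(nxt M (rv M a), 0) \<in> orbit ?f (a, i)"
  proof (cases "i = subdiv a")
    case True
    then show ?thesis using orbit.base[of ?f "(a, i)"] a by (simp add: sub_face_step del: o_apply)
  next
    case False
    then have "(a, subdiv a) \<in> orbit ?f (a, i)" using high a by simp
    from orbit.step[OF this] show ?thesis using a by (simp add: sub_face_step del: o_apply)
  qed
  have start: "(b, 0) \<in> orbit ?f (a, i)" if "b \<in> face a" for b
    using that
  proof induction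
    case base
    show ?case using first by (simp add: comp_def)
  next
    case (step b)
    have b: "b \<in> arcs G" using step.hyps face_subset[OF a(1)] by blast
    have "(b, subdiv b) \<in> orbit ?f (a, i)" using up[OF step.IH b] step by blast
    from orbit.step[OF this] have "(nxt M (rv M b), 0) \<in> orbit ?f (a, i)"
      using b by (simp add: sub_face_step del: o_apply)
    then show ?case by (simp add: comp_def)
  qed
  fix y assume "y \<in> sub_face (face a)"
  then show "y \<in> orbit ?f (a, i)"
    using up start face_subset[OF a(1)] by auto
qed

lemma sub_faces: "faces (sub_graph G M n) (sub_emb G M n) = sub_face ` faces G M"
proof -
  have arcs: "arcs (sub_graph G M n) = sub_arcs G M n" by (simp add: sub_graph_def)
  have "(\<lambda>y. orbit (nxt (sub_emb G M n) \<circ> rv (sub_emb G M n)) y) ` sub_arcs G M n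
      = (\<lambda>y. sub_face (face (fst y))) ` sub_arcs G M n"
    by (rule image_cong) (auto simp: orbit_sub_arc)
  also have "\<dots> = sub_face ` face ` fst ` sub_arcs G M n" by (simp add: image_image)
  also have "fst ` sub_arcs G M n = arcs G" by (force simp: sub_arcs_def)
  finally show ?thesis unfolding faces_def arcs .
qed

lemma sub_face_eq_iff: "sub_face f = sub_face g \<longleftrightarrow> f = g"
proof -
  have "fst ` sub_face h = h" for h by force
  then show ?thesis by metis
qed

lemma sub_outer: "outer (sub_emb G M n) = sub_face (outer M)"
  using faces_subset[OF outer_face] by (auto simp: sub_emb_def)

lemma sub_out_arcs_Inl: "out_arcs (sub_graph G M n) (Inl v) = (\<lambda>a. (a, 0)) ` out_arcs G v"
  by (auto simp: sub_graph_def sub_tail_def out_arcs_def split: if_splits)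

lemma sub_out_arcs_Inr:
  assumes "a \<in> arcs G" "1 \<le> i" "i \<le> subdiv a"
  shows "out_arcs (sub_graph G M n) (sub_tail G M n (a, i)) = {(a, i), (rv M a, subdiv a + 1 - i)}"
  using assms
  by (auto simp: sub_graph_def sub_tail_def out_arcs_def doubleton_eq_iff split: if_splits)

text \<open>Reversal sends the last piece of \<open>a\<close> to piece 0 of \<open>rv M a\<close>,
  so the old corner appears as \<open>al (rv M a, 0)\<close>. The other corners lie at subdivision
  vertices and join the bends of the pieces in the total turn of \<open>a\<close>.\<close>

lemma sub_face_sum:
  fixes al x :: "'d \<times> nat \<Rightarrow> int"
  assumes "f \<in> faces G M"
  shows "(\<Sum>y\<in>sub_face f. 2 - al (rv (sub_emb G M n) y) + x y) =
    (\<Sum>a\<in>f. 2 - al (rv M a, 0) +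
      ((\<Sum>i\<le>subdiv a. x (a, i)) + (\<Sum>j\<in>{1..subdiv a}. 2 - al (rv M a, j))))"
proof -
  have "(\<Sum>y\<in>sub_face f. 2 - al (rv (sub_emb G M n) y) + x y) =
    (\<Sum>a\<in>f. \<Sum>i\<le>subdiv a. 2 - al (rv (sub_emb G M n) (a, i)) + x (a, i))"
    using finite_face[OF assms] by (subst sum.Sigma) (auto simp: case_prod_unfold)
  also have "\<dots> = (\<Sum>a\<in>f. (\<Sum>i\<le>subdiv a. 2 - al (rv M a, i)) + (\<Sum>i\<le>subdiv a. x (a, i)))"
  proof (rule sum.cong[OF refl])
    fix a assume "a \<in> f"
    then have a: "a \<in> arcs G" using faces_subset[OF assms] by blast
    have "(\<Sum>i\<le>subdiv a. 2 - al (rv (sub_emb G M n) (a, i)))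
        = (\<Sum>i\<le>subdiv a. 2 - al (rv M a, subdiv a - i))"
      by (rule sum.cong) (use a in \<open>auto simp: sub_rv\<close>)
    also have "\<dots> = (\<Sum>i\<le>subdiv a. 2 - al (rv M a, i))"
      by (rule sum_flip_atMost)
    finally show "(\<Sum>i\<le>subdiv a. 2 - al (rv (sub_emb G M n) (a, i)) + x (a, i)) =
      (\<Sum>i\<le>subdiv a. 2 - al (rv M a, i)) + (\<Sum>i\<le>subdiv a. x (a, i))"
      by (simp add: sum.distrib)
  qed
  also have "\<dots> = (\<Sum>a\<in>f. 2 - al (rv M a, 0) +
      ((\<Sum>i\<le>subdiv a. x (a, i)) + (\<Sum>j\<in>{1..subdiv a}. 2 - al (rv M a, j))))"
  proof (rule sum.cong[OF refl])
    fix a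
    have "{..subdiv a} = insert 0 {1..subdiv a}" by auto
    then show "(\<Sum>i\<le>subdiv a. 2 - al (rv M a, i)) + (\<Sum>i\<le>subdiv a. x (a, i)) =
      2 - al (rv M a, 0) +
      ((\<Sum>i\<le>subdiv a. x (a, i)) + (\<Sum>j\<in>{1..subdiv a}. 2 - al (rv M a, j)))"
      by simp
  qed
  finally show ?thesis .
qed

text \<open>Forgetting the subdivision vertices turns their angles into bends. The two angles at
  such a vertex are positive with sum 4, so it accounts for at most one bend.\<close>

lemma sub_solution_imp:
  assumes sol: "ortho_solution (sub_graph G M n) (sub_emb G M n) al x"
  defines "X \<equiv> \<lambda>a. (\<Sum>i\<le>subdiv a. x (a, i)) + (\<Sum>j\<in>{1..subdiv a}. 2 - al (rv M a, j))"
  shows "ortho_solution G M (\<lambda>a. al (a, 0)) X"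
    and "a \<in> arcs G \<Longrightarrow> (\<And>i. i \<le> subdiv a \<Longrightarrow> x (a, i) = 0) \<Longrightarrow> \<bar>X a\<bar> \<le> int (subdiv a)"
proof -
  have al1: "1 \<le> al (a, i)" if "a \<in> arcs G" "i \<le> subdiv a" for a i
    using sol that by (simp add: ortho_solution_def sub_graph_def)
  have antix: "x (rv M a, subdiv a - i) = - x (a, i)" if "a \<in> arcs G" "i \<le> subdiv a" for a i
  proof -
    have "x (rv (sub_emb G M n) (a, i)) = - x (a, i)"
      using sol that by (simp add: ortho_solution_def sub_graph_def)
    then show ?thesis by (simp add: sub_rv[OF that])
  qed
  have straight: "al (a, i) + al (rv M a, subdiv a + 1 - i) = 4"
    if "a \<in> arcs G" "1 \<le> i" "i \<le> subdiv a" for a i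
  proof -
    have "sub_tail G M n (a, i) \<in> verts (sub_graph G M n)"
      using that by (simp add: sub_graph_def)
    then have "(\<Sum>y\<in>out_arcs (sub_graph G M n) (sub_tail G M n (a, i)). al y) = 4"
      using sol unfolding ortho_solution_def by blast
    then show ?thesis
      using that arev_neq[OF that(1)] by (auto simp: sub_out_arcs_Inr)
  qed
  have "X (rv M a) = - X a" if a: "a \<in> arcs G" for a
  proof -
    have "(\<Sum>i\<le>subdiv a. x (rv M a, i)) = (\<Sum>i\<le>subdiv a. x (rv M a, subdiv a - i))"
      by (rule sum_flip_atMost[symmetric])
    also have "\<dots> = - (\<Sum>i\<le>subdiv a. x (a, i))"
      by (simp add: antix[OF a] sum_negf)
    finally have 1: "(\<Sum>i\<le>subdiv a. x (rv M a, i)) = - (\<Sum>i\<le>subdiv a. x (a, i))" .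
    have "(\<Sum>j\<in>{1..subdiv a}. 2 - al (a, j))
        = (\<Sum>j\<in>{1..subdiv a}. - (2 - al (rv M a, subdiv a + 1 - j)))"
    proof (rule sum.cong[OF refl])
      fix j assume "j \<in> {1..subdiv a}"
      then show "2 - al (a, j) = - (2 - al (rv M a, subdiv a + 1 - j))"
        using straight[OF a, of j] by simp
    qed
    also have "\<dots> = - (\<Sum>j\<in>{1..subdiv a}. 2 - al (rv M a, j))"
      unfolding sum_negf by (simp only: sum_flip[where h = "\<lambda>j. 2 - al (rv M a, j)"])
    finally show ?thesis using 1 by (simp add: X_def)
  qed
  moreover have "(\<Sum>a\<in>out_arcs G v. al (a, 0)) = 4" if "v \<in> verts G" for v
  proof -
    have "Inl v \<in> verts (sub_graph G M n)" using that by (simp add: sub_graph_def)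
    then have "(\<Sum>y\<in>out_arcs (sub_graph G M n) (Inl v). al y) = 4"
      using sol unfolding ortho_solution_def by blast
    then show ?thesis by (simp add: sub_out_arcs_Inl sum.reindex inj_on_def)
  qed
  moreover have "(\<Sum>a\<in>f. 2 - al (rv M a, 0) + X a) = (if f = outer M then - 4 else 4)"
    if "f \<in> faces G M" for f
  proof -
    have "sub_face f \<in> faces (sub_graph G M n) (sub_emb G M n)"
      using that unfolding sub_faces by blast
    then have "(\<Sum>y\<in>sub_face f. 2 - al (rv (sub_emb G M n) y) + x y)
        = (if sub_face f = outer (sub_emb G M n) then - 4 else 4)"
      using sol unfolding ortho_solution_def by blast
    then show ?thesis
      unfolding sub_face_sum[OF that] sub_outer sub_face_eq_iff X_def .
  qed
  ultimately show "ortho_solution G M (\<lambda>a. al (a, 0)) X"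
    using al1 by (simp add: ortho_solution_def)
  assume a: "a \<in> arcs G" and zero: "\<And>i. i \<le> subdiv a \<Longrightarrow> x (a, i) = 0"
  have "\<bar>2 - al (rv M a, j)\<bar> \<le> 1" if "j \<in> {1..subdiv a}" for j
  proof -
    have "1 \<le> al (a, subdiv a + 1 - j)" by (rule al1[OF a]) (use that in auto)
    then show ?thesis using straight[of "rv M a" j] al1[of "rv M a" j] a that by auto
  qed
  then have "(\<Sum>j\<in>{1..subdiv a}. \<bar>2 - al (rv M a, j)\<bar>) \<le> (\<Sum>j\<in>{1..subdiv a}. 1)"
    by (rule sum_mono)
  then show "\<bar>X a\<bar> \<le> int (subdiv a)"
    using zero order_trans[OF sum_abs[of "\<lambda>j. 2 - al (rv M a, j)" "{1..subdiv a}"]]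
    by (simp add: X_def)
qed

text \<open>The first \<open>\<bar>x a\<bar>\<close> subdivision vertices of an edge, seen in the direction in which they
  turn positively, take over its bends.\<close>

lemma sub_solution_exists:
  assumes sol: "ortho_solution G M al x"
    and A: "\<And>a. a \<in> A \<Longrightarrow> rv M a \<in> A" "\<And>a. a \<in> A \<Longrightarrow> \<bar>x a\<bar> \<le> int (subdiv a)"
    and off: "\<And>a. a \<in> arcs G \<Longrightarrow> a \<notin> A \<Longrightarrow> subdiv a = 0"
    and sub: "A \<subseteq> arcs G"
  obtains al' x' where "ortho_solution (sub_graph G M n) (sub_emb G M n) al' x'"
    "\<And>a i. a \<in> A \<Longrightarrow> x' (a, i) = 0"
proof -
  define turn where "turn a i =
    (if int i \<le> x a then 1 else if int (subdiv a + 1 - i) \<le> - x a then - 1 else 0 :: int)" for a i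
  define al' where "al' = (\<lambda>(a, i). if i = 0 then al a else 2 + turn a i)"
  \<comment> \<open>Edges of \<open>A\<close> turn only at their subdivision vertices; the others
    have no such vertices and keep their bends.\<close>
  define x' where "x' = (\<lambda>(a, i :: nat). if a \<in> A then 0 else x a)"
  have rvA: "rv M a \<in> A \<longleftrightarrow> a \<in> A" for a using A(1)[of a] A(1)[of "rv M a"] by auto
  have al1: "1 \<le> al a" if "a \<in> arcs G" for a using sol that by (simp add: ortho_solution_def)
  have anti: "x (rv M a) = - x a" if "a \<in> arcs G" for a
    using sol that by (simp add: ortho_solution_def)
  have turn_rv: "turn (rv M a) (subdiv a + 1 - i) = - turn a i"
    if "a \<in> arcs G" "1 \<le> i" "i \<le> subdiv a" for a i
    using that by (auto simp: turn_def anti of_nat_diff)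
  have X: "(\<Sum>i\<le>subdiv a. x' (a, i)) + (\<Sum>j\<in>{1..subdiv a}. 2 - al' (rv M a, j)) = x a"
    if a: "a \<in> arcs G" for a
  proof (cases "a \<in> A")
    case False
    then show ?thesis using off[OF a False] by (simp add: x'_def)
  next
    case True
    have "(\<Sum>j\<in>{1..subdiv a}. 2 - al' (rv M a, j)) = (\<Sum>j\<in>{1..subdiv a}. - turn (rv M a) j)"
      by (rule sum.cong) (auto simp: al'_def)
    also have "\<dots> = - (\<Sum>j\<in>{1..subdiv a}. turn (rv M a) j)" by (rule sum_negf)
    also have "\<dots> = - (\<Sum>j\<in>{1..subdiv a}. turn (rv M a) (subdiv a + 1 - j))"
      by (simp only: sum_flip)
    also have "\<dots> = (\<Sum>j\<in>{1..subdiv a}. turn a j)"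
      unfolding sum_negf[symmetric] by (rule sum.cong) (use turn_rv[OF a] in auto)
    also have "\<dots> = x a"
    proof (cases "x a \<ge> 0")
      case True
      have "turn a j = (if int j \<le> x a then 1 else 0)" if "j \<in> {1..subdiv a}" for j
        using that True by (auto simp: turn_def of_nat_diff)
      then show ?thesis
        using sum_of_bool_le[of "x a" "subdiv a"] True A(2)[OF \<open>a \<in> A\<close>] by simp
    next
      case False
      have "turn a j = - (if int (subdiv a + 1 - j) \<le> - x a then 1 else 0)"
        if "j \<in> {1..subdiv a}" for j
        using that False by (auto simp: turn_def)
      then have "(\<Sum>j\<in>{1..subdiv a}. turn a j)
          = (\<Sum>j\<in>{1..subdiv a}. - (if int (subdiv a + 1 - j) \<le> - x a then 1 else 0))"
        by (rule sum.cong[OF refl])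
      also have "\<dots> = - (\<Sum>j\<in>{1..subdiv a}. if int (subdiv a + 1 - j) \<le> - x a then 1 else 0)"
        by (rule sum_negf)
      also have "\<dots> = - (\<Sum>j\<in>{1..subdiv a}. if int j \<le> - x a then 1 else 0)"
        by (simp only: sum_flip[where h = "\<lambda>j. if int j \<le> - x a then 1 else 0"])
      finally show ?thesis
        using sum_of_bool_le[of "- x a" "subdiv a"] False A(2)[OF \<open>a \<in> A\<close>] by simp
    qed
    finally show ?thesis using True by (simp add: x'_def)
  qed
  have "1 \<le> al' y" if "y \<in> sub_arcs G M n" for y
    using that al1 by (cases y) (simp add: al'_def turn_def)
  moreover have "(\<Sum>y\<in>out_arcs (sub_graph G M n) v. al' y) = 4"
    if v: "v \<in> verts (sub_graph G M n)" for v
  proof -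
    have "sub_tail G M n (a, i) = Inl (tail G a)" if "i = 0" for a i
      using that by (simp add: sub_tail_def)
    moreover from v have "(\<exists>w\<in>verts G. v = Inl w) \<or>
        (\<exists>a i. a \<in> arcs G \<and> i \<le> subdiv a \<and> v = sub_tail G M n (a, i))"
      by (auto simp: sub_graph_def sub_arcs_def)
    ultimately consider w where "v = Inl w" "w \<in> verts G"
      | a i where "a \<in> arcs G" "1 \<le> i" "i \<le> subdiv a" "v = sub_tail G M n (a, i)"
      by (metis less_one not_le tail_in_verts)
    then show ?thesis
    proof cases
      case 1
      then show ?thesis
        using sol by (simp add: sub_out_arcs_Inl sum.reindex inj_on_def al'_def ortho_solution_def)
    next
      case 2
      then show ?thesis
        using turn_rv[OF 2(1-3)] arev_neq[OF 2(1)] by (simp add: sub_out_arcs_Inr al'_def)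
    qed
  qed
  moreover have "x' (rv (sub_emb G M n) y) = - x' y" if "y \<in> sub_arcs G M n" for y
    using that by (auto simp: sub_rv x'_def rvA anti sub_arcs_def)
  moreover have "(\<Sum>y\<in>g. 2 - al' (rv (sub_emb G M n) y) + x' y)
      = (if g = outer (sub_emb G M n) then - 4 else 4)"
    if g: "g \<in> faces (sub_graph G M n) (sub_emb G M n)" for g
  proof -
    from g obtain f where f: "f \<in> faces G M" "g = sub_face f" by (auto simp: sub_faces)
    have "(\<Sum>y\<in>g. 2 - al' (rv (sub_emb G M n) y) + x' y) = (\<Sum>a\<in>f. 2 - al (rv M a) + x a)"
      unfolding f(2) sub_face_sum[OF f(1)]
    proof (rule sum.cong[OF refl])
      fix a assume "a \<in> f"
      then have "a \<in> arcs G" using faces_subset[OF f(1)] by blast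
      from X[OF this] show "2 - al' (rv M a, 0) + ((\<Sum>i\<le>subdiv a. x' (a, i))
          + (\<Sum>j\<in>{1..subdiv a}. 2 - al' (rv M a, j))) = 2 - al (rv M a) + x a"
        by (simp add: al'_def)
    qed
    then show ?thesis
      using sol f unfolding sub_outer f(2) sub_face_eq_iff by (simp add: ortho_solution_def)
  qed
  ultimately have "ortho_solution (sub_graph G M n) (sub_emb G M n) al' x'"
    by (auto simp: ortho_solution_def sub_graph_def)
  then show ?thesis by (rule that) (simp add: x'_def)
qed

text \<open>Subdivision vertices are capacities for the net bends of their edges. No subdivided
  graph has to be inspected after this.\<close>

lemma rectilinear_planar_iff:
  assumes A: "A \<subseteq> arcs G" "\<And>a. a \<in> A \<Longrightarrow> rv M a \<in> A"
    and off: "\<And>a. a \<in> arcs G \<Longrightarrow> a \<notin> A \<Longrightarrow> subdiv a = 0"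
  shows "rectilinear_planar G M A n \<longleftrightarrow>
    (\<exists>al x. ortho_solution G M al x \<and> (\<forall>a\<in>A. \<bar>x a\<bar> \<le> int (subdiv a)))"
proof
  have arcs: "arcs (sub_graph G M n) = sub_arcs G M n" by (simp add: sub_graph_def)
  have fin: "finite g \<and> g \<subseteq> arcs (sub_graph G M n)"
    if g: "g \<in> faces (sub_graph G M n) (sub_emb G M n)" for g
  proof -
    have "g \<subseteq> sub_arcs G M n"
      using g faces_subset by (auto simp: sub_faces sub_arcs_def)
    then show ?thesis using finite_sub_arcs arcs by (auto intro: finite_subset)
  qed
  have rv': "rv (sub_emb G M n) y \<in> arcs (sub_graph G M n)"
    if "y \<in> arcs (sub_graph G M n)" for y
    using that unfolding arcs by (cases y) (auto simp: sub_rv sub_arcs_def)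
  {
    assume "rectilinear_planar G M A n"
    then obtain R where
      R: "orthogonal_representation (sub_graph G M n) (sub_emb G M n) R"
        "\<And>a i. a \<in> A \<Longrightarrow> i \<le> subdiv a \<Longrightarrow> bends R (a, i) = []"
      using A(1) unfolding rectilinear_planar_def by fastforce
    from orthogonal_representation_solution[OF R(1) fin rv']
    have sol: "ortho_solution (sub_graph G M n) (sub_emb G M n)
      (\<lambda>y. int (angle R y div 90)) (\<lambda>y. net_bends (bends R y))" by blast
    have "net_bends (bends R (a, i)) = 0" if "a \<in> A" "i \<le> subdiv a" for a i
      using R(2)[OF that] by (simp add: net_bends_def)
    then show "\<exists>al x. ortho_solution G M al x \<and> (\<forall>a\<in>A. \<bar>x a\<bar> \<le> int (subdiv a))"
      using sub_solution_imp[OF sol] A(1) by blast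
  next
    assume "\<exists>al x. ortho_solution G M al x \<and> (\<forall>a\<in>A. \<bar>x a\<bar> \<le> int (subdiv a))"
    then obtain al x where sol: "ortho_solution G M al x" and x: "\<And>a. a \<in> A \<Longrightarrow> \<bar>x a\<bar> \<le> int (subdiv a)"
      by blast
    obtain al' x' where sol': "ortho_solution (sub_graph G M n) (sub_emb G M n) al' x'"
      and x': "\<And>a i. a \<in> A \<Longrightarrow> x' (a, i) = 0"
      by (rule sub_solution_exists[OF sol _ x off A(1)]) (rule that A(2) | assumption)+
    define R where "R = \<lparr>angle = \<lambda>y. nat (90 * al' y), bends = \<lambda>y. bend_list (x' y)\<rparr>"
    have "orthogonal_representation (sub_graph G M n) (sub_emb G M n) R"
      unfolding R_def
      by (rule ortho_solution_representation[OF sol' fin _ rv'])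
        (auto simp: finite_sub_arcs sub_graph_def)
    moreover have "bends R (a, i) = []" if "a \<in> A" for a i
      using x'[OF that] by (simp add: R_def bend_list_def)
    ultimately show "rectilinear_planar G M A n"
      unfolding rectilinear_planar_def by blast
  }
qed

end

end

section \<open>The lattice of solutions\<close>

context plane_graph
begin

lemma sum_edges:
  fixes h :: "'d set \<Rightarrow> nat"
  assumes A: "A \<subseteq> arcs G" "\<And>a. a \<in> A \<Longrightarrow> rv M a \<in> A"
  shows "(\<Sum>a\<in>A. h (edge_of M a)) = 2 * (\<Sum>E\<in>edge_of M ` A. h E)"
proof -
  have fin: "finite A" using A(1) finite_arcs finite_subset by blast
  have "(\<Sum>a | a \<in> A \<and> edge_of M a = E. h (edge_of M a)) = 2 * h E" if "E \<in> edge_of M ` A" for E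
  proof -
    from that obtain b where b: "b \<in> A" "E = edge_of M b" by blast
    then have "{a. a \<in> A \<and> edge_of M a = E} = {b, rv M b}"
      using A(2) by (auto simp: edge_of_eq_iff)
    moreover have "rv M b \<noteq> b" using arev_neq b(1) A(1) by blast
    ultimately show ?thesis using b by simp
  qed
  then show ?thesis
    unfolding sum.image_gen[OF fin, of "\<lambda>a. h (edge_of M a)" "edge_of M"] sum_distrib_left
    by (rule sum.cong[OF refl])
qed

lemma sum_over_faces:
  fixes g :: "'d \<Rightarrow> int"
  shows "(\<Sum>f\<in>faces G M. \<Sum>a\<in>f. g a) = (\<Sum>a\<in>arcs G. g a)"
proof -
  have "(\<Sum>a\<in>arcs G. g a) = (\<Sum>f\<in>face ` arcs G. \<Sum>a | a \<in> arcs G \<and> face a = f. g a)"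
    by (rule sum.image_gen[OF finite_arcs])
  also have "\<dots> = (\<Sum>f\<in>faces G M. \<Sum>a\<in>f. g a)"
    unfolding faces_def[symmetric] using faces_eq by (intro sum.cong) auto
  finally show ?thesis by simp
qed

text \<open>With degree at most 4 the angles can be chosen at each vertex separately. What the faces
  then lack sums to zero by Euler's formula, so bends can provide it.\<close>

lemma ortho_solution_exists:
  assumes four: "four_graph G" and nonempty: "\<And>v. v \<in> verts G \<Longrightarrow> out_arcs G v \<noteq> {}"
  obtains al x where "ortho_solution G M al x"
proof -
  define base where "base v = (SOME b. b \<in> out_arcs G v)" for v
  \<comment> \<open>All other arcs at the vertex take one quarter turn; the selected arc takes the
    rest, 4 - (d - 1) at degree d.\<close>
  define al where "al a = (if a = base (tail G a) then 5 - int (out_degree G (tail G a)) else 1)" for a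
  have base: "base v \<in> out_arcs G v" if "v \<in> verts G" for v
    unfolding base_def using nonempty[OF that] by (rule some_in_eq[THEN iffD2])
  have sum_out: "(\<Sum>a\<in>out_arcs G v. al a) = 4" if "v \<in> verts G" for v
  proof -
    have "(\<Sum>a\<in>out_arcs G v. al a)
        = (\<Sum>a\<in>out_arcs G v. 1 + (if a = base v then 4 - int (out_degree G v) else 0))"
      by (rule sum.cong) (auto simp: al_def)
    then show ?thesis
      using base[OF that] by (simp add: sum.distrib out_degree_def)
  qed
  define d where "d f = (if f = outer M then - 4 else 4) - (\<Sum>a\<in>f. 2 - al (rv M a))" for f
  have even_arcs: "card (arcs G) = 2 * (card (arcs G) div 2)"
    using sum_edges[of "arcs G" "\<lambda>_. 1"] by simp
  have "(\<Sum>a\<in>arcs G. al (rv M a)) = (\<Sum>a\<in>arcs G. al a)"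
    by (rule sum.reindex_bij_witness[of _ "rv M" "rv M"]) auto
  also have "\<dots> = (\<Sum>v\<in>tail G ` arcs G. \<Sum>a | a \<in> arcs G \<and> tail G a = v. al a)"
    by (rule sum.image_gen[OF finite_arcs])
  also have "tail G ` arcs G = verts G"
    using nonempty by (force simp: out_arcs_def)
  also have "(\<Sum>v\<in>verts G. \<Sum>a | a \<in> arcs G \<and> tail G a = v. al a) = 4 * int (card (verts G))"
    using sum_out by (simp add: out_arcs_def)
  finally have angles: "(\<Sum>a\<in>arcs G. al (rv M a)) = 4 * int (card (verts G))" .
  have "(\<Sum>f\<in>faces G M. if f = outer M then - 4 else 4 :: int)
      = (\<Sum>f\<in>faces G M. 4 - (if f = outer M then 8 else 0))"
    by (rule sum.cong) auto
  also have "\<dots> = 4 * int (card (faces G M)) - 8"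
    using outer_face finite_faces by (simp add: sum_subtractf)
  finally have "(\<Sum>f\<in>faces G M. d f) = 4 * int (card (faces G M)) - 8
      - (2 * int (card (arcs G)) - 4 * int (card (verts G)))"
    unfolding d_def sum_subtractf sum_over_faces angles by simp
  also have "\<dots> = 0" using euler even_arcs by linarith
  finally obtain x where x: "\<And>a. x (rv M a) = - x a"
    "\<And>f. f \<in> faces G M \<Longrightarrow> (\<Sum>a\<in>f. x a) = d f"
    by (rule face_flow) (rule that)
  have "(\<Sum>a\<in>f. 2 - al (rv M a) + x a) = (if f = outer M then - 4 else 4)"
    if "f \<in> faces G M" for f
    using x(2)[OF that] by (simp only: sum.distrib d_def)
  moreover have "1 \<le> al a" if "a \<in> arcs G" for a
    using four that tail_in_verts[OF that] by (auto simp: al_def four_graph_def)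
  ultimately have "ortho_solution G M al x"
    using sum_out x(1) by (simp add: ortho_solution_def)
  then show ?thesis by (rule that)
qed

definition symmetric_arcs :: "'d set \<Rightarrow> bool" where
  "symmetric_arcs A \<longleftrightarrow> A \<subseteq> arcs G \<and> (\<forall>a\<in>A. rv M a \<in> A)"

lemma symmetric_arcsD:
  assumes "symmetric_arcs A" "a \<in> A"
  shows "a \<in> arcs G" "rv M a \<in> A"
  using assms by (auto simp: symmetric_arcs_def)

lemma finite_symmetric_arcs: "symmetric_arcs A \<Longrightarrow> finite A"
  by (rule finite_subset[OF _ finite_arcs]) (simp add: symmetric_arcs_def)

lemma symmetric_arcs_Un: "symmetric_arcs A \<Longrightarrow> symmetric_arcs B \<Longrightarrow> symmetric_arcs (A \<union> B)"
  by (auto simp: symmetric_arcs_def)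

lemma symmetric_arcs_UN: "(\<And>i. i \<in> I \<Longrightarrow> symmetric_arcs (A i)) \<Longrightarrow> symmetric_arcs (\<Union>i\<in>I. A i)"
  by (auto simp: symmetric_arcs_def)

lemma tail_in_ends: "a \<in> A \<Longrightarrow> tail G a \<in> ends G A"
  by (simp add: ends_def)

lemma ends_symmetric: "symmetric_arcs A \<Longrightarrow> ends G A = tail G ` A"
  by (force simp: ends_def symmetric_arcs_def intro: rev_image_eqI[of "rv M _"])

end

text \<open>
  All solutions arise from a fixed one by adding \<^emph>\<open>q\<close> to the directions of the arcs. The face
  conditions then hold automatically, and what remains is a system of difference constraints
  between arcs with a common tail: it is a lattice, and its parts can be exchanged vertex by vertex.
\<close>

locale ortho_base = plane_graph G M
  for G :: "('v, 'd) pre_digraph" and M :: "'d embedding" +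
  fixes al0 x0 :: "'d \<Rightarrow> int"
  assumes four: "four_graph G"
    and base: "ortho_solution G M al0 x0"
begin

definition valid :: "('d \<Rightarrow> int) \<Rightarrow> bool" where
  "valid q \<longleftrightarrow> (\<forall>a\<in>arcs G. 1 \<le> al0 a + q (nxt M a) - q a)"

text \<open>\<open>q\<close> is a value at the tail of an arc, so the two ends of an edge rotate
  independently; the bends of the edge have to make up for the difference.\<close>

definition bend :: "('d \<Rightarrow> int) \<Rightarrow> 'd \<Rightarrow> int" where
  "bend q a = x0 a + q a - q (rv M a)"

lemma base_rv: "a \<in> arcs G \<Longrightarrow> x0 (rv M a) = - x0 a"
  using base by (simp add: ortho_solution_def)

lemma bend_rv: "a \<in> arcs G \<Longrightarrow> bend q (rv M a) = - bend q a"
  by (simp add: bend_def base_rv)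

text \<open>The changes caused by \<open>q\<close> are differences along the permutations of arcs
  around vertices and along faces, so they cancel in every sum.\<close>

lemma valid_solution:
  assumes "valid q"
  shows "ortho_solution G M (\<lambda>a. al0 a + q (nxt M a) - q a) (bend q)"
proof -
  have "(\<Sum>a\<in>out_arcs G v. al0 a + q (nxt M a) - q a) = 4" if "v \<in> verts G" for v
    using base that sum_nxt_out[of q v] by (simp add: ortho_solution_def sum.distrib sum_subtractf)
  moreover have "(\<Sum>a\<in>f. 2 - (al0 (rv M a) + q (nxt M (rv M a)) - q (rv M a)) + bend q a)
      = (if f = outer M then - 4 else 4)" if "f \<in> faces G M" for f
  proof -
    have "(\<Sum>a\<in>f. 2 - (al0 (rv M a) + q (nxt M (rv M a)) - q (rv M a)) + bend q a)
        = (\<Sum>a\<in>f. (2 - al0 (rv M a) + x0 a) + (q a - q (nxt M (rv M a))))"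
      by (rule sum.cong) (auto simp: bend_def)
    also have "\<dots> = (\<Sum>a\<in>f. 2 - al0 (rv M a) + x0 a)"
      using sum_face_step[OF that, of q] by (simp only: sum.distrib sum_subtractf)
    finally show ?thesis using base that by (simp add: ortho_solution_def)
  qed
  ultimately show ?thesis
    using assms bend_rv by (simp add: ortho_solution_def valid_def)
qed

lemma solution_valid:
  assumes sol: "ortho_solution G M al x"
  obtains q where "valid q" "\<And>a. a \<in> arcs G \<Longrightarrow> bend q a = x a"
proof -
  obtain q where q: "\<And>a. a \<in> arcs G \<Longrightarrow> q (nxt M a) = q a + (al a - al0 a)"
    "\<And>a. a \<in> arcs G \<Longrightarrow> q (rv M a) = q a + (x0 a - x a)"
  proof (rule rotation_potential[of "\<lambda>a. x0 a - x a" "\<lambda>a. al a - al0 a"])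
    show "x0 (rv M a) - x (rv M a) = - (x0 a - x a)" if "a \<in> arcs G" for a
      using sol that base_rv by (simp add: ortho_solution_def)
    show "(\<Sum>a\<in>out_arcs G v. al a - al0 a) = 0" if "v \<in> verts G" for v
      using sol base that by (simp add: ortho_solution_def sum_subtractf)
    show "(\<Sum>a\<in>f. x0 a - x a + (al (rv M a) - al0 (rv M a))) = 0" if "f \<in> faces G M" for f
    proof -
      have "(\<Sum>a\<in>f. x0 a - x a + (al (rv M a) - al0 (rv M a)))
          = (\<Sum>a\<in>f. 2 - al0 (rv M a) + x0 a) - (\<Sum>a\<in>f. 2 - al (rv M a) + x a)"
        unfolding sum_subtractf[symmetric] by (rule sum.cong) auto
      then show ?thesis using sol base that by (simp add: ortho_solution_def)
    qed
  qed (rule that)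
  have "valid q" using sol q(1) by (simp add: valid_def ortho_solution_def)
  moreover have "bend q a = x a" if "a \<in> arcs G" for a using q(2)[OF that] by (simp add: bend_def)
  ultimately show ?thesis by (rule that)
qed

lemma valid_zero: "valid (\<lambda>_. 0)"
  using base by (simp add: valid_def ortho_solution_def)

lemma valid_shift: "valid q \<Longrightarrow> valid (\<lambda>a. q a + c)"
  by (auto simp: valid_def)

lemma valid_max:
  assumes "valid p" "valid q" shows "valid (\<lambda>a. max (p a) (q a))"
  unfolding valid_def
proof
  fix a assume "a \<in> arcs G"
  then have "1 \<le> al0 a + p (nxt M a) - p a" "1 \<le> al0 a + q (nxt M a) - q a"
    using assms by (auto simp: valid_def)
  then show "1 \<le> al0 a + max (p (nxt M a)) (q (nxt M a)) - max (p a) (q a)" by linarith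
qed

lemma valid_min:
  assumes "valid p" "valid q" shows "valid (\<lambda>a. min (p a) (q a))"
  unfolding valid_def
proof
  fix a assume "a \<in> arcs G"
  then have "1 \<le> al0 a + p (nxt M a) - p a" "1 \<le> al0 a + q (nxt M a) - q a"
    using assms by (auto simp: valid_def)
  then show "1 \<le> al0 a + min (p (nxt M a)) (q (nxt M a)) - min (p a) (q a)" by linarith
qed

text \<open>The two arcs of an edge have opposite bends, so the chosen representative does not
  matter. Counting per edge matches \<open>subdivides\<close>.\<close>

definition edge_bends :: "('d \<Rightarrow> int) \<Rightarrow> 'd set \<Rightarrow> nat" where
  "edge_bends q E = nat \<bar>bend q (SOME a. a \<in> E)\<bar>"

lemma edge_bends_edge:
  assumes "a \<in> arcs G" shows "edge_bends q (edge_of M a) = nat \<bar>bend q a\<bar>"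
proof -
  have "(SOME b. b \<in> edge_of M a) \<in> edge_of M a" by (rule someI[of _ a]) (simp add: edge_of_def)
  then have "(SOME b. b \<in> edge_of M a) = a \<or> (SOME b. b \<in> edge_of M a) = rv M a"
    by (simp add: edge_of_def)
  then show ?thesis using bend_rv[OF assms, of q] by (auto simp: edge_bends_def)
qed

definition cost :: "'d set \<Rightarrow> ('d \<Rightarrow> int) \<Rightarrow> nat" where
  "cost A q = (\<Sum>E\<in>edge_of M ` A. edge_bends q E)"

text \<open>The rotation ranges over all of \<open>G\<close> although only \<open>A\<close> is
  charged, in line with rectilinear planarity, which lets edges outside of the subgraph
  bend.\<close>

definition opt :: "'d set \<Rightarrow> nat" where
  "opt A = (LEAST k. \<exists>q. valid q \<and> cost A q = k)"

section \<open>Optimal rotations, submodularity and exchange\<close>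

lemma opt_attained: obtains q where "valid q" "cost A q = opt A"
proof -
  have "\<exists>q. valid q \<and> cost A q = opt A"
    unfolding opt_def by (rule LeastI_ex) (use valid_zero in blast)
  then show ?thesis using that by blast
qed

lemma opt_le: "valid q \<Longrightarrow> opt A \<le> cost A q"
  unfolding opt_def by (rule Least_le) blast

lemma cost_cong:
  assumes "A \<subseteq> arcs G" "\<And>a. a \<in> A \<Longrightarrow> \<bar>bend q a\<bar> = \<bar>bend p a\<bar>"
  shows "cost A q = cost A p"
  unfolding cost_def by (rule sum.cong) (use assms edge_bends_edge in auto)

lemma cost_UN:
  assumes I: "finite I" "\<And>i. i \<in> I \<Longrightarrow> symmetric_arcs (A i)"
    and disj: "\<And>i j. i \<in> I \<Longrightarrow> j \<in> I \<Longrightarrow> i \<noteq> j \<Longrightarrow> A i \<inter> A j = {}"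
  shows "cost (\<Union>i\<in>I. A i) q = (\<Sum>i\<in>I. cost (A i) q)"
  unfolding cost_def image_UN
proof (rule sum.UNION_disjoint)
  show "\<forall>i\<in>I. finite (edge_of M ` A i)" using I(2) finite_symmetric_arcs by blast
  show "\<forall>i\<in>I. \<forall>j\<in>I. i \<noteq> j \<longrightarrow> edge_of M ` A i \<inter> edge_of M ` A j = {}"
  proof (intro ballI impI equals0I)
    fix i j E assume ij: "i \<in> I" "j \<in> I" "i \<noteq> j" and "E \<in> edge_of M ` A i \<inter> edge_of M ` A j"
    then obtain a b where "a \<in> A i" "b \<in> A j" "edge_of M a = edge_of M b" by blast
    then have "a \<in> A j"
      using symmetric_arcsD(2)[OF I(2)[OF ij(2)]] by (auto simp: edge_of_eq_iff)
    then show False using \<open>a \<in> A i\<close> disj[OF ij] by blast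
  qed
qed (rule I(1))

text \<open>Write X and Y for the two values on the right. Those on the left are X + D and Y - D,
  with D between 0 and Y - X because \<open>max 0\<close> is monotone and 1-Lipschitz. So they lie
  between X and Y, and convexity applies.\<close>

lemma abs_submodular:
  fixes x pa pb qa qb j :: int
  shows "\<bar>x + max pa (qa - j) - max pb (qb - j)\<bar> + \<bar>x + min (pa + j) qa - min (pb + j) qb\<bar>
    \<le> \<bar>x + pa - pb\<bar> + \<bar>x + qa - qb\<bar>"
proof -
  define D where "D = max 0 (qa - j - pa) - max 0 (qb - j - pb)"
  have eqs: "x + max pa (qa - j) - max pb (qb - j) = x + pa - pb + D"
    "x + min (pa + j) qa - min (pb + j) qb = x + qa - qb - D"
    by (auto simp: D_def max_def min_def)
  have D: "0 \<le> D \<and> D \<le> (x + qa - qb) - (x + pa - pb) \<or>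
      (x + qa - qb) - (x + pa - pb) \<le> D \<and> D \<le> 0"
    by (auto simp: D_def max_def)
  have "\<bar>X + D\<bar> + \<bar>Y - D\<bar> \<le> \<bar>X\<bar> + \<bar>Y\<bar>"
    if "0 \<le> D \<and> D \<le> Y - X \<or> Y - X \<le> D \<and> D \<le> 0" for X Y
    using that by arith
  from this[OF D] show ?thesis unfolding eqs .
qed

text \<open>A constant shift changes no bend, so the lattice operations may be applied to shifted
  rotations; the choice of \<open>j\<close> controls where the two rotations cross.\<close>

lemma cost_submodular:
  assumes A: "A \<subseteq> arcs G"
  shows "cost A (\<lambda>a. max (p a) (q a - j)) + cost A (\<lambda>a. min (p a + j) (q a)) \<le> cost A p + cost A q"
  unfolding cost_def sum.distrib[symmetric]
proof (rule sum_mono)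
  have nat_abs: "nat \<bar>a\<bar> + nat \<bar>b\<bar> \<le> nat \<bar>c\<bar> + nat \<bar>d\<bar>"
    if "\<bar>a\<bar> + \<bar>b\<bar> \<le> \<bar>c\<bar> + \<bar>d\<bar>" for a b c d :: int
    using that by linarith
  fix E assume "E \<in> edge_of M ` A"
  then obtain a where a: "a \<in> arcs G" "E = edge_of M a" using A by blast
  show "edge_bends (\<lambda>a. max (p a) (q a - j)) E + edge_bends (\<lambda>a. min (p a + j) (q a)) E
      \<le> edge_bends p E + edge_bends q E"
    unfolding a(2) edge_bends_edge[OF a(1)] bend_def by (rule nat_abs, rule abs_submodular)
qed

text \<open>Let \<open>z\<close> be an optimum whose turning from \<open>s\<close> to
  \<open>t\<close> is as close as possible to that of \<open>q\<close>, and \<open>d\<close> the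
  remaining gap. The join \<open>z'\<close> has gap \<open>d - 1\<close>, hence is not optimal; by
  submodularity the meet \<open>q'\<close> is then cheaper than \<open>q\<close>, and its turning
  differs from that of \<open>q\<close> by one only.\<close>

lemma exchange_step:
  assumes A: "A \<subseteq> arcs G" and q: "valid q" and z: "valid z" "cost A z = opt A"
    and pos: "q t - q s - (z t - z s) > 0"
    and min: "\<And>z'. valid z' \<Longrightarrow> cost A z' = opt A \<Longrightarrow>
      \<bar>q t - q s - (z t - z s)\<bar> \<le> \<bar>q t - q s - (z' t - z' s)\<bar>"
  obtains q' where "valid q'" "cost A q' < cost A q" "\<bar>q t - q s - (q' t - q' s)\<bar> \<le> 1"
proof -
  define d where "d = q t - q s - (z t - z s)"
  define p where "p a = z a + (q s - z s)" for a
  \<comment> \<open>After aligning at \<open>s\<close>, \<open>p\<close> is \<open>d\<close> below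
    \<open>q\<close> at \<open>t\<close>. Lowering \<open>q\<close> by \<open>d - 1\<close> lets it
    win the maximum at \<open>t\<close> by one without exceeding \<open>p\<close> at
    \<open>s\<close>.\<close>
  define z' where "z' = (\<lambda>a. max (p a) (q a - (d - 1)))"
  define q' where "q' = (\<lambda>a. min (p a + (d - 1)) (q a))"
  have p: "valid p" "cost A p = opt A" "p s = q s" "p t = q t - d"
    using valid_shift[OF z(1), of "q s - z s"] z(2) cost_cong[OF A, of p z]
    by (auto simp: p_def[abs_def] d_def bend_def)
  have "valid (\<lambda>a. q a - (d - 1))" using q by (auto simp: valid_def)
  from valid_max[OF p(1) this] have "valid z'" unfolding z'_def .
  moreover have "z' t - z' s = q t - q s - (d - 1)" using p(3,4) pos by (simp add: z'_def d_def)
  ultimately have "opt A < cost A z'"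
    using min[of z'] opt_le[of z' A] pos by (fastforce simp: d_def)
  then have "cost A q' < cost A q"
    using cost_submodular[OF A, of p q "d - 1"] p(2) by (simp add: z'_def q'_def)
  moreover have "valid q'" unfolding q'_def by (rule valid_min[OF valid_shift[OF p(1)] q])
  moreover have "q' t - q' s = q t - 1 - q s" using p(3,4) pos by (simp add: q'_def d_def)
  ultimately show ?thesis by (intro that[of q']) auto
qed

text \<open>Each step buys a saving of at least one bend with one unit of turning; it is repeated
  until an optimum with the current turning exists.\<close>

lemma exchange:
  assumes A: "A \<subseteq> arcs G" and "valid q"
  obtains z where "valid z" "cost A z = opt A"
    "\<bar>q t - q s - (z t - z s)\<bar> + int (opt A) \<le> int (cost A q)"
proof -
  have "\<exists>z. valid z \<and> cost A z = opt A \<and>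
      \<bar>q t - q s - (z t - z s)\<bar> + int (opt A) \<le> int (cost A q)"
    using assms(2)
  proof (induction "cost A q" arbitrary: q rule: less_induct)
    case less
    let ?d = "\<lambda>z. q t - q s - (z t - z s)"
    obtain z0 where "valid z0 \<and> cost A z0 = opt A" using opt_attained by metis
    then have "\<exists>z. (valid z \<and> cost A z = opt A) \<and>
        (\<forall>z'. valid z' \<and> cost A z' = opt A \<longrightarrow> nat \<bar>?d z\<bar> \<le> nat \<bar>?d z'\<bar>)"
      using ex_has_least_nat[of "\<lambda>z. valid z \<and> cost A z = opt A" z0 "\<lambda>z. nat \<bar>?d z\<bar>"] by blast
    then obtain z where z: "valid z" "cost A z = opt A"
      and least: "\<And>z'. valid z' \<Longrightarrow> cost A z' = opt A \<Longrightarrow> \<bar>?d z\<bar> \<le> \<bar>?d z'\<bar>"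
      by (auto simp: nat_le_eq_zle)
    show ?case
    proof (cases "?d z = 0")
      case True
      then show ?thesis using z opt_le[OF less.prems, of A] by auto
    next
      case False
      have "\<exists>q'. valid q' \<and> cost A q' < cost A q \<and> \<bar>?d q'\<bar> \<le> 1"
      proof (cases "?d z > 0")
        case True
        from exchange_step[OF A less.prems z True least] show ?thesis by blast
      next
        case neg: False
        have swap: "q s - q t - (z' s - z' t) = - ?d z'" for z' :: "'d \<Rightarrow> int" by simp
        have "- ?d z > 0" using neg False by simp
        from exchange_step[OF A less.prems z, of s t] this least show ?thesis
          unfolding swap abs_minus_cancel by blast
      qed
      then obtain q' where q': "valid q'" "cost A q' < cost A q" "\<bar>?d q'\<bar> \<le> 1" by blast
      from less.hyps[OF q'(2,1)] obtain z' where "valid z'" "cost A z' = opt A"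
        "\<bar>q' t - q' s - (z' t - z' s)\<bar> + int (opt A) \<le> int (cost A q')" by blast
      moreover have "\<bar>?d z'\<bar> \<le> \<bar>?d q'\<bar> + \<bar>q' t - q' s - (z' t - z' s)\<bar>" by simp
      ultimately show ?thesis using q'(2,3) by (intro exI[of _ z']) auto
    qed
  qed
  then show ?thesis using that by blast
qed

section \<open>Gluing solutions\<close>

definition patch :: "('d \<Rightarrow> int) \<Rightarrow> ('d \<Rightarrow> int) \<Rightarrow> int \<Rightarrow> 'v set \<Rightarrow> 'd \<Rightarrow> int" where
  "patch q z c S = (\<lambda>a. if tail G a \<in> S then z a + c else q a)"

text \<open>Each constraint compares \<open>a\<close> with \<open>nxt M a\<close>, which have the
  same tail, so any vertexwise mixture of valid rotations is valid.\<close>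

lemma valid_patch: "valid q \<Longrightarrow> valid z \<Longrightarrow> valid (patch q z c S)"
  by (auto simp: valid_def patch_def)

text \<open>Four angles of at least one quarter turn that sum to four are all right angles, so only
  a common rotation of the vertex is possible.\<close>

lemma rigid:
  assumes "out_degree G v = 4" "valid q" "valid z" "a \<in> out_arcs G v" "b \<in> out_arcs G v"
  shows "q a - z a = q b - z b"
proof -
  have right: "al0 a + q (nxt M a) - q a = 1" if "valid q" "a \<in> out_arcs G v" for q a
  proof -
    let ?al = "\<lambda>a. al0 a + q (nxt M a) - q a"
    have v: "v \<in> verts G" using that(2) by auto
    have "(\<Sum>a\<in>out_arcs G v. ?al a - 1) = 0"
      using valid_solution[OF that(1)] v assms(1)
      by (simp add: ortho_solution_def sum_subtractf out_degree_def)
    then have "\<forall>a\<in>out_arcs G v. ?al a - 1 = 0"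
      by (subst (asm) sum_nonneg_eq_0_iff) (use that(1) in \<open>auto simp: valid_def\<close>)
    then show ?thesis using that(2) by auto
  qed
  show ?thesis
  proof (rule out_arcs_induct[OF assms(5), of "\<lambda>a. q a - z a = q b - z b"])
    show "q (nxt M c) - z (nxt M c) = q b - z b"
      if "c \<in> out_arcs G v" "q c - z c = q b - z b" for c
      using right[OF assms(2) that(1)] right[OF assms(3) that(1)] that(2) by simp
  qed (use assms(4) in auto)
qed

text \<open>The condition under which any two valid rotations differ by a constant on the arcs of
  \<open>B\<close> at \<open>v\<close>: there is nothing to compare, or \<open>v\<close> is
  rigid.\<close>

definition aligned :: "'d set \<Rightarrow> 'v \<Rightarrow> bool" where
  "aligned B v \<longleftrightarrow> card (B \<inter> out_arcs G v) \<le> 1 \<or> out_degree G v = 4"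

lemma aligned_shift:
  assumes "aligned B v" "valid q" "valid z"
    and "a \<in> B \<inter> out_arcs G v" "b \<in> B \<inter> out_arcs G v"
  shows "q a - z a = q b - z b"
proof (cases "card (B \<inter> out_arcs G v) \<le> 1")
  case True
  then show ?thesis using assms(4,5) card_le_Suc0_iff_eq[of "B \<inter> out_arcs G v"] by force
next
  case False
  then show ?thesis using assms rigid[of v q z a b] by (auto simp: aligned_def)
qed

lemma glue_aligned:
  assumes A: "symmetric_arcs A" and B: "symmetric_arcs B" and AB: "ends G A \<inter> ends G B \<subseteq> {w}"
    and al: "aligned B w" and q: "valid q1" "valid q2"
  obtains q where "valid q" "\<And>a. a \<in> A \<Longrightarrow> bend q a = bend q1 a" "\<And>a. a \<in> B \<Longrightarrow> bend q a = bend q2 a"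
proof -
  obtain c where c: "\<And>a. a \<in> B \<inter> out_arcs G w \<Longrightarrow> q1 a = q2 a + c"
  proof (cases "B \<inter> out_arcs G w = {}")
    case False
    then obtain b where "b \<in> B \<inter> out_arcs G w" by blast
    then have "q1 a = q2 a + (q1 b - q2 b)" if "a \<in> B \<inter> out_arcs G w" for a
      using aligned_shift[OF al q that, of b] by simp
    then show ?thesis using that by blast
  qed (use that in blast)
  \<comment> \<open>\<open>w\<close> keeps \<open>q1\<close>; by the choice of \<open>c\<close> this
    agrees with the shifted \<open>q2\<close> on the arcs of \<open>B\<close> there.\<close>
  define q where "q = patch q1 q2 c (ends G B - {w})"
  have qA: "q a = q1 a" if "a \<in> A" for a
    using AB tail_in_ends[OF that] by (auto simp: q_def patch_def)
  have qB: "q a = q2 a + c" if "a \<in> B" for a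
    using c[of a] that symmetric_arcsD(1)[OF B that] tail_in_ends[OF that]
    by (auto simp: q_def patch_def)
  show ?thesis
  proof (rule that)
    show "valid q" unfolding q_def by (rule valid_patch[OF q])
    show "bend q a = bend q1 a" if "a \<in> A" for a
      using qA[OF that] qA[OF symmetric_arcsD(2)[OF A that]] by (simp add: bend_def)
    show "bend q a = bend q2 a" if "a \<in> B" for a
      using qB[OF that] qB[OF symmetric_arcsD(2)[OF B that]] by (simp add: bend_def)
  qed
qed

text \<open>With at most four arcs at the common vertex, either one of the two parts has at most one of
  them or all angles there are right angles.\<close>

lemma glue_series:
  assumes A: "symmetric_arcs A" and B: "symmetric_arcs B" and AB: "ends G A \<inter> ends G B \<subseteq> {w}"
    and disj: "A \<inter> B = {}" and q: "valid q1" "valid q2"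
  obtains q where "valid q" "\<And>a. a \<in> A \<Longrightarrow> bend q a = bend q1 a" "\<And>a. a \<in> B \<Longrightarrow> bend q a = bend q2 a"
proof -
  have "card (A \<inter> out_arcs G w) + card (B \<inter> out_arcs G w)
      = card ((A \<inter> out_arcs G w) \<union> (B \<inter> out_arcs G w))"
    using disj by (intro card_Un_disjoint[symmetric]) auto
  also have "\<dots> \<le> out_degree G w"
    unfolding out_degree_def by (intro card_mono) auto
  finally have deg: "card (A \<inter> out_arcs G w) + card (B \<inter> out_arcs G w) \<le> out_degree G w" .
  have "out_degree G w \<le> 4"
  proof (cases "w \<in> verts G")
    case True
    then show ?thesis using four by (simp add: four_graph_def)
  next
    case False
    then have "out_arcs G w = {}" by auto
    then show ?thesis by (simp add: out_degree_def)
  qed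
  with deg consider "aligned A w" | "aligned B w" unfolding aligned_def by linarith
  then show ?thesis
  proof cases
    case 1
    from AB have "ends G B \<inter> ends G A \<subseteq> {w}" by blast
    from glue_aligned[OF B A this 1 q(2,1)] show ?thesis using that by blast
  next
    case 2
    from glue_aligned[OF A B AB 2 q] show ?thesis using that by blast
  qed
qed

text \<open>The difference of the two rotations is absorbed by the single arc at \<open>s\<close>.\<close>

lemma replace_part:
  assumes A: "symmetric_arcs A" and s: "A \<inter> out_arcs G s = {a1}"
    and t: "a2 \<in> A \<inter> out_arcs G t" "aligned A t" and st: "s \<noteq> t" and q: "valid q" "valid z"
  obtains q' where "valid q'"
    "\<And>a. tail G a \<notin> ends G A - {s, t} \<Longrightarrow> q' a = q a"
    "\<And>a. a \<in> A \<Longrightarrow> \<bar>bend q' a\<bar> \<le> \<bar>bend z a\<bar> +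
       (if a \<in> edge_of M a1 then \<bar>q a2 - q a1 - (z a2 - z a1)\<bar> else 0)"
proof -
  define c where "c = q a2 - z a2"
  \<comment> \<open>Both poles keep \<open>q\<close>, so parts that meet \<open>A\<close> only there
    are unaffected. \<open>c\<close> fits the new interior to \<open>q\<close> at \<open>t\<close>,
    which leaves a mismatch at \<open>s\<close> alone.\<close>
  define q' where "q' = patch q z c (ends G A - {s, t})"
  have a1: "a1 \<in> A" "tail G a1 = s" using s by auto
  have qz: "q' a = z a + c" if "a \<in> A" "tail G a \<noteq> s" for a
  proof (cases "tail G a = t")
    case True
    then have "a \<in> A \<inter> out_arcs G t" using that symmetric_arcsD(1)[OF A] by auto
    from aligned_shift[OF t(2) q this t(1)] show ?thesis
      using True by (simp add: q'_def patch_def c_def)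
  next
    case False
    then show ?thesis using that tail_in_ends[OF that(1)] by (simp add: q'_def patch_def)
  qed
  have tail_s: "a = a1" if "a \<in> A" "tail G a = s" for a
    using s that symmetric_arcsD(1)[OF A] by auto
  have "rv M a1 \<noteq> a1" using arev_neq symmetric_arcsD(1)[OF A a1(1)] by blast
  then have "tail G (rv M a1) \<noteq> s" using tail_s symmetric_arcsD(2)[OF A a1(1)] by blast
  then have q_rv: "q' (rv M a1) = z (rv M a1) + c" using qz symmetric_arcsD(2)[OF A a1(1)] by blast
  have "q' a1 = q a1" using a1 by (simp add: q'_def patch_def)
  with q_rv have a1_bend: "\<bar>bend q' a1\<bar> \<le> \<bar>bend z a1\<bar> + \<bar>q a2 - q a1 - (z a2 - z a1)\<bar>"
    by (simp add: bend_def c_def)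
  show ?thesis
  proof (rule that)
    show "valid q'" unfolding q'_def by (rule valid_patch[OF q])
    show "q' a = q a" if "tail G a \<notin> ends G A - {s, t}" for a
      using that by (auto simp: q'_def patch_def)
    fix a assume a: "a \<in> A"
    show "\<bar>bend q' a\<bar> \<le> \<bar>bend z a\<bar> +
       (if a \<in> edge_of M a1 then \<bar>q a2 - q a1 - (z a2 - z a1)\<bar> else 0)"
    proof (cases "a \<in> edge_of M a1")
      case True
      then have "a = a1 \<or> a = rv M a1" by (simp add: edge_of_def)
      then show ?thesis
        using a1_bend bend_rv[OF symmetric_arcsD(1)[OF A a1(1)]] True by auto
    next
      case False
      then have "tail G a \<noteq> s" "tail G (rv M a) \<noteq> s"
        using tail_s[OF a] tail_s[OF symmetric_arcsD(2)[OF A a]] rv_rv[of a]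
        by (auto simp: edge_of_def)
      then show ?thesis
        using qz[OF a] qz[OF symmetric_arcsD(2)[OF A a]] False by (simp add: bend_def)
    qed
  qed
qed

end

section \<open>Budgets\<close>

text \<open>Every arc ends in a vertex not met so far, so no arc of the list closes a cycle. Tails
  may be new as well, which lets a path grow from the empty set in \<open>opt_path\<close>.\<close>

fun attachable :: "('v, 'd) pre_digraph \<Rightarrow> 'v set \<Rightarrow> 'd list \<Rightarrow> bool" where
  "attachable G V [] \<longleftrightarrow> True"
| "attachable G V (a # p) \<longleftrightarrow> head G a \<notin> V \<and> tail G a \<noteq> head G a \<and>
     attachable G (insert (tail G a) (insert (head G a) V)) p"

context plane_graph
begin

section \<open>Paths and the subgraphs of tree nodes\<close>

lemma attachable_path:
  assumes "cas s p t" "distinct (awalk_verts s p)" "set (awalk_verts s p) \<inter> V \<subseteq> {s}"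
  shows "attachable G V p"
  using assms
proof (induction p arbitrary: s V)
  case (Cons a p)
  let ?W = "set (awalk_verts (head G a) p)"
  have a: "tail G a = s" "cas (head G a) p t" "s \<notin> ?W" "distinct (awalk_verts (head G a) p)"
    "?W \<inter> V \<subseteq> {s}"
    using Cons.prems by auto
  have "head G a \<in> ?W" by (cases p) (use a(2) in auto)
  moreover have "attachable G (insert (tail G a) (insert (head G a) V)) p"
    by (rule Cons.IH[OF a(2,4)]) (use a(1,3,5) in blast)
  ultimately show ?case using a(1,3,5) by auto
qed simp

lemma reverse_path:
  assumes "cas s p t" "set p \<subseteq> arcs G"
  shows "cas t (rev (map (rv M) p)) s" "awalk_verts t (rev (map (rv M) p)) = rev (awalk_verts s p)"
proof -
  show rev: "cas t (rev (map (rv M) p)) s" using assms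
  proof (induction p arbitrary: s)
    case (Cons a p)
    then have "cas t (rev (map (rv M) p)) (head G a)" by simp
    moreover from this have "awlast t (rev (map (rv M) p)) = head G a" by (rule awlast_if_cas)
    ultimately show ?case using Cons.prems by (simp add: cas_append_iff)
  qed simp
  show "awalk_verts t (rev (map (rv M) p)) = rev (awalk_verts s p)"
  proof (cases "p = []")
    case False
    have "map (tail G) (rev (map (rv M) p)) = rev (map (head G) p)"
      using assms(2) by (auto simp: rev_map)
    moreover have "head G (last (rev (map (rv M) p))) = tail G (hd p)"
      using False assms(2) by (simp add: last_rev hd_map subset_iff)
    ultimately show ?thesis
      using False awalk_verts_conv'[OF assms(1)] by (simp add: awalk_verts_conv)
  qed (use assms(1) in simp)
qed

text \<open>A simple path has one arc at each end. For the path of the reference edge this is what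
  lets it absorb rotation at the root.\<close>

lemma apath_arcs:
  assumes "apath s p t" "p \<noteq> []"
  shows "s \<noteq> t" "(set p \<union> rv M ` set p) \<inter> out_arcs G s = {hd p}"
    "(set p \<union> rv M ` set p) \<inter> out_arcs G t = {rv M (last p)}"
    "\<And>a. a \<in> set p \<Longrightarrow> tail G a \<noteq> head G a"
proof -
  have p: "cas s p t" "set p \<subseteq> arcs G" "distinct (awalk_verts s p)"
    using assms by (auto simp: apath_def awalk_def)
  have tails: "awalk_verts s p = map (tail G) p @ [head G (last p)]"
    using assms(2) by (simp add: awalk_verts_conv)
  have heads: "awalk_verts s p = tail G (hd p) # map (head G) p"
    using awalk_verts_conv'[OF p(1)] assms(2) by simp
  have s: "tail G (hd p) = s" using p(1) assms(2) by (simp add: cas_simp)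
  have t: "head G (last p) = t"
    using awlast_if_cas[OF p(1)] tails by simp
  have dt: "distinct (map (tail G) p)" "t \<notin> tail G ` set p" using p(3) t unfolding tails by auto
  have dh: "distinct (map (head G) p)" "s \<notin> head G ` set p" using p(3) s unfolding heads by auto
  have hl: "hd p \<in> set p" "last p \<in> set p" using assms(2) by auto
  show "s \<noteq> t" using dh(2) hl(2) t by blast
  have tail_inj: "a = hd p" if "a \<in> set p" "tail G a = s" for a
    using dt(1) hl(1) that s by (auto simp: distinct_map dest: inj_onD)
  have head_inj: "a = last p" if "a \<in> set p" "head G a = t" for a
    using dh(1) hl(2) that t by (auto simp: distinct_map dest: inj_onD)
  show "(set p \<union> rv M ` set p) \<inter> out_arcs G s = {hd p}"
  proof -
    have "a = hd p" if "a \<in> (set p \<union> rv M ` set p) \<inter> out_arcs G s" for a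
    proof -
      have "a \<notin> rv M ` set p" using that dh(2) p(2) by auto
      then show ?thesis using that tail_inj by auto
    qed
    moreover have "hd p \<in> (set p \<union> rv M ` set p) \<inter> out_arcs G s" using hl(1) s p(2) by auto
    ultimately show ?thesis by blast
  qed
  show "(set p \<union> rv M ` set p) \<inter> out_arcs G t = {rv M (last p)}"
  proof -
    have "a = rv M (last p)" if a: "a \<in> (set p \<union> rv M ` set p) \<inter> out_arcs G t" for a
    proof -
      have "a \<notin> set p" using a dt(2) by auto
      then obtain b where b: "b \<in> set p" "a = rv M b" using a by blast
      then have "head G b = t" using a p(2) by auto
      then show ?thesis using b head_inj by blast
    qed
    moreover have "rv M (last p) \<in> (set p \<union> rv M ` set p) \<inter> out_arcs G t"
      using hl(2) t p(2) by auto
    ultimately show ?thesis by blast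
  qed
  fix a assume "a \<in> set p"
  then obtain i where i: "i < length p" "a = p ! i" by (auto simp: in_set_conv_nth)
  have "awalk_verts s p ! i = tail G a" using i by (simp add: tails nth_append)
  moreover have "awalk_verts s p ! Suc i = head G a" using i by (simp add: heads)
  ultimately show "tail G a \<noteq> head G a"
    using nth_eq_iff_index_eq[OF p(3), of i "Suc i"] i by (simp add: length_awalk_verts)
qed

lemma ends_Un: "ends G (A \<union> B) = ends G A \<union> ends G B"
  by (auto simp: ends_def)

lemma ends_UN: "ends G (\<Union>i\<in>I. A i) = (\<Union>i\<in>I. ends G (A i))"
  by (auto simp: ends_def)

text \<open>Series compositions restrict common vertices only. An arc in both parts would have both
  of its ends at \<open>w\<close>.\<close>

lemma loopless_disjoint:
  assumes A: "symmetric_arcs A" "symmetric_arcs B" and "ends G A \<inter> ends G B \<subseteq> {w}"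
    and "\<And>a. a \<in> A \<Longrightarrow> tail G a \<noteq> head G a"
  shows "A \<inter> B = {}"
proof (rule equals0I)
  fix a assume "a \<in> A \<inter> B"
  then have "tail G a = w" "head G a = w" using assms(3) by (auto simp: ends_def)
  then show False using assms(4)[of a] \<open>a \<in> A \<inter> B\<close> by simp
qed

lemma node_arcs_children: "children T = ts \<Longrightarrow> ts \<noteq> [] \<Longrightarrow>
    node_arcs M T = (\<Union>i<length ts. node_arcs M (ts ! i))"
proof -
  assume T: "children T = ts" "ts \<noteq> []"
  have "set ts = (!) ts ` {..<length ts}" by (auto simp: set_conv_nth)
  then have "(\<Union>i<length ts. node_arcs M (ts ! i)) = (\<Union>t\<in>set ts. node_arcs M t)" by simp
  then show ?thesis using T by (cases T) auto
qed

lemma decomposes_basic: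
  assumes "decomposes G M T s t"
  shows "s \<noteq> t \<and> symmetric_arcs (node_arcs M T) \<and>
    node_arcs M T \<inter> out_arcs G s \<noteq> {} \<and> node_arcs M T \<inter> out_arcs G t \<noteq> {} \<and>
    (\<forall>a\<in>node_arcs M T. tail G a \<noteq> head G a)"
  using assms
proof induction
  case (QStar p s t)
  have "set p \<subseteq> arcs G" using QStar(2) by (auto simp: apath_def awalk_def)
  then show ?case
    using apath_arcs[OF QStar(2,1)] by (fastforce simp: symmetric_arcs_def)
next
  case (SNode ts ws)
  let ?A = "\<lambda>i. node_arcs M (ts ! i)"
  have IH: "ws ! i \<noteq> ws ! (i + 1)" "symmetric_arcs (?A i)" "?A i \<inter> out_arcs G (ws ! i) \<noteq> {}"
    "?A i \<inter> out_arcs G (ws ! (i + 1)) \<noteq> {}" "\<forall>a\<in>?A i. tail G a \<noteq> head G a"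
    if "i < length ts" for i
    using SNode.IH[OF that] by auto
  let ?h = "length ts - 1"
  have h: "0 < length ts" "?h < length ts" "0 < ?h" "?h + 1 = length ts" using SNode(1) by auto
  have hd: "hd ws = ws ! 0" and last: "last ws = ws ! (?h + 1)"
    using SNode(1,2) by (auto simp: hd_conv_nth last_conv_nth simp flip: length_greater_0_conv)
  have A: "node_arcs M (SNode ts) = (\<Union>i<length ts. ?A i)"
    by (rule node_arcs_children) (use h in auto)
  have ws0: "ws ! 0 \<in> ends G (?A 0)" using IH(3)[OF h(1)] tail_in_ends[of _ "?A 0"] by force
  have wsh: "ws ! (?h + 1) \<in> ends G (?A ?h)" using IH(4)[OF h(2)] tail_in_ends[of _ "?A ?h"] by force
  \<comment> \<open>If the poles coincided, the first and the last child would share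
    \<open>ws ! 0\<close>. They share a vertex only if they are adjacent, and then it is
    \<open>ws ! 1\<close>.\<close>
  have "ws ! 0 \<noteq> ws ! (?h + 1)"
  proof
    assume "ws ! 0 = ws ! (?h + 1)"
    then have "ws ! 0 \<in> ends G (?A 0) \<inter> ends G (?A ?h)" using ws0 wsh by (metis IntI)
    then have "ws ! 0 \<in> (if ?h = 0 + 1 then {ws ! ?h} else {})"
      unfolding SNode.hyps(4)[OF h(3,2)] .
    then show False using IH(1)[OF h(1)] by (auto split: if_splits)
  qed
  moreover have "symmetric_arcs (node_arcs M (SNode ts))"
    unfolding A by (rule symmetric_arcs_UN) (use IH(2) in auto)
  moreover have "node_arcs M (SNode ts) \<inter> out_arcs G (ws ! 0) \<noteq> {}"
    unfolding A using IH(3)[OF h(1)] h(1) by blast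
  moreover have "node_arcs M (SNode ts) \<inter> out_arcs G (ws ! (?h + 1)) \<noteq> {}"
    unfolding A using IH(4)[OF h(2)] h(2) by blast
  moreover have "\<forall>a\<in>node_arcs M (SNode ts). tail G a \<noteq> head G a"
    unfolding A using IH(5) by blast
  ultimately show ?case unfolding hd last by blast
next
  case (PNode ts s t)
  let ?A = "\<lambda>i. node_arcs M (ts ! i)"
  have IH: "s \<noteq> t" "symmetric_arcs (?A i)" "?A i \<inter> out_arcs G s \<noteq> {}"
    "?A i \<inter> out_arcs G t \<noteq> {}" "\<forall>a\<in>?A i. tail G a \<noteq> head G a"
    if "i < length ts" for i
    using PNode.IH[OF that] by auto
  have h: "0 < length ts" using PNode(1) by linarith
  have A: "node_arcs M (PNode ts) = (\<Union>i<length ts. ?A i)"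
    by (rule node_arcs_children) (use h in auto)
  have "symmetric_arcs (node_arcs M (PNode ts))"
    unfolding A by (rule symmetric_arcs_UN) (use IH(2) in auto)
  then show ?case unfolding A using IH[OF h] IH(5) h by blast
qed

end

context ortho_base
begin

section \<open>Budgets in terms of rotations\<close>

lemma rectilinear_planar_valid:
  assumes A: "symmetric_arcs A" and n: "\<And>E. E \<notin> edge_of M ` A \<Longrightarrow> n E = 0"
  shows "rectilinear_planar G M A n \<longleftrightarrow>
    (\<exists>q. valid q \<and> (\<forall>a\<in>A. \<bar>bend q a\<bar> \<le> int (n (edge_of M a))))"
proof -
  have "n (edge_of M a) = 0" if "a \<in> arcs G" "a \<notin> A" for a
  proof (rule n, rule notI)
    assume "edge_of M a \<in> edge_of M ` A"
    then obtain b where "b \<in> A" "edge_of M a = edge_of M b" by blast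
    then have "a \<in> A" using symmetric_arcsD(2)[OF A] by (auto simp: edge_of_eq_iff)
    with that show False by blast
  qed
  then have "rectilinear_planar G M A n \<longleftrightarrow>
    (\<exists>al x. ortho_solution G M al x \<and> (\<forall>a\<in>A. \<bar>x a\<bar> \<le> int (n (edge_of M a))))"
    using A by (intro rectilinear_planar_iff) (auto simp: symmetric_arcs_def)
  also have "\<dots> \<longleftrightarrow> (\<exists>q. valid q \<and> (\<forall>a\<in>A. \<bar>bend q a\<bar> \<le> int (n (edge_of M a))))"
    using solution_valid valid_solution symmetric_arcsD(1)[OF A] by (metis (no_types, lifting))
  finally show ?thesis .
qed

lemma cost_le_subdivides:
  assumes A: "symmetric_arcs A" and "subdivides M A k n"
    and "\<And>a. a \<in> A \<Longrightarrow> \<bar>bend q a\<bar> \<le> int (n (edge_of M a))"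
  shows "cost A q \<le> k"
proof -
  have "cost A q \<le> (\<Sum>E\<in>edge_of M ` A. n E)"
    unfolding cost_def
    by (rule sum_mono) (use assms(3) symmetric_arcsD(1)[OF A] edge_bends_edge in fastforce)
  then show ?thesis using assms(2) by (simp add: subdivides_def)
qed

definition bends_on :: "'d set \<Rightarrow> ('d \<Rightarrow> int) \<Rightarrow> 'd set \<Rightarrow> nat" where
  "bends_on A q E = (if E \<in> edge_of M ` A then edge_bends q E else 0)"

lemma subdivides_bends_on: "subdivides M A (cost A q) (bends_on A q)"
  by (simp add: subdivides_def bends_on_def cost_def)

lemma bends_on_edge: "a \<in> A \<Longrightarrow> a \<in> arcs G \<Longrightarrow> int (bends_on A q (edge_of M a)) = \<bar>bend q a\<bar>"
  by (simp add: bends_on_def edge_bends_edge)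

lemma rectilinear_bends_on:
  assumes "symmetric_arcs A" "valid q"
  shows "rectilinear_planar G M A (bends_on A q)"
proof -
  have "\<bar>bend q a\<bar> \<le> int (bends_on A q (edge_of M a))" if "a \<in> A" for a
    using bends_on_edge[OF that] symmetric_arcsD(1)[OF assms(1) that] by simp
  moreover have "bends_on A q E = 0" if "E \<notin> edge_of M ` A" for E
    using that by (simp add: bends_on_def)
  ultimately show ?thesis using rectilinear_planar_valid[OF assms(1)] assms(2) by blast
qed

text \<open>What a type of node has to supply is a witness: optimal rotations \<open>z\<close> of
  the children, a common rotation \<open>q\<close>, and further vertices \<open>m\<close> that pay
  for the bends of \<open>q\<close> in excess of those of \<open>z\<close>.\<close>

lemma budget_opt:
  fixes T :: "'d spq" and ts :: "'d spq list"
  defines "h \<equiv> length ts" and "A \<equiv> \<lambda>i. node_arcs M (ts ! i)"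
  assumes ts: "children T = ts"
    and AT: "node_arcs M T = (\<Union>i<h. A i)"
    and sym: "\<And>i. i < h \<Longrightarrow> symmetric_arcs (A i)"
    and bs: "length bs = h" "\<And>i. i < h \<Longrightarrow> bs ! i = opt (A i)"
    and z: "\<And>i. i < h \<Longrightarrow> valid (z i)" "\<And>i. i < h \<Longrightarrow> cost (A i) (z i) = opt (A i)"
    and q: "valid q" and m: "subdivides M (node_arcs M T) k m"
    and qz: "\<And>i a. i < h \<Longrightarrow> a \<in> A i \<Longrightarrow> \<bar>bend q a\<bar> \<le> \<bar>bend (z i) a\<bar> + int (m (edge_of M a))"
    and k: "k + (\<Sum>i<h. opt (A i)) \<le> opt (node_arcs M T)"
  shows "budget G M T bs + sum_list bs = opt (node_arcs M T)"
proof -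
  have symT: "symmetric_arcs (node_arcs M T)"
    unfolding AT by (rule symmetric_arcs_UN) (use sym in auto)
  have finT: "finite (edge_of M ` node_arcs M T)"
    using finite_symmetric_arcs[OF symT] by blast
  have sum_bs: "sum_list bs = (\<Sum>i<h. opt (A i))"
    using bs by (simp add: sum_list_sum_nth atLeast0LessThan)
  define P where "P k \<longleftrightarrow> (\<exists>ns m n. length ns = length (children T) \<and>
       (\<forall>i < length (children T).
          subdivides M (node_arcs M (children T ! i)) (bs ! i) (ns ! i) \<and>
          rectilinear_planar G M (node_arcs M (children T ! i)) (ns ! i)) \<and>
       subdivides M (node_arcs M T) k m \<and>
       n = (\<lambda>E. (\<Sum>i < length ns. (ns ! i) E) + m E) \<and>
       rectilinear_planar G M (node_arcs M T) n)" for k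
  have budget: "budget G M T bs = (LEAST k. P k)" unfolding budget_def P_def ..
  have "P k"
  proof -
    \<comment> \<open>Each child receives one vertex per bend of its optimal rotation, hence exactly
      \<open>bs ! i\<close> vertices.\<close>
    let ?ns = "map (\<lambda>i. bends_on (A i) (z i)) [0..<h]"
    let ?n = "\<lambda>E. (\<Sum>i < length ?ns. (?ns ! i) E) + m E"
    have n: "?n E = (\<Sum>i<h. bends_on (A i) (z i) E) + m E" for E by simp
    have off: "?n E = 0" if "E \<notin> edge_of M ` node_arcs M T" for E
      using that m unfolding n AT by (auto simp: bends_on_def subdivides_def)
    have "\<bar>bend q a\<bar> \<le> int (?n (edge_of M a))" if a: "a \<in> node_arcs M T" for a
    proof -
      from a obtain i where i: "i < h" "a \<in> A i" unfolding AT by blast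
      have "bends_on (A i) (z i) (edge_of M a) \<le> (\<Sum>i<h. bends_on (A i) (z i) (edge_of M a))"
        by (rule member_le_sum) (use i in auto)
      then show ?thesis
        using qz[OF i] bends_on_edge[OF i(2) symmetric_arcsD(1)[OF sym[OF i(1)] i(2)], of "z i"]
        unfolding n by linarith
    qed
    then have "rectilinear_planar G M (node_arcs M T) ?n"
      using rectilinear_planar_valid[OF symT, of ?n] off q by blast
    moreover have "\<forall>i<length (children T).
        subdivides M (node_arcs M (children T ! i)) (bs ! i) (?ns ! i) \<and>
        rectilinear_planar G M (node_arcs M (children T ! i)) (?ns ! i)"
    proof (intro allI impI)
      fix i assume "i < length (children T)"
      then have i: "i < h" by (simp add: h_def ts)
      show "subdivides M (node_arcs M (children T ! i)) (bs ! i) (?ns ! i) \<and>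
        rectilinear_planar G M (node_arcs M (children T ! i)) (?ns ! i)"
        using subdivides_bends_on[of "A i" "z i"] rectilinear_bends_on[OF sym[OF i] z(1)[OF i]]
          z(2)[OF i] bs(2)[OF i] i by (simp add: A_def ts)
    qed
    ultimately show ?thesis
      unfolding P_def using m by (intro exI[of _ ?ns] exI[of _ m] exI[of _ ?n]) (simp add: h_def ts)
  qed
  then have "budget G M T bs \<le> k" "P (budget G M T bs)"
    unfolding budget by (rule Least_le, rule LeastI)
  \<comment> \<open>The vertices of the children and the further ones together form one subdivision
    of the node, so their total cannot be below the optimum.\<close>
  moreover have "opt (node_arcs M T) \<le> k' + sum_list bs" if "P k'" for k'
  proof -
    from that obtain ns m' n where ns: "length ns = h"
      "\<And>i. i < h \<Longrightarrow> subdivides M (A i) (bs ! i) (ns ! i)"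
      and m': "subdivides M (node_arcs M T) k' m'"
      and n: "n = (\<lambda>E. (\<Sum>i < length ns. (ns ! i) E) + m' E)"
        "rectilinear_planar G M (node_arcs M T) n"
      unfolding P_def A_def h_def ts by blast
    have off: "(ns ! i) E = 0" if "i < h" "E \<notin> edge_of M ` A i" for i E
      using ns(2)[OF that(1)] that(2) by (simp add: subdivides_def)
    have "(\<Sum>E\<in>edge_of M ` node_arcs M T. (ns ! i) E) = bs ! i" if i: "i < h" for i
    proof -
      have "(\<Sum>E\<in>edge_of M ` node_arcs M T. (ns ! i) E) = (\<Sum>E\<in>edge_of M ` A i. (ns ! i) E)"
        by (rule sum.mono_neutral_right[OF finT]) (use i AT off[OF i] in auto)
      then show ?thesis using ns(2)[OF i] by (simp add: subdivides_def)
    qed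
    then have "(\<Sum>i<h. \<Sum>E\<in>edge_of M ` node_arcs M T. (ns ! i) E) = sum_list bs"
      using bs by (simp add: sum_list_sum_nth atLeast0LessThan)
    then have "(\<Sum>E\<in>edge_of M ` node_arcs M T. \<Sum>i<h. (ns ! i) E) = sum_list bs"
      by (subst sum.swap)
    then have tot: "(\<Sum>E\<in>edge_of M ` node_arcs M T. n E) = sum_list bs + k'"
      using m' unfolding n(1) sum.distrib ns(1) by (simp add: subdivides_def)
    have offT: "n E = 0" if "E \<notin> edge_of M ` node_arcs M T" for E
    proof -
      have "E \<notin> edge_of M ` A i" if "i < h" for i
        using that \<open>E \<notin> _\<close> unfolding AT by blast
      then show ?thesis using off that m' unfolding n(1) ns(1) by (simp add: subdivides_def)
    qed
    with tot have sub: "subdivides M (node_arcs M T) (sum_list bs + k') n"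
      by (simp add: subdivides_def)
    have "\<exists>q'. valid q' \<and> (\<forall>a\<in>node_arcs M T. \<bar>bend q' a\<bar> \<le> int (n (edge_of M a)))"
      using rectilinear_planar_valid[OF symT, of n] offT n(2) by blast
    then obtain q' where q': "valid q'"
      "\<And>a. a \<in> node_arcs M T \<Longrightarrow> \<bar>bend q' a\<bar> \<le> int (n (edge_of M a))"
      by blast
    show ?thesis
      using cost_le_subdivides[OF symT sub q'(2)] opt_le[OF q'(1), of "node_arcs M T"] by simp
  qed
  ultimately show ?thesis using k sum_bs by (simp add: order_antisym)
qed

text \<open>An arc with a new head meets \<open>A\<close> at most in its tail, where it can be
  straightened separately and then glued on.\<close>

lemma attach_zero:
  assumes "symmetric_arcs A" "valid z" "attachable G (ends G A) l" "set l \<subseteq> arcs G"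
  shows "\<exists>q. valid q \<and> (\<forall>a\<in>A. bend q a = bend z a) \<and> (\<forall>a\<in>set l. bend q a = 0)"
  using assms
proof (induction l arbitrary: A z)
  case (Cons b l)
  have b: "b \<in> arcs G" "head G b \<notin> ends G A" "tail G b \<noteq> head G b" using Cons.prems by auto
  have sym: "symmetric_arcs {b, rv M b}" using b by (auto simp: symmetric_arcs_def)
  \<comment> \<open>Rotating the tail of \<open>b\<close> by the number of its bends straightens
    \<open>b\<close>. Other arcs there may be spoilt, but only \<open>b\<close> is taken from
    \<open>z'\<close>.\<close>
  define z' where "z' = patch z z (- bend z b) {tail G b}"
  have "bend z' b = 0" using b by (simp add: z'_def patch_def bend_def)
  then have z'_rv: "bend z' (rv M b) = 0" using bend_rv[OF b(1)] by simp
  have ends_b: "ends G {b, rv M b} = {tail G b, head G b}" using b by (auto simp: ends_def)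
  obtain q where q: "valid q" "\<And>a. a \<in> A \<Longrightarrow> bend q a = bend z a"
    "\<And>a. a \<in> {b, rv M b} \<Longrightarrow> bend q a = bend z' a"
  proof (rule glue_series[OF Cons.prems(1) sym, of "tail G b" z z'])
    show "ends G A \<inter> ends G {b, rv M b} \<subseteq> {tail G b}" using b(2) unfolding ends_b by blast
    show "A \<inter> {b, rv M b} = {}"
      using b symmetric_arcsD(2)[OF Cons.prems(1), of "rv M b"] by (auto simp: ends_def)
    show "valid z'" unfolding z'_def by (rule valid_patch[OF Cons.prems(2,2)])
    show "valid z" by (rule Cons.prems(2))
  qed (rule that)
  let ?B = "A \<union> {b, rv M b}"
  have "ends G ?B = insert (tail G b) (insert (head G b) (ends G A))"
    unfolding ends_Un ends_b by auto
  then obtain q' where "valid q'" "\<forall>a\<in>?B. bend q' a = bend q a" "\<forall>a\<in>set l. bend q' a = 0"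
    using Cons.IH[OF symmetric_arcs_Un[OF Cons.prems(1) sym] q(1)] Cons.prems by auto
  then show ?case using q \<open>bend z' b = 0\<close> by (intro exI[of _ q']) auto
qed auto

lemma opt_path:
  assumes "apath s p t" shows "opt (set p \<union> rv M ` set p) = 0"
proof -
  have p: "cas s p t" "set p \<subseteq> arcs G" "distinct (awalk_verts s p)"
    using assms by (auto simp: apath_def awalk_def)
  have "attachable G (ends G {}) p"
    by (rule attachable_path[OF p(1,3)]) (simp add: ends_def)
  then obtain q where q: "valid q" "\<forall>a\<in>set p. bend q a = 0"
    using attach_zero[of "{}" "\<lambda>_. 0" p] valid_zero p(2) by (auto simp: symmetric_arcs_def)
  then have "bend q a = 0" if "a \<in> set p \<union> rv M ` set p" for a
    using that p(2) bend_rv by auto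
  then have "edge_bends q (edge_of M a) = 0" if "a \<in> set p \<union> rv M ` set p" for a
    using edge_bends_edge[of a q] that p(2) by auto
  then have "cost (set p \<union> rv M ` set p) q = 0" by (auto simp: cost_def)
  then show ?thesis using opt_le[OF q(1)] by (metis le_zero_eq)
qed

text \<open>The bound \<open>{w j}\<close> depends on the later part only, so the union of all
  earlier parts also meets part \<open>j\<close> in at most one vertex.\<close>

lemma glue_chain:
  fixes h :: nat
  assumes sym: "\<And>i. i < h \<Longrightarrow> symmetric_arcs (A i)"
    and ends: "\<And>i j. i < j \<Longrightarrow> j < h \<Longrightarrow> ends G (A i) \<inter> ends G (A j) \<subseteq> {w j}"
    and disj: "\<And>i j. i < j \<Longrightarrow> j < h \<Longrightarrow> A i \<inter> A j = {}"
    and z: "\<And>i. i < h \<Longrightarrow> valid (z i)"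
  obtains q where "valid q" "\<And>i a. i < h \<Longrightarrow> a \<in> A i \<Longrightarrow> bend q a = bend (z i) a"
proof -
  have "\<exists>q. valid q \<and> (\<forall>i<j. \<forall>a\<in>A i. bend q a = bend (z i) a)" if "j \<le> h" for j
    using that
  proof (induction j)
    case 0
    show ?case using valid_zero by (intro exI[of _ "\<lambda>_. 0"]) simp
  next
    case (Suc j)
    then have "\<exists>q. valid q \<and> (\<forall>i<j. \<forall>a\<in>A i. bend q a = bend (z i) a)" by simp
    then obtain q where q: "valid q" "\<And>i a. i < j \<Longrightarrow> a \<in> A i \<Longrightarrow> bend q a = bend (z i) a" by blast
    have j: "j < h" using Suc.prems by simp
    obtain q' where q': "valid q'" "\<And>a. a \<in> (\<Union>i<j. A i) \<Longrightarrow> bend q' a = bend q a"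
      "\<And>a. a \<in> A j \<Longrightarrow> bend q' a = bend (z j) a"
    proof (rule glue_series[of "\<Union>i<j. A i" "A j" "w j" q "z j"])
      show "symmetric_arcs (\<Union>i<j. A i)" by (rule symmetric_arcs_UN) (use sym j in auto)
      show "ends G (\<Union>i<j. A i) \<inter> ends G (A j) \<subseteq> {w j}"
        unfolding ends_UN using ends[OF _ j] by blast
      show "(\<Union>i<j. A i) \<inter> A j = {}" using disj[OF _ j] by blast
      show "symmetric_arcs (A j)" by (rule sym[OF j])
      show "valid (z j)" by (rule z[OF j])
    qed (rule q(1), rule that)
    have "bend q' a = bend (z i) a" if "i < Suc j" "a \<in> A i" for i a
    proof (cases "i = j")
      case False
      then have "i < j" using that by simp
      then show ?thesis using q'(2)[of a] q(2)[of i a] that by auto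
    qed (use q'(3) that in simp)
    then show ?case using q'(1) by blast
  qed
  then show ?thesis using that by blast
qed

end

section \<open>Budgets of the nodes\<close>

context ortho_base
begin

lemma sum_opt_le:
  fixes h :: nat
  assumes sym: "\<And>i. i < h \<Longrightarrow> symmetric_arcs (A i)"
    and disj: "\<And>i j. i < j \<Longrightarrow> j < h \<Longrightarrow> A i \<inter> A j = {}"
  shows "(\<Sum>i<h. opt (A i)) \<le> opt (\<Union>i<h. A i)"
proof -
  obtain q where q: "valid q" "cost (\<Union>i<h. A i) q = opt (\<Union>i<h. A i)"
    by (rule opt_attained)
  have "(\<Sum>i<h. opt (A i)) \<le> (\<Sum>i<h. cost (A i) q)" by (rule sum_mono) (rule opt_le[OF q(1)])
  also have "\<dots> = cost (\<Union>i<h. A i) q"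
    by (rule cost_UN[symmetric]) (use sym disj in \<open>auto, metis Int_iff empty_iff nat_neq_iff\<close>)
  finally show ?thesis using q(2) by simp
qed

text \<open>An optimal rotation \<open>q0\<close> of the union is the common frame. Moving child
  \<open>i\<close> to an optimum of its own saves at least \<open>D i\<close>, the change of its
  turning between the poles, and \<open>D i\<close> new vertices on its single arc at
  \<open>s\<close> restore that turning.\<close>

lemma parallel_all:
  fixes h :: nat
  assumes sym: "\<And>i. i < h \<Longrightarrow> symmetric_arcs (A i)"
    and disj: "\<And>i j. i < j \<Longrightarrow> j < h \<Longrightarrow> A i \<inter> A j = {}"
    and ends: "\<And>i j. i < j \<Longrightarrow> j < h \<Longrightarrow> ends G (A i) \<inter> ends G (A j) \<subseteq> {s, t}"
    and st: "s \<noteq> t"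
    and s: "\<And>i. i < h \<Longrightarrow> card (A i \<inter> out_arcs G s) = 1"
    and t: "\<And>i. i < h \<Longrightarrow> A i \<inter> out_arcs G t \<noteq> {} \<and> aligned (A i) t"
  obtains z q k m where "\<And>i. i < h \<Longrightarrow> valid (z i)" "\<And>i. i < h \<Longrightarrow> cost (A i) (z i) = opt (A i)"
    "valid q" "subdivides M (\<Union>i<h. A i) k m"
    "\<And>i a. i < h \<Longrightarrow> a \<in> A i \<Longrightarrow> \<bar>bend q a\<bar> \<le> \<bar>bend (z i) a\<bar> + int (m (edge_of M a))"
    "k + (\<Sum>i<h. opt (A i)) \<le> opt (\<Union>i<h. A i)"
proof -
  let ?U = "\<Union>i<h. A i"
  have symU: "symmetric_arcs ?U" by (rule symmetric_arcs_UN) (use sym in auto)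
  obtain q0 where q0: "valid q0" "cost ?U q0 = opt ?U" by (rule opt_attained)
  have "\<forall>i\<in>{..<h}. \<exists>a. A i \<inter> out_arcs G s = {a}" using s by (simp add: card_1_singleton_iff)
  then obtain a1 where a1: "\<And>i. i < h \<Longrightarrow> A i \<inter> out_arcs G s = {a1 i}"
    using bchoice[of "{..<h}"] by (metis lessThan_iff)
  have "\<forall>i\<in>{..<h}. \<exists>a. a \<in> A i \<inter> out_arcs G t" using t by blast
  then obtain a2 where a2: "\<And>i. i < h \<Longrightarrow> a2 i \<in> A i \<inter> out_arcs G t"
    using bchoice[of "{..<h}"] by (metis lessThan_iff)
  define d where "d z i = nat \<bar>q0 (a2 i) - q0 (a1 i) - (z (a2 i) - z (a1 i))\<bar>" for z i
  have "\<exists>z. valid z \<and> cost (A i) z = opt (A i) \<and> d z i + opt (A i) \<le> cost (A i) q0"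
    if i: "i < h" for i
  proof -
    have "A i \<subseteq> arcs G" using sym[OF i] by (simp add: symmetric_arcs_def)
    from exchange[OF this q0(1), of "a2 i" "a1 i"] obtain z where "valid z" "cost (A i) z = opt (A i)"
      "\<bar>q0 (a2 i) - q0 (a1 i) - (z (a2 i) - z (a1 i))\<bar> + int (opt (A i)) \<le> int (cost (A i) q0)"
      by blast
    then show ?thesis by (intro exI[of _ z]) (simp add: d_def)
  qed
  then have "\<forall>i\<in>{..<h}. \<exists>z. valid z \<and> cost (A i) z = opt (A i) \<and> d z i + opt (A i) \<le> cost (A i) q0"
    by blast
  from bchoice[OF this] obtain z where z: "\<And>i. i < h \<Longrightarrow> valid (z i)"
    "\<And>i. i < h \<Longrightarrow> cost (A i) (z i) = opt (A i)"
    "\<And>i. i < h \<Longrightarrow> d (z i) i + opt (A i) \<le> cost (A i) q0" by auto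
  define D where "D i = d (z i) i" for i
  \<comment> \<open>Every replacement leaves both poles as in \<open>q0\<close>, so the children are
    replaced one after the other without interfering, each paying only its own
    \<open>D i\<close>.\<close>
  have "\<exists>q. valid q \<and> (\<forall>a. tail G a \<in> {s, t} \<longrightarrow> q a = q0 a) \<and>
      (\<forall>i<j. \<forall>a\<in>A i. \<bar>bend q a\<bar> \<le> \<bar>bend (z i) a\<bar> +
        (if a \<in> edge_of M (a1 i) then int (D i) else 0))" if "j \<le> h" for j
    using that
  proof (induction j)
    case 0
    show ?case using q0(1) by (intro exI[of _ q0]) simp
  next
    case (Suc j)
    then obtain q where q: "valid q" "\<And>a. tail G a \<in> {s, t} \<Longrightarrow> q a = q0 a"
      "\<And>i a. i < j \<Longrightarrow> a \<in> A i \<Longrightarrow> \<bar>bend q a\<bar> \<le> \<bar>bend (z i) a\<bar> +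
        (if a \<in> edge_of M (a1 i) then int (D i) else 0)"
      by (metis Suc_leD)
    have j: "j < h" using Suc.prems by simp
    obtain q' where q': "valid q'"
      "\<And>a. tail G a \<notin> ends G (A j) - {s, t} \<Longrightarrow> q' a = q a"
      "\<And>a. a \<in> A j \<Longrightarrow> \<bar>bend q' a\<bar> \<le> \<bar>bend (z j) a\<bar> + (if a \<in> edge_of M (a1 j)
        then \<bar>q (a2 j) - q (a1 j) - (z j (a2 j) - z j (a1 j))\<bar> else 0)"
      by (rule replace_part[OF sym[OF j] a1[OF j] a2[OF j] conjunct2[OF t[OF j]] st q(1) z(1)[OF j]])
        (rule that)
    have "q (a2 j) = q0 (a2 j)" "q (a1 j) = q0 (a1 j)"
      using q(2)[of "a1 j"] q(2)[of "a2 j"] a1[OF j] a2[OF j] by (auto simp: set_eq_iff)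
    then have new: "\<bar>bend q' a\<bar> \<le> \<bar>bend (z j) a\<bar> + (if a \<in> edge_of M (a1 j) then int (D j) else 0)"
      if "a \<in> A j" for a
      using q'(3)[OF that] by (auto simp: D_def d_def split: if_splits)
    have old: "bend q' a = bend q a" if i: "i < j" "a \<in> A i" for i a
    proof -
      have "q' b = q b" if "b \<in> A i" for b
        using ends[OF i(1) j] tail_in_ends[OF that] by (intro q'(2)) blast
      moreover have "rv M a \<in> A i" using symmetric_arcsD(2)[OF sym i(2)] i(1) j by simp
      ultimately show ?thesis using i(2) by (simp add: bend_def)
    qed
    have "\<bar>bend q' a\<bar> \<le> \<bar>bend (z i) a\<bar> + (if a \<in> edge_of M (a1 i) then int (D i) else 0)"
      if "i < Suc j" "a \<in> A i" for i a
    proof (cases "i = j")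
      case False
      then have "i < j" using that by simp
      then show ?thesis using old[OF _ that(2)] q(3)[OF _ that(2)] by simp
    next
      case True
      then show ?thesis using new[of a] that(2) by (simp only:)
    qed
    moreover have "q' a = q0 a" if "tail G a \<in> {s, t}" for a
      using q'(2)[of a] q(2)[OF that] that by auto
    ultimately show ?case using q'(1) by blast
  qed
  from this[OF order_refl] obtain q where q: "valid q"
    "\<And>i a. i < h \<Longrightarrow> a \<in> A i \<Longrightarrow> \<bar>bend q a\<bar> \<le> \<bar>bend (z i) a\<bar> +
        (if a \<in> edge_of M (a1 i) then int (D i) else 0)" by blast
  define m where "m E = (\<Sum>i<h. if E = edge_of M (a1 i) then D i else 0)" for E
  have a1U: "edge_of M (a1 i) \<in> edge_of M ` ?U" if "i < h" for i using a1[OF that] that by blast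
  have fin: "finite (edge_of M ` ?U)" using finite_symmetric_arcs[OF symU] by blast
  have "(\<Sum>E\<in>edge_of M ` ?U. m E) = (\<Sum>i<h. \<Sum>E\<in>edge_of M ` ?U. if E = edge_of M (a1 i) then D i else 0)"
    unfolding m_def by (rule sum.swap)
  also have "\<dots> = (\<Sum>i<h. D i)"
    using fin a1U by (intro sum.cong) auto
  finally have "(\<Sum>E\<in>edge_of M ` ?U. m E) = (\<Sum>i<h. D i)" .
  moreover have "m E = 0" if "E \<notin> edge_of M ` ?U" for E
    unfolding m_def by (rule sum.neutral) (use a1U that in auto)
  ultimately have "subdivides M ?U (\<Sum>i<h. D i) m" by (simp add: subdivides_def)
  moreover have "\<bar>bend q a\<bar> \<le> \<bar>bend (z i) a\<bar> + int (m (edge_of M a))" if i: "i < h" "a \<in> A i" for i a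
  proof -
    have "(if edge_of M a = edge_of M (a1 i) then D i else 0) \<le> m (edge_of M a)"
      unfolding m_def
      by (rule member_le_sum[of i "{..<h}" "\<lambda>i. if edge_of M a = edge_of M (a1 i) then D i else 0"])
        (use i in auto)
    moreover have "edge_of M a = edge_of M (a1 i)" if "a \<in> edge_of M (a1 i)"
      using that unfolding edge_of_eq_iff by (simp add: edge_of_def)
    ultimately show ?thesis using q(2)[OF i] by (auto split: if_splits)
  qed
  moreover have "(\<Sum>i<h. D i) + (\<Sum>i<h. opt (A i)) \<le> opt ?U"
  proof -
    have "(\<Sum>i<h. D i) + (\<Sum>i<h. opt (A i)) \<le> (\<Sum>i<h. cost (A i) q0)"
      unfolding sum.distrib[symmetric] by (rule sum_mono) (use z(3) in \<open>simp add: D_def\<close>)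
    also have "\<dots> = cost ?U q0"
      by (rule cost_UN[symmetric]) (use sym disj in \<open>auto, metis Int_iff empty_iff nat_neq_iff\<close>)
    finally show ?thesis using q0(2) by simp
  qed
  ultimately show ?thesis by (intro that[of z q "\<Sum>i<h. D i" m] z(1,2) q(1))
qed

text \<open>\<open>B\<close> may have several arcs at both poles and then cannot absorb rotation.
  Its optimum becomes the frame, and \<open>A\<close> alone makes up for the deviations of both
  children from \<open>q0\<close>; each child has saved its share.\<close>

lemma parallel_two:
  assumes A: "symmetric_arcs A" and B: "symmetric_arcs B" and disj: "A \<inter> B = {}"
    and ends: "ends G A \<inter> ends G B \<subseteq> {s, t}" and st: "s \<noteq> t"
    and s: "card (A \<inter> out_arcs G s) = 1" and t: "A \<inter> out_arcs G t \<noteq> {}" "aligned A t"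
  obtains z z' q k m where "valid z" "cost A z = opt A" "valid z'" "cost B z' = opt B"
    "valid q" "subdivides M (A \<union> B) k m"
    "\<And>a. a \<in> A \<Longrightarrow> \<bar>bend q a\<bar> \<le> \<bar>bend z a\<bar> + int (m (edge_of M a))"
    "\<And>a. a \<in> B \<Longrightarrow> \<bar>bend q a\<bar> \<le> \<bar>bend z' a\<bar> + int (m (edge_of M a))"
    "k + (opt A + opt B) \<le> opt (A \<union> B)"
proof -
  have sub: "A \<subseteq> arcs G" "B \<subseteq> arcs G" using A B by (auto simp: symmetric_arcs_def)
  obtain q0 where q0: "valid q0" "cost (A \<union> B) q0 = opt (A \<union> B)" by (rule opt_attained)
  obtain a1 where a1: "A \<inter> out_arcs G s = {a1}" using s by (auto simp: card_1_singleton_iff)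
  obtain a2 where a2: "a2 \<in> A \<inter> out_arcs G t" using t by blast
  obtain z where z: "valid z" "cost A z = opt A"
    "\<bar>q0 a2 - q0 a1 - (z a2 - z a1)\<bar> + int (opt A) \<le> int (cost A q0)"
    by (rule exchange[OF sub(1) q0(1)])
  \<comment> \<open>For \<open>B\<close>, too, rotations are compared at the arcs \<open>a1\<close>
    and \<open>a2\<close> of \<open>A\<close>, because it is \<open>A\<close> that has to fit
    between the poles as \<open>z'\<close> places them.\<close>
  obtain z' where z': "valid z'" "cost B z' = opt B"
    "\<bar>q0 a2 - q0 a1 - (z' a2 - z' a1)\<bar> + int (opt B) \<le> int (cost B q0)"
    by (rule exchange[OF sub(2) q0(1)])
  obtain q where q: "valid q" "\<And>a. tail G a \<notin> ends G A - {s, t} \<Longrightarrow> q a = z' a"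
    "\<And>a. a \<in> A \<Longrightarrow> \<bar>bend q a\<bar> \<le> \<bar>bend z a\<bar> +
       (if a \<in> edge_of M a1 then \<bar>z' a2 - z' a1 - (z a2 - z a1)\<bar> else 0)"
    by (rule replace_part[OF A a1 a2 t(2) st z'(1) z(1)]) (rule that)
  define k where "k = nat \<bar>z' a2 - z' a1 - (z a2 - z a1)\<bar>"
  define m where "m E = (if E = edge_of M a1 then k else 0)" for E
  have "finite (edge_of M ` (A \<union> B))"
    using finite_symmetric_arcs[OF symmetric_arcs_Un[OF A B]] by blast
  moreover have "edge_of M a1 \<in> edge_of M ` (A \<union> B)" using a1 by blast
  ultimately have "subdivides M (A \<union> B) k m" by (auto simp: subdivides_def m_def)
  moreover have "\<bar>bend q a\<bar> \<le> \<bar>bend z a\<bar> + int (m (edge_of M a))" if "a \<in> A" for a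
  proof -
    have "edge_of M a = edge_of M a1" if "a \<in> edge_of M a1"
      using that unfolding edge_of_eq_iff by (simp add: edge_of_def)
    then show ?thesis using q(3)[OF that] by (auto simp: m_def k_def split: if_splits)
  qed
  moreover have "\<bar>bend q a\<bar> \<le> \<bar>bend z' a\<bar> + int (m (edge_of M a))" if a: "a \<in> B" for a
  proof -
    have "q b = z' b" if "b \<in> B" for b
      using ends tail_in_ends[OF that] by (intro q(2)) blast
    then have "bend q a = bend z' a" using a symmetric_arcsD(2)[OF B a] by (simp add: bend_def)
    then show ?thesis by simp
  qed
  moreover have "k + (opt A + opt B) \<le> opt (A \<union> B)"
  proof -
    have "cost (\<Union>i\<in>{True, False}. if i then A else B) q0
        = (\<Sum>i\<in>{True, False}. cost (if i then A else B) q0)"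
      by (rule cost_UN) (use A B disj in auto)
    then have "cost A q0 + cost B q0 = opt (A \<union> B)" using q0(2) by (simp add: Un_commute)
    then show ?thesis using z(3) z'(3) unfolding k_def by linarith
  qed
  ultimately show ?thesis by (rule that[OF z(1,2) z'(1,2) q(1)])
qed

text \<open>The alternatives in \<open>cond\<close> have different sources: the degree bound at an
  inner P-node, the single arcs at the ends of the reference path at the root.\<close>

lemma parallel_budget:
  assumes dec: "\<And>i. i < length ts \<Longrightarrow> decomposes G M (ts ! i) s t"
    and pair: "\<And>i j. i < j \<Longrightarrow> j < length ts \<Longrightarrow>
       node_arcs M (ts ! i) \<inter> node_arcs M (ts ! j) = {} \<and>
       ends G (node_arcs M (ts ! i)) \<inter> ends G (node_arcs M (ts ! j)) = {s, t}"
    and bs: "length bs = length ts" "\<And>i. i < length ts \<Longrightarrow> bs ! i = opt (node_arcs M (ts ! i))"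
    and cond: "length ts = 3 \<and> (\<forall>i<3. card (node_arcs M (ts ! i) \<inter> out_arcs G s) = 1 \<and>
          aligned (node_arcs M (ts ! i)) t) \<or>
      length ts = 2 \<and> (\<exists>i<2. card (node_arcs M (ts ! i) \<inter> out_arcs G s) = 1 \<and>
          aligned (node_arcs M (ts ! i)) t)"
  shows "budget G M (PNode ts) bs + sum_list bs = opt (node_arcs M (PNode ts))"
proof -
  let ?A = "\<lambda>i. node_arcs M (ts ! i)"
  have basic: "s \<noteq> t" "symmetric_arcs (?A i)" "?A i \<inter> out_arcs G t \<noteq> {}" if "i < length ts" for i
    using decomposes_basic[OF dec[OF that]] by auto
  have ne: "ts \<noteq> []" using cond by auto
  have U: "node_arcs M (PNode ts) = (\<Union>i<length ts. ?A i)"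
    by (rule node_arcs_children) (use ne in auto)
  obtain z q k m where r: "\<And>i. i < length ts \<Longrightarrow> valid (z i)"
    "\<And>i. i < length ts \<Longrightarrow> cost (?A i) (z i) = opt (?A i)"
    "valid q" "subdivides M (\<Union>i<length ts. ?A i) k m"
    "\<And>i a. i < length ts \<Longrightarrow> a \<in> ?A i \<Longrightarrow> \<bar>bend q a\<bar> \<le> \<bar>bend (z i) a\<bar> + int (m (edge_of M a))"
    "k + (\<Sum>i<length ts. opt (?A i)) \<le> opt (\<Union>i<length ts. ?A i)"
  proof (cases "length ts = 3")
    case True
    then have three: "\<And>i. i < length ts \<Longrightarrow> card (?A i \<inter> out_arcs G s) = 1 \<and> aligned (?A i) t"
      using cond by auto
    show ?thesis
    proof (rule parallel_all[of "length ts" ?A s t])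
      show "s \<noteq> t" using basic(1)[of 0] ne by simp
      show "symmetric_arcs (?A i)" if "i < length ts" for i by (rule basic(2)[OF that])
      show "?A i \<inter> ?A j = {}" if "i < j" "j < length ts" for i j using pair[OF that] by blast
      show "ends G (?A i) \<inter> ends G (?A j) \<subseteq> {s, t}" if "i < j" "j < length ts" for i j
        using pair[OF that] by blast
      show "card (?A i \<inter> out_arcs G s) = 1" if "i < length ts" for i using three[OF that] by blast
      show "?A i \<inter> out_arcs G t \<noteq> {} \<and> aligned (?A i) t" if "i < length ts" for i
        using three[OF that] basic(3)[OF that] by blast
    qed (rule that)
  next
    case False
    then have len: "length ts = 2" and "\<exists>i<2. card (?A i \<inter> out_arcs G s) = 1 \<and> aligned (?A i) t"
      using cond by auto
    then obtain i where i: "i < 2" "card (?A i \<inter> out_arcs G s) = 1" "aligned (?A i) t"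
      by blast
    define j where "j = 1 - i"
    have j: "j < 2" "i \<noteq> j" "{..<2} = {i, j}" using less_2_cases[OF i(1)] by (auto simp: j_def)
    have ij: "?A i \<inter> ?A j = {} \<and> ends G (?A i) \<inter> ends G (?A j) = {s, t}"
    proof (cases "i < j")
      case True
      then show ?thesis using pair[of i j] j(1) len by simp
    next
      case False
      then show ?thesis using pair[of j i] i(1) j len by (simp add: Int_commute)
    qed
    obtain z z' q k m where r: "valid z" "cost (?A i) z = opt (?A i)" "valid z'"
      "cost (?A j) z' = opt (?A j)" "valid q" "subdivides M (?A i \<union> ?A j) k m"
      "\<And>a. a \<in> ?A i \<Longrightarrow> \<bar>bend q a\<bar> \<le> \<bar>bend z a\<bar> + int (m (edge_of M a))"
      "\<And>a. a \<in> ?A j \<Longrightarrow> \<bar>bend q a\<bar> \<le> \<bar>bend z' a\<bar> + int (m (edge_of M a))"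
      "k + (opt (?A i) + opt (?A j)) \<le> opt (?A i \<union> ?A j)"
    proof (rule parallel_two[of "?A i" "?A j" s t])
      show "symmetric_arcs (?A i)" "symmetric_arcs (?A j)" "?A i \<inter> out_arcs G t \<noteq> {}" "s \<noteq> t"
        using basic[of i] basic[of j] i(1) j(1) len by auto
      show "?A i \<inter> ?A j = {}" "ends G (?A i) \<inter> ends G (?A j) \<subseteq> {s, t}" using ij by auto
    qed (rule i(2), rule i(3), rule that)
    have idx: "l = j" if "l < length ts" "l \<noteq> i" for l using that j(3) len by auto
    have U2: "(\<Union>l<length ts. ?A l) = ?A i \<union> ?A j" unfolding len j(3) by simp
    have S2: "(\<Sum>l<length ts. opt (?A l)) = opt (?A i) + opt (?A j)"
      unfolding len j(3) using j(2) by simp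
    show ?thesis
    proof (rule that[of "\<lambda>l. if l = i then z else z'" q k m])
      show "valid q" by (rule r(5))
      show "valid (if l = i then z else z')" for l using r(1,3) by simp
      show "cost (?A l) (if l = i then z else z') = opt (?A l)" if "l < length ts" for l
        using r(2,4) idx[OF that] by (cases "l = i") simp_all
      show "\<bar>bend q a\<bar> \<le> \<bar>bend (if l = i then z else z') a\<bar> + int (m (edge_of M a))"
        if "l < length ts" "a \<in> ?A l" for l a
        using r(7,8) idx[OF that(1)] that(2) by (cases "l = i") simp_all
      show "subdivides M (\<Union>l<length ts. ?A l) k m" unfolding U2 by (rule r(6))
      show "k + (\<Sum>l<length ts. opt (?A l)) \<le> opt (\<Union>l<length ts. ?A l)"
        unfolding U2 S2 by (rule r(9))
    qed
  qed
  show ?thesis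
  proof (rule budget_opt[where ts = ts and z = z and q = q and k = k and m = m])
    show "children (PNode ts) = ts" by simp
    show "subdivides M (node_arcs M (PNode ts)) k m" unfolding U by (rule r(4))
    show "k + (\<Sum>i<length ts. opt (?A i)) \<le> opt (node_arcs M (PNode ts))" unfolding U by (rule r(6))
  qed (fact U basic(2) bs r)+
qed

lemma series_budget:
  assumes ne: "ts \<noteq> []"
    and dec: "\<And>i. i < length ts \<Longrightarrow> decomposes G M (ts ! i) (ws ! i) (ws ! (i + 1))"
    and disj: "\<And>i j. i < j \<Longrightarrow> j < length ts \<Longrightarrow> node_arcs M (ts ! i) \<inter> node_arcs M (ts ! j) = {}"
    and ends: "\<And>i j. i < j \<Longrightarrow> j < length ts \<Longrightarrow>
       ends G (node_arcs M (ts ! i)) \<inter> ends G (node_arcs M (ts ! j)) \<subseteq> {ws ! j}"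
    and bs: "length bs = length ts" "\<And>i. i < length ts \<Longrightarrow> bs ! i = opt (node_arcs M (ts ! i))"
  shows "budget G M (SNode ts) bs + sum_list bs = opt (node_arcs M (SNode ts))"
proof -
  let ?A = "\<lambda>i. node_arcs M (ts ! i)"
  have sym: "symmetric_arcs (?A i)" if "i < length ts" for i
    using decomposes_basic[OF dec[OF that]] by auto
  have U: "node_arcs M (SNode ts) = (\<Union>i<length ts. ?A i)"
    by (rule node_arcs_children) (use ne in auto)
  have "\<forall>i. \<exists>z. valid z \<and> cost (?A i) z = opt (?A i)" using opt_attained by metis
  then obtain z where z: "\<And>i. valid (z i)" "\<And>i. cost (?A i) (z i) = opt (?A i)" by metis
  obtain q where q: "valid q" "\<And>i a. i < length ts \<Longrightarrow> a \<in> ?A i \<Longrightarrow> bend q a = bend (z i) a"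
    by (rule glue_chain[of "length ts" ?A "(!) ws" z, OF sym ends disj z(1)]) (rule that | assumption)+
  show ?thesis
  proof (rule budget_opt[where ts = ts and z = z and q = q and k = 0 and m = "\<lambda>_. 0"])
    show "children (SNode ts) = ts" by simp
    show "subdivides M (node_arcs M (SNode ts)) 0 (\<lambda>_. 0)" by (simp add: subdivides_def)
    show "0 + (\<Sum>i<length ts. opt (?A i)) \<le> opt (node_arcs M (SNode ts))"
      unfolding U using sum_opt_le[of "length ts" ?A] sym disj by simp
    show "\<bar>bend q a\<bar> \<le> \<bar>bend (z i) a\<bar> + int 0" if "i < length ts" "a \<in> ?A i" for i a
      using q(2)[OF that] by simp
  qed (fact U sym bs | rule z q(1))+
qed

lemma pole_degree:
  fixes h :: nat
  assumes disj: "\<And>i j. i < j \<Longrightarrow> j < h \<Longrightarrow> A i \<inter> A j = {}"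
    and b: "b \<in> arcs G" "tail G b = v" "\<And>i. i < h \<Longrightarrow> b \<notin> A i"
  shows "(\<Sum>i<h. card (A i \<inter> out_arcs G v)) + 1 \<le> out_degree G v" "out_degree G v \<le> 4"
proof -
  have "(\<Sum>i<h. card (A i \<inter> out_arcs G v)) = card (\<Union>i<h. A i \<inter> out_arcs G v)"
    by (rule card_UN_disjoint[symmetric]) (use disj in \<open>auto, metis Int_iff empty_iff nat_neq_iff\<close>)
  also have "\<dots> + 1 = card (insert b (\<Union>i<h. A i \<inter> out_arcs G v))"
    using b(3) by (subst card_insert_disjoint) auto
  also have "\<dots> \<le> out_degree G v"
    unfolding out_degree_def by (rule card_mono) (use b in auto)
  finally show "(\<Sum>i<h. card (A i \<inter> out_arcs G v)) + 1 \<le> out_degree G v" .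
  show "out_degree G v \<le> 4" using four b by (auto simp: four_graph_def)
qed

text \<open>An arc outside the subgraph leaves at most three arcs of the subgraph at each pole; this
  provides the children with a single arc at \<open>s\<close> that absorbs rotation.\<close>

lemma cumulative_budget_opt:
  assumes "decomposes G M T s t" "proper_node T"
    and "\<exists>b\<in>arcs G - node_arcs M T. tail G b = s" "\<exists>b\<in>arcs G - node_arcs M T. tail G b = t"
  shows "cumulative_budget G M T = opt (node_arcs M T)"
  using assms
proof (induction rule: decomposes.induct)
  case (QStar p s t)
  then show ?case using opt_path[OF QStar(2)] by simp
next
  case (SNode ts ws)
  let ?A = "\<lambda>i. node_arcs M (ts ! i)"
  let ?h = "length ts - 1"
  have h: "0 < length ts" "?h + 1 = length ts" "ts \<noteq> []" using SNode.hyps(1) by auto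
  have basic: "symmetric_arcs (?A i)" "?A i \<inter> out_arcs G (ws ! i) \<noteq> {}"
    "?A i \<inter> out_arcs G (ws ! (i + 1)) \<noteq> {}" "\<And>a. a \<in> ?A i \<Longrightarrow> tail G a \<noteq> head G a"
    if "i < length ts" for i
    using decomposes_basic[OF SNode.hyps(3)[OF that]] by auto
  have U: "node_arcs M (SNode ts) = (\<Union>i<length ts. ?A i)"
    by (rule node_arcs_children) (use h in auto)
  have hd: "hd ws = ws ! 0" and last: "last ws = ws ! (?h + 1)"
    using SNode.hyps(1,2) by (auto simp: hd_conv_nth last_conv_nth simp flip: length_greater_0_conv)
  have ends: "ends G (?A i) \<inter> ends G (?A j) \<subseteq> {ws ! j}" if "i < j" "j < length ts" for i j
    using SNode.hyps(4)[OF that] by (auto split: if_splits)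
  have disj: "?A i \<inter> ?A j = {}" if "i < j" "j < length ts" for i j
  proof (rule loopless_disjoint[OF basic(1) basic(1) ends[OF that]])
    show i: "i < length ts" using that by simp
    show "tail G a \<noteq> head G a" if "a \<in> ?A i" for a using basic(4)[OF i that] .
  qed (rule that(2))
  have IH: "cumulative_budget G M (ts ! i) = opt (?A i)" if i: "i < length ts" for i
  proof (rule SNode.IH[OF i])
    show "proper_node (ts ! i)" using SNode.prems(1) i by simp
    show "\<exists>b\<in>arcs G - ?A i. tail G b = ws ! i"
    proof (cases i)
      case 0
      then show ?thesis using SNode.prems(2) i unfolding U hd by blast
    next
      case (Suc l)
      \<comment> \<open>At an inner cut vertex of the series composition the neighbouring child
        supplies the outside arc.\<close>
      have l: "l < i" "l < length ts" using Suc i by auto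
      have "?A l \<inter> out_arcs G (ws ! i) \<noteq> {}" using basic(3)[OF l(2)] Suc by simp
      then obtain b where "b \<in> ?A l \<inter> out_arcs G (ws ! i)" by blast
      then show ?thesis using disj[OF l(1) i] by (intro bexI[of _ b]) auto
    qed
    show "\<exists>b\<in>arcs G - ?A i. tail G b = ws ! (i + 1)"
    proof (cases "i = ?h")
      case True
      then show ?thesis using SNode.prems(3) i unfolding U last by blast
    next
      case False
      then have i1: "i + 1 < length ts" using i by simp
      then obtain b where "b \<in> ?A (i + 1) \<inter> out_arcs G (ws ! (i + 1))"
        using basic(2)[of "i + 1"] by blast
      then show ?thesis using disj[of i "i + 1"] i1 by (intro bexI[of _ b]) auto
    qed
  qed
  have "budget G M (SNode ts) (map (cumulative_budget G M) ts)
      + sum_list (map (cumulative_budget G M) ts) = opt (node_arcs M (SNode ts))"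
    by (rule series_budget[of ts ws]) (fact h(3) SNode.hyps(3) disj ends | simp add: IH)+
  then show ?case by (simp add: Let_def)
next
  case (PNode ts s t)
  let ?A = "\<lambda>i. node_arcs M (ts ! i)"
  have h: "ts \<noteq> []" "2 \<le> length ts" using PNode.hyps(1) by auto
  have basic: "?A i \<inter> out_arcs G s \<noteq> {}" "?A i \<inter> out_arcs G t \<noteq> {}" if "i < length ts" for i
    using decomposes_basic[OF PNode.hyps(2)[OF that]] by auto
  have U: "node_arcs M (PNode ts) = (\<Union>i<length ts. ?A i)"
    by (rule node_arcs_children) (use h in auto)
  have pair: "?A i \<inter> ?A j = {} \<and> ends G (?A i) \<inter> ends G (?A j) = {s, t}"
    if "i < j" "j < length ts" for i j
    using PNode.hyps(3)[OF that] .
  have card: "1 \<le> card (?A i \<inter> out_arcs G s)" "1 \<le> card (?A i \<inter> out_arcs G t)" if "i < length ts" for i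
    using basic[OF that] by (auto simp: Suc_le_eq card_gt_0_iff)
  have IH: "cumulative_budget G M (ts ! i) = opt (?A i)" if i: "i < length ts" for i
  proof (rule PNode.IH[OF i])
    show "proper_node (ts ! i)" using PNode.prems(1) i by simp
    show "\<exists>b\<in>arcs G - ?A i. tail G b = s" using PNode.prems(2) i unfolding U by blast
    show "\<exists>b\<in>arcs G - ?A i. tail G b = t" using PNode.prems(3) i unfolding U by blast
  qed
  obtain b c where b: "b \<in> arcs G" "tail G b = s" "\<And>i. i < length ts \<Longrightarrow> b \<notin> ?A i"
    and c: "c \<in> arcs G" "tail G c = t" "\<And>i. i < length ts \<Longrightarrow> c \<notin> ?A i"
    using PNode.prems(2,3) unfolding U by blast
  have ds: "(\<Sum>i<length ts. card (?A i \<inter> out_arcs G s)) + 1 \<le> out_degree G s" "out_degree G s \<le> 4"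
    using pole_degree[of "length ts" ?A b s] b pair by auto
  have dt: "(\<Sum>i<length ts. card (?A i \<inter> out_arcs G t)) + 1 \<le> out_degree G t" "out_degree G t \<le> 4"
    using pole_degree[of "length ts" ?A c t] c pair by auto
  have "length ts = 3 \<and> (\<forall>i<3. card (?A i \<inter> out_arcs G s) = 1 \<and> aligned (?A i) t) \<or>
      length ts = 2 \<and> (\<exists>i<2. card (?A i \<inter> out_arcs G s) = 1 \<and> aligned (?A i) t)"
  proof -
    have "length ts = 3 \<or> length ts = 2" using PNode.prems(1) by auto
    then show ?thesis
    proof
      assume three: "length ts = 3"
      \<comment> \<open>Three nonempty shares and one outside arc exhaust degree 4.\<close>
      have "card (?A i \<inter> out_arcs G s) = 1 \<and> card (?A i \<inter> out_arcs G t) \<le> 1" if "i < 3" for i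
      proof -
        from that have "i = 0 \<or> i = 1 \<or> i = 2" by linarith
        then show ?thesis
          using ds dt card[of 0] card[of 1] card[of 2] three
          by (auto simp: eval_nat_numeral lessThan_Suc)
      qed
      then show ?thesis using three by (simp add: aligned_def)
    next
      assume two: "length ts = 2"
      have "card (?A 0 \<inter> out_arcs G s) = 1 \<or> card (?A 1 \<inter> out_arcs G s) = 1"
        using ds card[of 0] card[of 1] two by (auto simp: eval_nat_numeral lessThan_Suc)
      \<comment> \<open>If a child has two arcs at \<open>t\<close>, then these, one arc of the
        other child and the outside arc make up degree 4, and \<open>t\<close> is rigid.\<close>
      moreover have "aligned (?A 0) t \<and> aligned (?A 1) t"
        using dt card[of 0] card[of 1] two
        by (auto simp: eval_nat_numeral lessThan_Suc aligned_def)
      ultimately have "\<exists>i<2. card (?A i \<inter> out_arcs G s) = 1 \<and> aligned (?A i) t"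
        by (metis one_less_numeral_iff pos2 semiring_norm(76))
      then show ?thesis using two by simp
    qed
  qed
  then have "budget G M (PNode ts) (map (cumulative_budget G M) ts)
      + sum_list (map (cumulative_budget G M) ts) = opt (node_arcs M (PNode ts))"
    by (intro parallel_budget[of ts s t]) (use PNode.hyps(2) pair IH in auto)
  then show ?case by (simp add: Let_def)
qed

end

section \<open>The root\<close>

lemma attachable_append:
  "attachable G V (p @ q) \<longleftrightarrow> attachable G V p \<and> attachable G (V \<union> (tail G ` set p \<union> head G ` set p)) q"
  by (induction p arbitrary: V) (auto simp: insert_commute Un_commute)

context ortho_base
begin

text \<open>Without the arc \<open>c\<close>, the path \<open>p\<close> consists of two chains hanging off the poles of \<open>C\<close>,
  which can be straightened for free.\<close>

lemma opt_without_arc: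
  assumes p: "apath s p t" and c: "c \<in> set p"
    and C: "symmetric_arcs C" "ends G (set p \<union> rv M ` set p) \<inter> ends G C = {s, t}"
    and all: "arcs G = (set p \<union> rv M ` set p) \<union> C"
    and disj: "(set p \<union> rv M ` set p) \<inter> C = {}"
  shows "opt (arcs G - {c, rv M c}) = opt C"
proof (rule antisym)
  let ?B = "arcs G - {c, rv M c}"
  have path: "cas s p t" "set p \<subseteq> arcs G" "distinct (awalk_verts s p)"
    using p by (auto simp: apath_def awalk_def)
  have C_B: "C \<subseteq> ?B" using all disj c by auto
  have fin: "finite (edge_of M ` ?B)" using finite_arcs by blast
  show "opt C \<le> opt ?B"
  proof -
    obtain q where q: "valid q" "cost ?B q = opt ?B" by (rule opt_attained)
    have "cost C q \<le> cost ?B q"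
      unfolding cost_def using C_B fin by (intro sum_mono2) auto
    then show ?thesis using opt_le[OF q(1), of C] q(2) by simp
  qed
  obtain p1 p2 where split: "p = p1 @ c # p2" using split_list[OF c] by blast
  define u v where "u = tail G c" and "v = head G c"
  have cas: "cas s p1 u" "cas v p2 t"
    using path(1) awlast_if_cas by (auto simp: split cas_append_iff u_def v_def)
  have verts: "awalk_verts s p = awalk_verts s p1 @ awalk_verts v p2"
    using awalk_verts_append_cas[of s p1 "c # p2" t] path(1) by (simp add: split v_def)
  have disj12: "set (awalk_verts s p1) \<inter> set (awalk_verts v p2) = {}"
    and dist: "distinct (awalk_verts s p1)" "distinct (awalk_verts v p2)"
    using path(3) unfolding verts by auto
  have "set (awalk_verts s p) = tail G ` set p \<union> head G ` set p"
    using set_awalk_verts_not_Nil_cas[OF path(1)] length_pos_if_in_set[OF c] by simp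
  then have "set (awalk_verts s p) \<subseteq> ends G (set p \<union> rv M ` set p)" by (auto simp: ends_def)
  then have meet: "(set (awalk_verts s p1) \<union> set (awalk_verts v p2)) \<inter> ends G C \<subseteq> {s, t}"
    using C(2) unfolding verts by auto
  have s1: "s \<in> set (awalk_verts s p1)" and t2: "t \<in> set (awalk_verts v p2)"
    using set_awalk_verts_cas[OF cas(1)] awlast_if_cas[OF cas(2)] last_in_set[of "awalk_verts v p2"]
    by auto
  \<comment> \<open>The second half of the path hangs off \<open>C\<close> at \<open>t\<close>,
    hence is attached backwards from there.\<close>
  let ?r = "rev (map (rv M) p2)"
  have p2: "set p2 \<subseteq> arcs G" using path(2) by (simp add: split)
  have "attachable G (ends G C) p1"
    by (rule attachable_path[OF cas(1) dist(1)]) (use meet disj12 t2 in blast)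
  moreover have "attachable G (ends G C \<union> (tail G ` set p1 \<union> head G ` set p1)) ?r"
  proof (rule attachable_path[OF reverse_path(1)[OF cas(2) p2]])
    show "distinct (awalk_verts t ?r)" using dist(2) reverse_path(2)[OF cas(2) p2] by simp
    have "tail G ` set p1 \<union> head G ` set p1 \<subseteq> set (awalk_verts s p1)"
      using set_awalk_verts_cas[OF cas(1)] by auto
    then show "set (awalk_verts t ?r) \<inter> (ends G C \<union> (tail G ` set p1 \<union> head G ` set p1)) \<subseteq> {t}"
      using reverse_path(2)[OF cas(2) p2] meet disj12 s1 by auto
  qed
  ultimately have "attachable G (ends G C) (p1 @ ?r)" by (simp add: attachable_append)
  moreover obtain z where z: "valid z" "cost C z = opt C" by (rule opt_attained)
  moreover have "set (p1 @ ?r) \<subseteq> arcs G" using path(2) p2 by (auto simp: split)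
  ultimately obtain q where q: "valid q" "\<forall>a\<in>C. bend q a = bend z a" "\<forall>a\<in>set (p1 @ ?r). bend q a = 0"
    using attach_zero[OF C(1), of z "p1 @ ?r"] by blast
  have zero: "bend q a = 0" if a: "a \<in> ?B" "a \<notin> C" for a
  proof -
    have "a \<in> arcs G" "a \<in> set p \<union> rv M ` set p" "a \<noteq> c" "a \<noteq> rv M c" using a all by auto
    then have "a \<in> set (p1 @ ?r) \<or> rv M a \<in> set (p1 @ ?r)" by (auto simp: split)
    then show ?thesis using q(3) bend_rv[OF \<open>a \<in> arcs G\<close>, of q] by fastforce
  qed
  have "cost C q = cost ?B q"
    unfolding cost_def
  proof (rule sum.mono_neutral_left[OF fin])
    show "\<forall>E\<in>edge_of M ` ?B - edge_of M ` C. edge_bends q E = 0"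
    proof
      fix E assume "E \<in> edge_of M ` ?B - edge_of M ` C"
      then obtain a where a: "E = edge_of M a" "a \<in> ?B" "a \<notin> C" by blast
      from zero[OF a(2,3)] show "edge_bends q E = 0" using a(1,2) by (simp add: edge_bends_edge)
    qed
  qed (use C_B in blast)
  moreover have "cost C q = cost C z"
    by (rule cost_cong) (use q(2) C(1) in \<open>auto simp: symmetric_arcs_def\<close>)
  ultimately show "opt ?B \<le> opt C" using opt_le[OF q(1), of ?B] z(2) by simp
qed

text \<open>Only net bends enter the rotation, so an edge of \<open>R\<close> that bends back and
  forth can only cost more.\<close>

lemma opt_le_bends:
  assumes B: "symmetric_arcs B" and R: "orthogonal_representation G M R"
  shows "opt B \<le> (\<Sum>a\<in>B. length (bends R a)) div 2"
proof -
  have "ortho_solution G M (\<lambda>a. int (angle R a div 90)) (\<lambda>a. net_bends (bends R a))"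
    using finite_face faces_subset by (intro orthogonal_representation_solution[OF R]) auto
  then obtain q where q: "valid q" "\<And>a. a \<in> arcs G \<Longrightarrow> bend q a = net_bends (bends R a)"
    by (rule solution_valid) (rule that)
  have "2 * cost B q = (\<Sum>a\<in>B. edge_bends q (edge_of M a))"
    unfolding cost_def using B by (intro sum_edges[symmetric]) (auto simp: symmetric_arcs_def)
  also have "\<dots> \<le> (\<Sum>a\<in>B. length (bends R a))"
  proof (rule sum_mono)
    fix a assume "a \<in> B"
    then have "a \<in> arcs G" by (rule symmetric_arcsD(1)[OF B])
    then show "edge_bends q (edge_of M a) \<le> length (bends R a)"
      using q(2) abs_net_bends_le[of "bends R a"] by (simp add: edge_bends_edge nat_le_iff)
  qed
  finally show ?thesis using opt_le[OF q(1), of B] by linarith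
qed

lemma opt_representation:
  assumes B: "symmetric_arcs B"
  obtains R where "orthogonal_representation G M R" "(\<Sum>a\<in>B. length (bends R a)) div 2 = opt B"
proof -
  obtain q where q: "valid q" "cost B q = opt B" by (rule opt_attained)
  define R where "R = \<lparr>angle = \<lambda>a. nat (90 * (al0 a + q (nxt M a) - q a)), bends = \<lambda>a. bend_list (bend q a)\<rparr>"
  have "orthogonal_representation G M R"
    unfolding R_def using finite_face faces_subset
    by (intro ortho_solution_representation[OF valid_solution[OF q(1)]]) auto
  moreover have "(\<Sum>a\<in>B. length (bends R a)) = 2 * opt B"
  proof -
    have "(\<Sum>a\<in>B. length (bends R a)) = (\<Sum>a\<in>B. edge_bends q (edge_of M a))"
      by (rule sum.cong) (use symmetric_arcsD(1)[OF B] in \<open>auto simp: R_def bend_list_def edge_bends_edge\<close>)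
    also have "\<dots> = 2 * cost B q"
      unfolding cost_def using B by (intro sum_edges) (auto simp: symmetric_arcs_def)
    finally show ?thesis using q(2) by simp
  qed
  ultimately show ?thesis using that by simp
qed

text \<open>With a drawn reference edge the root is a parallel composition in which the reference
  path absorbs rotation. With a dummy edge the drawn rest of that path is straight at no cost, so
  the other child alone determines the optimum and no root budget is due.\<close>

lemma root_cumulative_budget_opt:
  assumes T: "spq_tree G M e T"
  shows "root_cumulative_budget G M dummy T = opt (arcs (drawn_graph G M e dummy))"
proof -
  obtain s t t1 t2 p where dec: "decomposes G M T s t" and arcs: "node_arcs M T = arcs G"
    and T': "T = PNode [t1, t2]" and proper: "proper_node t1" "proper_node t2"
    and p: "QStar p \<in> {t1, t2}" and e: "e \<in> node_arcs M (QStar p)"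
    using T unfolding spq_tree_def by blast
  let ?ts = "[t1, t2]"
  have child: "decomposes G M (?ts ! i) s t" if "i < 2" for i
    using dec that unfolding T' by (cases rule: decomposes.cases) auto
  have pair: "node_arcs M t1 \<inter> node_arcs M t2 = {} \<and>
      ends G (node_arcs M t1) \<inter> ends G (node_arcs M t2) = {s, t}"
    using dec unfolding T'
  proof cases
    case PNode
    from PNode(3)[of 0 1] show ?thesis by simp
  qed
  have dec12: "decomposes G M t1 s t" "decomposes G M t2 s t"
    using child[of 0] child[of 1] by auto
  note basic = decomposes_basic[OF dec12(1)] decomposes_basic[OF dec12(2)]
  have U: "arcs G = node_arcs M t1 \<union> node_arcs M t2" using arcs by (simp add: T')
  \<comment> \<open>Each child of the root finds its outside arcs in the other child.\<close>
  have outside: "\<exists>b\<in>arcs G - X. tail G b = v" if "X \<inter> Y = {}" "Y \<inter> out_arcs G v \<noteq> {}" for X Y v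
    using that by fastforce
  have "cumulative_budget G M t1 = opt (node_arcs M t1)"
    by (rule cumulative_budget_opt[OF dec12(1) proper(1)])
      (rule outside[of _ "node_arcs M t2"]; use basic pair in blast)+
  moreover have "cumulative_budget G M t2 = opt (node_arcs M t2)"
    by (rule cumulative_budget_opt[OF dec12(2) proper(2)])
      (rule outside[of _ "node_arcs M t1"]; use basic pair in blast)+
  ultimately have bs: "map (cumulative_budget G M) (children T) = map (\<lambda>x. opt (node_arcs M x)) ?ts"
    by (simp add: T')
  have qstar: "apath s p t" "p \<noteq> []" if "decomposes G M (QStar p) s t"
    using that by (cases rule: decomposes.cases, auto)+
  have dp: "decomposes G M (QStar p) s t" using p dec12 by auto
  note single = apath_arcs[OF qstar[OF dp]]
  show ?thesis
  proof (cases dummy)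
    case False
    have "\<exists>i<2. ?ts ! i = QStar p" using p by (auto intro: exI[of _ 0] exI[of _ 1])
    then obtain i where i: "i < 2" "?ts ! i = QStar p" by blast
    have pair': "node_arcs M (?ts ! i) \<inter> node_arcs M (?ts ! j) = {} \<and>
       ends G (node_arcs M (?ts ! i)) \<inter> ends G (node_arcs M (?ts ! j)) = {s, t}"
      if "i < j" "j < length ?ts" for i j
    proof -
      have "i = 0" "j = 1" using that by auto
      then show ?thesis using pair by simp
    qed
    have "card (node_arcs M (?ts ! i) \<inter> out_arcs G s) = 1 \<and> aligned (node_arcs M (?ts ! i)) t"
      unfolding i(2) aligned_def using single(2,3) by simp
    then have single_child: "length ?ts = 2 \<and>
        (\<exists>i<2. card (node_arcs M (?ts ! i) \<inter> out_arcs G s) = 1 \<and> aligned (node_arcs M (?ts ! i)) t)"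
      using i(1) by auto
    have "budget G M (PNode ?ts) (map (\<lambda>x. opt (node_arcs M x)) ?ts)
        + sum_list (map (\<lambda>x. opt (node_arcs M x)) ?ts) = opt (node_arcs M (PNode ?ts))"
    proof (rule parallel_budget[of ?ts s t])
      show "decomposes G M (?ts ! i) s t" if "i < length ?ts" for i using child[of i] that by simp
      show "map (\<lambda>x. opt (node_arcs M x)) ?ts ! i = opt (node_arcs M (?ts ! i))"
        if "i < length ?ts" for i
        using that by (rule nth_map)
    qed (fact pair' length_map disjI2[OF single_child])+
    then show ?thesis
      unfolding root_cumulative_budget_def bs using False arcs
      by (simp add: T' drawn_graph_def Let_def)
  next
    case True
    have "e \<in> set p \<or> rv M e \<in> set p" using e by auto
    \<comment> \<open>The path runs from \<open>s\<close> to \<open>t\<close> and may traverse the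
      reference edge against \<open>e\<close>.\<close>
    then obtain c where c: "c \<in> set p" "{e, rv M e} = {c, rv M c}"
      by (metis insert_commute rv_rv)
    have drawn: "arcs (drawn_graph G M e dummy) = arcs G - {c, rv M c}"
      unfolding c(2)[symmetric] using True
      by (auto simp: drawn_graph_def pre_digraph.del_arc_def)
    have node: "node_arcs M (QStar p) = set p \<union> rv M ` set p" by simp
    have zero: "opt (node_arcs M (QStar p)) = 0" using opt_path[OF qstar(1)[OF dp]] by simp
    obtain C where C: "arcs G = (set p \<union> rv M ` set p) \<union> C" "(set p \<union> rv M ` set p) \<inter> C = {}"
      "ends G (set p \<union> rv M ` set p) \<inter> ends G C = {s, t}" "symmetric_arcs C"
      "sum_list (map (\<lambda>x. opt (node_arcs M x)) ?ts) = opt C"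
    proof (cases "t1 = QStar p")
      case True
      show ?thesis
      proof (rule that)
        show "arcs G = (set p \<union> rv M ` set p) \<union> node_arcs M t2" using U unfolding True node .
        show "(set p \<union> rv M ` set p) \<inter> node_arcs M t2 = {}"
          "ends G (set p \<union> rv M ` set p) \<inter> ends G (node_arcs M t2) = {s, t}"
          using pair unfolding True node by (rule conjunct1, rule conjunct2)
        show "symmetric_arcs (node_arcs M t2)" using basic(2) by blast
        show "sum_list (map (\<lambda>x. opt (node_arcs M x)) ?ts) = opt (node_arcs M t2)"
          using zero unfolding True by (simp del: node_arcs.simps)
      qed
    next
      case False
      then have t2: "t2 = QStar p" using p by simp
      show ?thesis
      proof (rule that)
        show "arcs G = (set p \<union> rv M ` set p) \<union> node_arcs M t1"
          using U unfolding t2 node by (simp only: Un_commute)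
        show "(set p \<union> rv M ` set p) \<inter> node_arcs M t1 = {}"
          "ends G (set p \<union> rv M ` set p) \<inter> ends G (node_arcs M t1) = {s, t}"
          using pair unfolding t2 node by (simp_all only: Int_commute)
        show "symmetric_arcs (node_arcs M t1)" using basic(1) by blast
        show "sum_list (map (\<lambda>x. opt (node_arcs M x)) ?ts) = opt (node_arcs M t1)"
          using zero unfolding t2 by (simp del: node_arcs.simps)
      qed
    qed
    have "opt (arcs G - {c, rv M c}) = opt C"
      by (rule opt_without_arc[OF qstar(1)[OF dp] c(1) C(4,3,1,2)])
    then show ?thesis
      unfolding root_cumulative_budget_def bs drawn using True C(5) by (simp add: Let_def)
  qed
qed

end

theorem theorem3:
  fixes G :: "('v, 'd) pre_digraph" and M :: "'d embedding"
    and e :: 'd and dummy :: bool and T :: "'d spq"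
  assumes "plane_graph G M"
    and "four_graph G"
    and "reference_edge G M e dummy"
    and "series_parallel (drawn_graph G M e dummy) M"
    and "spq_tree G M e T"
  shows "(\<exists>R. bend_minimum G M e dummy R) \<and>
    (\<forall>R. bend_minimum G M e dummy R \<longrightarrow>
       root_cumulative_budget G M dummy T = num_bends G M e dummy R)"
proof -
  interpret plane_graph G M by fact
  have "symmetric_arcs (arcs G)" by (simp add: symmetric_arcs_def)
  \<comment> \<open>The tree covers all vertices, so none is isolated; an isolated one would have
    angle sum 0 and admit no representation.\<close>
  then have "tail G ` arcs G = verts G"
    using assms(5) by (simp add: spq_tree_def ends_symmetric)
  then have "out_arcs G v \<noteq> {}" if "v \<in> verts G" for v
    using that by (force simp: out_arcs_def)
  then obtain al x where "ortho_solution G M al x"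
    using ortho_solution_exists[OF assms(2)] by blast
  then interpret ortho_base G M al x using assms(2) by unfold_locales
  define B where "B = arcs (drawn_graph G M e dummy)"
  have B: "symmetric_arcs B"
    by (auto simp: B_def drawn_graph_def symmetric_arcs_def pre_digraph.del_arc_def arev_eq_iff)
  have bends: "num_bends G M e dummy R = (\<Sum>a\<in>B. length (bends R a)) div 2" for R
    by (simp add: num_bends_def B_def)
  obtain R0 where R0: "orthogonal_representation G M R0" "num_bends G M e dummy R0 = opt B"
    using opt_representation[OF B] unfolding bends by blast
  have le: "opt B \<le> num_bends G M e dummy R" if "orthogonal_representation G M R" for R
    unfolding bends by (rule opt_le_bends[OF B that])
  have "bend_minimum G M e dummy R0" using R0 le by (simp add: bend_minimum_def)
  moreover have "num_bends G M e dummy R = opt B" if "bend_minimum G M e dummy R" for R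
    using that R0 le[of R] by (metis bend_minimum_def order_antisym)
  moreover have "root_cumulative_budget G M dummy T = opt B"
    unfolding B_def by (rule root_cumulative_budget_opt[OF assms(5)])
  ultimately show ?thesis by auto
qed

end
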